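(* Let $q,p\in\mathbb{N}$ (positive integers) and let $\mathbb{G}_{qp}$ be the associated Reiter-Heisenberg group. Then: 1. The cut locus of the origin is $$\operatorname{Cut}(\mathbb{G}_{qp})=\big\{(x,0,t)\in\mathbb{G}_{qp}:\ t\notin\operatorname{Im}x\ \text{ and }\ |P_{\operatorname{Im}x}^\perp t|\ge\pi|x^\dagger t|^2\big\}.$$ 2. If $p\ge2$, then all cut points are conjugate points. 3. A cut point $(x,0,t)$ is reached (from the origin) by a unique unit-speed length-minimizing curve if and only if the equality $|P_{\operatorname{Im}x}^\perp t|=\pi|x^\dagger t|^2$ holds. 4. The distance $d(x,0,t)$ from the origin of a cut point $(x,0,t)$ is $$d(x,0,t)=\sqrt{|x|^2+4\pi|P_{\operatorname{Im}x}^\perp t|}.$$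
   Context: Group. For positive integers $q,p$ let $V_1=\mathbb{R}^{q\times p}\times\mathbb{R}^{p\times 1}$, $V_2=\mathbb{R}^{q\times 1}$ and let $\mathbb{G}_{qp}=V_1\times V_2$ be the step-2 Carnot group (Reiter-Heisenberg group) with product $(x,y,t)\cdot(\xi,\eta,\tau)=\big(x+\xi,\,y+\eta,\,t+\tau+Q((x,y),(\xi,\eta))\big)$, where $Q((x,y),(\xi,\eta))=\tfrac12(x\eta-\xi y)$. On $V_1$ use the inner product $\langle(x,y),(\xi,\eta)\rangle=\operatorname{trace}(x^T\xi)+y^T\eta$; all matrix norms are Hilbert-Schmidt norms. Horizontal curves and length. A horizontal curve is a Lipschitz curve $\gamma=(x,y,t):[0,T]\to V_1\times V_2$ with $(\dot x,\dot y)=(u,v)$ and $\dot t=Q((x,y),(u,v))$ a.e., for some $L^\infty$ control $(u,v):[0,T]\to V_1$. Its speed is $\sqrt{|u|^2+|v|^2}$ and its length is $\int_0^T\sqrt{|u|^2+|v|^2}\,ds$. The sub-Riemannian distance is the infimum of lengths of horizontal curves joining two points; $d(x,y,t)$ denotes the distance of $(x,y,t)$ from the origin $(0,0,0)$. A horizontal curve minimizes length on $[0,\bar s]$ if its length on $[0,\bar s]$ equals the distance between its endpoints. Extremals. For $\tau\in\mathbb{R}^q$ let $A_\tau:V_1\to V_1$, $A_\tau(\xi,\eta)=(\tau\eta^T,-\xi^T\tau)$. For $(\xi,\eta,\tau)\in V_1\times V_2\simeq T^*_{(0,0,0)}\mathbb{G}_{qp}$, the length-extremal $\gamma(\cdot,\xi,\eta,\tau):\mathbb{R}\to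 V_1\times V_2$ is the horizontal curve with $\gamma(0,\xi,\eta,\tau)=(0,0,0)$ and control $(u(s),v(s))=e^{-sA_\tau}(\xi,\eta)$ (equivalently, the projection of the solution of the sub-Riemannian normal Hamiltonian system with initial point the origin and initial covector $(\xi,\eta,\tau)$). Cut time and cut locus. For $(\xi,\eta)\neq0$, $t_{\rm cut}(\xi,\eta,\tau)=\sup\{\bar s>0:\gamma(\cdot,\xi,\eta,\tau)\text{ minimizes length on }[0,\bar s]\}\in\,]0,+\infty]$. The cut locus $\operatorname{Cut}(\mathbb{G}_{qp})$ of the origin is the set of cut points, i.e. points $\gamma(t_{\rm cut}(\xi,\eta,\tau),\xi,\eta,\tau)$ with $(\xi,\eta)\neq0$ and $t_{\rm cut}(\xi,\eta,\tau)<+\infty$; the origin $(0,0,0)$ is not included. Conjugate times and points. Given an extremal $\gamma(\cdot,\bar\xi,\bar\eta,\bar\tau)$ with $(\bar\xi,\bar\eta)\ne0$, a time $\bar s>0$ is a conjugate time for it if the differential of the map $(\xi,\eta,\tau)\in\mathbb{G}_{qp}\mapsto\gamma(\bar s,\xi,\eta,\tau)\in\mathbb{G}_{qp}$ is singular at $(\bar\xi,\bar\eta,\bar\tau)$. A cut point $\gamma(t_{\rm cut}(\xi,\eta,\tau),\xi,\eta,\tau)$ is a conjugate point if $t_{\rm cut}(\xi,\eta,\tau)$ is a conjugate time for $\gamma(\cdot,\xi,\eta,\tau)$. Linear algebra. For $x\in\mathbb{R}^{q\times p}$, $\operatorname{Im}x=\{xy:y\in\mathbb{R}^p\}\subset\mathbb{R}^q$;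 $P_{\operatorname{Im}x}$ and $P_{\operatorname{Im}x}^\perp$ are the orthogonal projections of $\mathbb{R}^q$ onto $\operatorname{Im}x$ and onto its orthogonal complement; $x^\dagger\in\mathbb{R}^{p\times q}$ is the Moore-Penrose inverse of $x$: for $t\in\mathbb{R}^q$, $x^\dagger t$ is uniquely determined by $xx^\dagger t=P_{\operatorname{Im}x}t$ and $x^\dagger t\perp\ker x$. *)

theory Defs
  imports "HOL-Analysis.Analysis"
begin

text \<open>A \<open>q \<times> p\<close> matrix is an element of \<^typ>\<open>real^'p^'q\<close>; columns are vectors.  The library norm and
  inner product on \<^typ>\<open>real^'p^'q\<close> and on products are the Hilbert-Schmidt and the Euclidean
  ones, so \<open>V\<^sub>1\<close> carries the required inner product.\<close>

type_synonym ('q, 'p) V1 = "(real^'p^'q) \<times> (real^'p)"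
type_synonym ('q, 'p) RH = "(real^'p^'q) \<times> (real^'p) \<times> (real^'q)"

definition rhQ :: "('q::finite, 'p::finite) V1 \<Rightarrow> ('q, 'p) V1 \<Rightarrow> real^'q"
  where "rhQ = (\<lambda>(x, y) (\<xi>, \<eta>). (1/2) *\<^sub>R (x *v \<eta> - \<xi> *v y))"

text \<open>The group law is recorded to fix the convention for \<open>rhQ\<close>; its left-invariant horizontal
  distribution is the one given by \<open>horizontal_velocity\<close>.\<close>

definition rh_mult :: "('q::finite, 'p::finite) RH \<Rightarrow> ('q, 'p) RH \<Rightarrow> ('q, 'p) RH"
  where "rh_mult = (\<lambda>(x, y, t) (\<xi>, \<eta>, \<tau>). (x + \<xi>, y + \<eta>, t + \<tau> + rhQ (x, y) (\<xi>, \<eta>)))"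


subsection \<open>Horizontal curves, length and distance\<close>

definition horizontal_velocity :: "('q::finite, 'p::finite) RH \<Rightarrow> ('q, 'p) V1 \<Rightarrow> ('q, 'p) RH"
  where "horizontal_velocity = (\<lambda>(x, y, t) (u, v). (u, v, rhQ (x, y) (u, v)))"

definition horizontal_curve ::
    "real \<Rightarrow> (real \<Rightarrow> ('q::finite, 'p::finite) RH) \<Rightarrow> (real \<Rightarrow> ('q, 'p) V1) \<Rightarrow> bool"
  where "horizontal_curve T \<gamma> w \<longleftrightarrow>
    T > 0 \<and>
    (\<exists>L. L-lipschitz_on {0..T} \<gamma>) \<and>
    set_borel_measurable lebesgue {0..T} w \<and>
    (\<exists>C. AE s\<in>{0..T} in lebesgue. norm (w s) \<le> C) \<and>
    (AE s\<in>{0..T} in lebesgue.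
       (\<gamma> has_vector_derivative horizontal_velocity (\<gamma> s) (w s)) (at s within {0..T}))"

text \<open>The length is a function of the control; by \<open>control_length_unique\<close> below it only depends on
  the curve.\<close>

definition control_length :: "real \<Rightarrow> (real \<Rightarrow> ('q::finite, 'p::finite) V1) \<Rightarrow> real"
  where "control_length T w = (LINT s:{0..T}|lebesgue. norm (w s))"

definition rh_dist :: "('q::finite, 'p::finite) RH \<Rightarrow> ('q, 'p) RH \<Rightarrow> real"
  where "rh_dist g h =
    Inf {control_length T w | T \<gamma> w. horizontal_curve T \<gamma> w \<and> \<gamma> 0 = g \<and> \<gamma> T = h}"

definition minimizes_length :: "real \<Rightarrow> (real \<Rightarrow> ('q::finite, 'p::finite) RH) \<Rightarrow> bool"
  where "minimizes_length T \<gamma> \<longleftrightarrow>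
    (\<exists>w. horizontal_curve T \<gamma> w \<and> control_length T w = rh_dist (\<gamma> 0) (\<gamma> T))"

definition unit_speed :: "real \<Rightarrow> (real \<Rightarrow> ('q::finite, 'p::finite) RH) \<Rightarrow> bool"
  where "unit_speed T \<gamma> \<longleftrightarrow>
    (\<exists>w. horizontal_curve T \<gamma> w \<and> (AE s\<in>{0..T} in lebesgue. norm (w s) = 1))"

definition unit_speed_minimizer ::
    "('q::finite, 'p::finite) RH \<Rightarrow> real \<Rightarrow> (real \<Rightarrow> ('q, 'p) RH) \<Rightarrow> bool"
  where "unit_speed_minimizer g T \<gamma> \<longleftrightarrow>
    \<gamma> 0 = 0 \<and> \<gamma> T = g \<and> unit_speed T \<gamma> \<and> minimizes_length T \<gamma>"

text \<open>Curves are total functions on the reals, so uniqueness is up to values outside \<open>[0, T]\<close>.\<close>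

definition unique_unit_speed_minimizer :: "('q::finite, 'p::finite) RH \<Rightarrow> bool"
  where "unique_unit_speed_minimizer g \<longleftrightarrow>
    (\<exists>T \<gamma>. unit_speed_minimizer g T \<gamma> \<and>
      (\<forall>T' \<gamma>'. unit_speed_minimizer g T' \<gamma>' \<longrightarrow> T' = T \<and> (\<forall>s\<in>{0..T}. \<gamma>' s = \<gamma> s)))"


subsection \<open>Length-extremals, cut and conjugate points\<close>

definition A_op :: "real^'q::finite \<Rightarrow> ('q, 'p::finite) V1 \<Rightarrow> ('q, 'p) V1"
  where "A_op \<tau> = (\<lambda>(\<xi>, \<eta>). (\<chi> i j. \<tau> $ i * \<eta> $ j, - (transpose \<xi> *v \<tau>)))"

text \<open>The control \<open>exp (- s A\<^sub>\<tau>) (\<xi>, \<eta>)\<close>, as the exponential series applied to \<open>(\<xi>, \<eta>)\<close>.\<close>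

definition extremal_control :: "('q::finite, 'p::finite) RH \<Rightarrow> real \<Rightarrow> ('q, 'p) V1"
  where "extremal_control = (\<lambda>(\<xi>, \<eta>, \<tau>) s.
    (\<Sum>n. ((- s) ^ n / fact n) *\<^sub>R (A_op \<tau> ^^ n) (\<xi>, \<eta>)))"

text \<open>The horizontal curve through the origin with this control, obtained by integrating it; see
  \<open>horizontal_curve_extremal\<close> below.\<close>

definition extremal_horizontal_part :: "('q::finite, 'p::finite) RH \<Rightarrow> real \<Rightarrow> ('q, 'p) V1"
  where "extremal_horizontal_part \<zeta> s = (LBINT r=0..s. extremal_control \<zeta> r)"

definition extremal :: "('q::finite, 'p::finite) RH \<Rightarrow> real \<Rightarrow> ('q, 'p) RH"
  where "extremal \<zeta> s =
    (fst (extremal_horizontal_part \<zeta> s), snd (extremal_horizontal_part \<zeta> s),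
     LBINT r=0..s. rhQ (extremal_horizontal_part \<zeta> r) (extremal_control \<zeta> r))"

definition cut_time :: "('q::finite, 'p::finite) RH \<Rightarrow> ereal"
  where "cut_time \<zeta> = Sup {ereal s | s. s > 0 \<and> minimizes_length s (extremal \<zeta>)}"

definition cut_locus :: "('q::finite, 'p::finite) RH set"
  where "cut_locus = {extremal (\<xi>, \<eta>, \<tau>) s | \<xi> \<eta> \<tau> s.
    (\<xi>, \<eta>) \<noteq> 0 \<and> cut_time (\<xi>, \<eta>, \<tau>) = ereal s}"

text \<open>The group and the covector space at the origin are the same coordinate space, so the
  differential is an endomorphism, and singular means not invertible.\<close>

definition conjugate_time :: "('q::finite, 'p::finite) RH \<Rightarrow> real \<Rightarrow> bool"
  where "conjugate_time \<zeta> s \<longleftrightarrow>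
    s > 0 \<and> (\<exists>D. ((\<lambda>\<omega>. extremal \<omega> s) has_derivative D) (at \<zeta>) \<and> \<not> bij D)"


subsection \<open>Projections and the Moore-Penrose inverse\<close>

definition mat_im :: "real^'p^'q \<Rightarrow> (real^'q) set"
  where "mat_im x = range (\<lambda>y. x *v y)"

definition proj_on :: "'a::real_inner set \<Rightarrow> 'a \<Rightarrow> 'a"
  where "proj_on S t = (THE w. w \<in> S \<and> (\<forall>z\<in>S. orthogonal (t - w) z))"

definition moore_penrose :: "real^'p^'q \<Rightarrow> real^'q^'p"
  where "moore_penrose x = (THE z. \<forall>t.
    x *v (z *v t) = proj_on (mat_im x) t \<and> (\<forall>k. x *v k = 0 \<longrightarrow> orthogonal (z *v t) k))"

lemma control_length_unique:
  assumes "horizontal_curve T \<gamma> w" "horizontal_curve T \<gamma> w'"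
  shows "control_length T w = control_length T w'"
proof -
  have T: "T > 0" using assms by (simp add: horizontal_curve_def)
  have "AE s\<in>{0..T} in lebesgue. w s = w' s"
  proof -
    have 1: "AE s\<in>{0..T} in lebesgue.
        (\<gamma> has_vector_derivative horizontal_velocity (\<gamma> s) (w s)) (at s within {0..T})"
      and 2: "AE s\<in>{0..T} in lebesgue.
        (\<gamma> has_vector_derivative horizontal_velocity (\<gamma> s) (w' s)) (at s within {0..T})"
      using assms by (auto simp: horizontal_curve_def)
    show ?thesis
    proof (rule AE_mp[OF 1], rule AE_mp[OF 2], rule AE_I2, intro impI)
      fix s assume s: "s \<in> {0..T}"
        and "s \<in> {0..T} \<longrightarrow>
          (\<gamma> has_vector_derivative horizontal_velocity (\<gamma> s) (w' s)) (at s within {0..T})"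
        and "s \<in> {0..T} \<longrightarrow>
          (\<gamma> has_vector_derivative horizontal_velocity (\<gamma> s) (w s)) (at s within {0..T})"
      then have "horizontal_velocity (\<gamma> s) (w s) = horizontal_velocity (\<gamma> s) (w' s)"
        using T by (auto intro: vector_derivative_unique_within_closed_interval)
      then show "w s = w' s"
        by (auto simp: horizontal_velocity_def split: prod.splits)
    qed
  qed
  then have "AE s in lebesgue. indicator {0..T} s *\<^sub>R norm (w s) = indicator {0..T} s *\<^sub>R norm (w' s)"
    by (auto simp: indicator_def elim!: eventually_mono)
  moreover have "(\<lambda>s. indicator {0..T} s *\<^sub>R norm (v s)) \<in> borel_measurable lebesgue"
    if "horizontal_curve T \<gamma> v" for v
  proof -
    have "(\<lambda>s. indicator {0..T} s *\<^sub>R v s) \<in> borel_measurable lebesgue"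
      using that by (simp add: horizontal_curve_def set_borel_measurable_def)
    then have "(\<lambda>s. norm (indicator {0..T} s *\<^sub>R v s)) \<in> borel_measurable lebesgue"
      by (rule measurable_compose) (auto intro!: borel_measurable_continuous_onI continuous_intros)
    then show ?thesis by (simp add: indicator_def if_distrib cong: if_cong)
  qed
  ultimately show ?thesis
    unfolding control_length_def set_lebesgue_integral_def using assms by (intro integral_cong_AE) auto
qed

lemma linear_A_op: "linear (A_op \<tau>)"
  by (rule linearI)
    (auto simp: A_op_def vec_eq_iff algebra_simps transpose_def matrix_vector_mult_def
      sum.distrib sum_distrib_left)

lemma continuous_on_extremal_control:
  fixes \<zeta> :: "('q::finite, 'p::finite) RH"
  shows "continuous_on S (extremal_control \<zeta>)"
proof -
  obtain \<xi> \<eta> \<tau> where \<zeta>: "\<zeta> = (\<xi>, \<eta>, \<tau>)" by (cases \<zeta>)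
  let ?L = "A_op \<tau> :: ('q, 'p) V1 \<Rightarrow> ('q, 'p) V1" and ?v = "(\<xi>, \<eta>)"
  let ?f = "\<lambda>n s. ((- s) ^ n / fact n) *\<^sub>R (?L ^^ n) ?v"
  have "linear ?L" by (rule linear_A_op)
  then obtain K where K: "K > 0" "\<And>v. norm (?L v) \<le> norm v * K"
    by (auto simp: mult.commute elim: linear_bounded_pos)
  have pow: "norm ((?L ^^ n) ?v) \<le> K ^ n * norm ?v" for n
  proof (induction n)
    case (Suc n)
    have "norm (?L ((?L ^^ n) ?v)) \<le> norm ((?L ^^ n) ?v) * K" by (rule K)
    also have "\<dots> \<le> (K ^ n * norm ?v) * K" using Suc K(1) by (intro mult_right_mono) auto
    finally show ?case by (simp add: ac_simps)
  qed simp
  have cont: "continuous_on {-R<..<R} (\<lambda>s. \<Sum>n. ?f n s)" for R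
  proof (rule uniform_limit_theorem[OF _ Weierstrass_m_test[where M = "\<lambda>n. norm ?v * ((R * K) ^ n / fact n)"]])
    show "\<forall>\<^sub>F n in sequentially. continuous_on {-R<..<R} (\<lambda>s. \<Sum>i<n. ?f i s)"
      by (intro always_eventually allI continuous_intros) auto
    show "summable (\<lambda>n. norm ?v * ((R * K) ^ n / fact n))"
      using summable_exp[of "R * K"] by (intro summable_mult) (simp add: field_simps)
    fix n s assume "s \<in> {-R<..<R}"
    then have s: "\<bar>s\<bar> ^ n \<le> R ^ n" by (intro power_mono) auto
    have "norm (?f n s) = (\<bar>s\<bar> ^ n / fact n) * norm ((?L ^^ n) ?v)"
      by (simp add: power_abs)
    also have "\<dots> \<le> (R ^ n / fact n) * (K ^ n * norm ?v)"
    proof (intro mult_mono divide_right_mono s pow)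
      have "0 \<le> \<bar>s\<bar> ^ n" by simp
      also note s
      finally show "0 \<le> R ^ n / fact n" by simp
    qed auto
    finally show "norm (?f n s) \<le> norm ?v * ((R * K) ^ n / fact n)"
      by (simp add: power_mult_distrib ac_simps)
  qed auto
  have "isCont (\<lambda>s. \<Sum>n. ?f n s) s" for s
    using cont[of "\<bar>s\<bar> + 1"]
    by (rule continuous_on_interior) (auto simp: interior_open)
  then show ?thesis
    by (auto simp: \<zeta> extremal_control_def intro!: continuous_at_imp_continuous_on)
qed

lemma continuous_on_rhQ:
  assumes "continuous_on S f" "continuous_on S g"
  shows "continuous_on S (\<lambda>s. rhQ (f s) (g s))"
  unfolding rhQ_def case_prod_beta matrix_vector_mult_def
  by (intro continuous_intros assms)

lemma has_vector_derivative_LBINT: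
  fixes f :: "real \<Rightarrow> 'a::euclidean_space"
  assumes "continuous_on UNIV f"
  shows "((\<lambda>s. LBINT r=0..s. f r) has_vector_derivative f s) (at s)"
proof -
  let ?a = "- \<bar>s\<bar> - 1" and ?b = "\<bar>s\<bar> + 1"
  have "((\<lambda>u. LBINT r=ereal 0..u. f r) has_vector_derivative f s) (at s within {?a..?b})"
    by (rule interval_integral_FTC2) (auto intro: continuous_on_subset[OF assms])
  then have "((\<lambda>u. LBINT r=ereal 0..u. f r) has_vector_derivative f s) (at s within {?a<..<?b})"
    by (rule has_vector_derivative_within_subset) auto
  moreover have "at s within {?a<..<?b} = at s"
    by (rule at_within_open) auto
  ultimately show ?thesis by (simp add: zero_ereal_def)
qed

lemma extremal_0 [simp]: "extremal \<zeta> 0 = 0"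
  by (simp add: extremal_def extremal_horizontal_part_def zero_prod_def flip: zero_ereal_def)

lemma extremal_has_vector_derivative:
  "(extremal \<zeta> has_vector_derivative
     horizontal_velocity (extremal \<zeta> s) (extremal_control \<zeta> s)) (at s)"
proof -
  let ?h = "extremal_horizontal_part \<zeta>" and ?w = "extremal_control \<zeta>"
  have h: "(?h has_vector_derivative ?w s) (at s)" for s
    unfolding extremal_horizontal_part_def
    by (rule has_vector_derivative_LBINT[OF continuous_on_extremal_control])
  then have ch: "continuous_on UNIV ?h"
    by (meson continuous_at_imp_continuous_on has_vector_derivative_continuous)
  have "continuous_on UNIV (\<lambda>r. rhQ (?h r) (?w r))"
    by (intro continuous_on_rhQ ch continuous_on_extremal_control)
  from has_vector_derivative_LBINT[OF this, of s]
  have "((\<lambda>s. (fst (?h s), snd (?h s), LBINT r=0..s. rhQ (?h r) (?w r)))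
      has_vector_derivative (fst (?w s), snd (?w s), rhQ (?h s) (?w s))) (at s)"
    using h[of s]
    by (intro has_vector_derivative_Pair bounded_linear.has_vector_derivative[OF bounded_linear_fst]
        bounded_linear.has_vector_derivative[OF bounded_linear_snd])
  then show ?thesis
    by (simp add: extremal_def[abs_def] horizontal_velocity_def case_prod_beta)
qed

lemma horizontal_curve_extremal:
  assumes "T > 0"
  shows "horizontal_curve T (extremal \<zeta>) (extremal_control \<zeta>)"
proof -
  let ?w = "extremal_control \<zeta>"
  let ?D = "\<lambda>s. horizontal_velocity (extremal \<zeta> s) (?w s)"
  have w: "continuous_on {0..T} ?w" by (rule continuous_on_extremal_control)
  have g: "continuous_on {0..T} (extremal \<zeta>)"
    using extremal_has_vector_derivative
    by (meson continuous_at_imp_continuous_on has_vector_derivative_continuous)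
  have D: "continuous_on {0..T} ?D"
    unfolding horizontal_velocity_def case_prod_beta
    by (intro continuous_intros continuous_on_rhQ g w)
  obtain B where B: "\<And>s. s \<in> {0..T} \<Longrightarrow> norm (?D s) \<le> B"
    using compact_imp_bounded[OF compact_continuous_image[OF D compact_Icc]]
    unfolding bounded_iff by blast
  obtain C where C: "\<And>s. s \<in> {0..T} \<Longrightarrow> norm (?w s) \<le> C"
    using compact_imp_bounded[OF compact_continuous_image[OF w compact_Icc]]
    unfolding bounded_iff by blast
  have "B-lipschitz_on {0..T} (extremal \<zeta>)"
  proof (rule bounded_derivative_imp_lipschitz)
    fix s assume "s \<in> {0..T}"
    show "(extremal \<zeta> has_derivative (\<lambda>h. h *\<^sub>R ?D s)) (at s within {0..T})"
      using has_vector_derivative_at_within[OF extremal_has_vector_derivative]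
      by (simp only: has_vector_derivative_def)
    show "onorm (\<lambda>h. h *\<^sub>R ?D s) \<le> B"
      using B[OF \<open>s \<in> _\<close>] by (simp add: onorm_scaleR_left bounded_linear_ident onorm_id)
  next
    have "0 \<le> norm (?D 0)" by simp
    also have "\<dots> \<le> B" using assms by (intro B) auto
    finally show "0 \<le> B" .
  qed auto
  then have "\<exists>L. L-lipschitz_on {0..T} (extremal \<zeta>)" ..
  moreover have "set_borel_measurable lebesgue {0..T} ?w"
    using w borel_measurable_continuous_on_indicator[of "{0..T}" ?w]
    by (auto simp: set_borel_measurable_def intro!: measurable_completion)
  moreover have "(extremal \<zeta> has_vector_derivative ?D s) (at s within {0..T})" for s
    by (rule has_vector_derivative_at_within[OF extremal_has_vector_derivative])
  moreover have "\<exists>C. AE s\<in>{0..T} in lebesgue. norm (?w s) \<le> C"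
    using C by (intro exI[of _ C] AE_I2) auto
  ultimately show ?thesis
    using assms unfolding horizontal_curve_def by (intro conjI) simp_all
qed

end

theory Submission
  imports Defs
begin

text \<open>The map \<open>A\<^sub>\<tau>\<close> is skew with \<open>A\<^sub>\<tau>\<^sup>3 = - |\<tau>|\<^sup>2 A\<^sub>\<tau>\<close>.  Write \<open>\<tau> = \<omega> \<theta>\<close> with \<open>|\<theta>| = 1\<close>, \<open>J = - A\<^sub>\<theta>\<close> and
  \<open>P = - J\<^sup>2\<close>.  Then \<open>P\<close> is the orthogonal projection of \<open>V\<^sub>1\<close> onto the pairs \<open>(\<theta> a\<^sup>T, v)\<close>, on which \<open>J\<close>
  is a complex structure, and \<open>J\<close> vanishes on the complement.  The control \<open>exp (- s A\<^sub>\<tau>) w\<close> thus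
  consists of the constant \<open>w - P w\<close> and of \<open>P w\<close> turning at speed \<open>\<omega>\<close>: the horizontal part of an
  extremal is the sum of a straight line and a circle, which closes up at \<open>T = 2 \<pi> / \<omega>\<close>.  At that
  time the extremal is at a point \<open>(x, 0, t)\<close> with \<open>x\<^sup>T \<theta> = 0\<close>, and \<open>t\<close> is the sum of a multiple of \<open>\<theta>\<close>,
  the area of the circle, and of a vector of \<open>Im x\<close>, produced by the interaction of the line with
  the circle.  Comparing the two summands gives the inequality in the description of the
  cut locus (\<open>extremal_at_period\<close>, \<open>endpoint_at_cut_time\<close>); conversely the initial covector can be
  chosen so as to reach any prescribed \<open>x\<close> and \<open>t\<close> that satisfy it (\<open>extremal_to_cut_point\<close>).

  The cut time is \<open>T\<close>.  Up to \<open>T\<close> the extremal is minimal by an isoperimetric inequality: a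
  horizontal curve of length \<open>l\<close> from the origin to \<open>(x, 0, t)\<close> satisfies
  \<open>l\<^sup>2 \<ge> |x|\<^sup>2 + 4 \<pi> \<langle>\<theta>, t\<rangle>\<close> for every unit vector \<open>\<theta>\<close> orthogonal to \<open>Im x\<close>.  This is proved by a
  calibration: the velocity is compared by the Cauchy-Schwarz inequality with a vector field that
  depends on position and arc length and equals the velocity on the minimizers; the rest is an exact
  derivative (\<open>calibration_integral\<close>, \<open>length_lower_bound\<close>).  After \<open>T\<close> minimality fails.  Extremals
  are critical points of the energy minus \<open>\<langle>\<tau>, t\<rangle>\<close>, which is a quadratic functional of the
  horizontal part, so a perturbation that keeps the endpoint changes the energy exactly by its own
  value of this functional; on an interval longer than \<open>T\<close> a circle makes it negative
  (\<open>perturbation_shortens\<close>, \<open>not_minimizing_after_period\<close>).  If \<open>A\<^sub>\<tau> w = 0\<close> the extremal is a straight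
  line and has no cut point.

  The length of the extremal at \<open>T\<close> is the value of the isoperimetric bound, which is the distance
  formula.  Equality in the calibration forces the velocity to be the calibrating field, so every
  unit-speed minimizer to a cut point is an extremal with the covector component \<open>\<tau> = (2 \<pi> / T) \<theta>\<close>
  (\<open>unit_speed_minimizer_is_extremal\<close>).  If the inequality for the cut point is an equality, the endpoint
  determines the rest of the covector, with \<open>\<eta> = 0\<close>; otherwise \<open>\<eta> \<noteq> 0\<close>, and \<open>- \<eta>\<close> gives a second minimizer.
  Finally, the endpoint at time \<open>T\<close> depends on \<open>\<eta>\<close> through \<open>|\<eta>|\<^sup>2\<close> only, so its differential
  vanishes in the directions \<open>(0, v, 0)\<close> with \<open>v \<bottom> \<eta>\<close>; such \<open>v \<noteq> 0\<close> exist as soon as \<open>p \<ge> 2\<close>.\<close>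

section \<open>Lipschitz functions and their derivatives almost everywhere\<close>

text \<open>The difference quotients of \<open>F\<close> are bounded by the Lipschitz constant and converge to \<open>f\<close> almost
  everywhere, while their integrals converge to \<open>F b - F a\<close> because a primitive of \<open>F\<close> is differentiable at
  \<open>a\<close> and \<open>b\<close>; dominated convergence identifies the limits.\<close>
lemma lipschitz_FTC:
  fixes F :: "real \<Rightarrow> 'a::euclidean_space"
  assumes "a \<le> b" and lip: "L-lipschitz_on {a..b} F" and N: "negligible N"
    and der: "\<And>s. s \<in> {a..b} - N \<Longrightarrow> (F has_vector_derivative f s) (at s within {a..b})"
  shows "(f has_integral (F b - F a)) {a..b}"
proof -
  \<comment> \<open>\<open>H\<close> extends \<open>F\<close> by constants, so that the difference quotients make sense up to \<open>b\<close>.\<close>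
  define H where "H s = F (max a (min b s))" for s
  have Hlip: "dist (H s) (H r) \<le> L * dist s r" for s r
  proof -
    have "dist (H s) (H r) \<le> L * dist (max a (min b s)) (max a (min b r))"
      unfolding H_def using lip \<open>a \<le> b\<close> by (intro lipschitz_onD) auto
    also have "\<dots> \<le> L * dist s r"
      using lipschitz_on_nonneg[OF lip] by (intro mult_left_mono) (auto simp: dist_real_def)
    finally show ?thesis .
  qed
  have "L-lipschitz_on UNIV H"
    using Hlip lipschitz_on_nonneg[OF lip] by (intro lipschitz_onI) auto
  then have Hc: "continuous_on UNIV H"
    by (rule lipschitz_on_continuous_on)
  define G where "G s = (LBINT r=0..s. H r)" for s :: real
  have G: "(G has_vector_derivative H s) (at s)" for s
    unfolding G_def by (rule has_vector_derivative_LBINT[OF Hc])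
  define e where "e k = inverse (real (Suc k))" for k
  have e: "e k > 0" for k by (simp add: e_def)
  have e0: "e \<longlonglongrightarrow> 0"
    unfolding e_def by (rule LIMSEQ_inverse_real_of_nat)
  have quot: "(\<lambda>k. (1 / e k) *\<^sub>R (u (s + e k) - u s)) \<longlonglongrightarrow> D"
    if "(u has_vector_derivative D) (at s)" for u :: "real \<Rightarrow> 'a" and s D
  proof -
    have 1: "((\<lambda>y. (1 / \<bar>y - s\<bar>) *\<^sub>R (u y - (u s + (y - s) *\<^sub>R D))) \<longlongrightarrow> 0) (at s)"
      using that by (simp add: has_vector_derivative_def has_derivative_within)
    have "(\<lambda>k. s + e k) \<longlonglongrightarrow> s + 0" by (intro tendsto_intros e0)
    then have "filterlim (\<lambda>k. s + e k) (at s) sequentially"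
      using e by (simp add: filterlim_at less_imp_neq[OF e, symmetric])
    from filterlim_compose[OF 1 this]
    have "(\<lambda>k. (1 / e k) *\<^sub>R (u (s + e k) - u s) - D) \<longlonglongrightarrow> 0"
      using less_imp_neq[OF e, symmetric] e
      by (simp add: abs_of_pos algebra_simps scaleR_diff_right scaleR_add_right)
    then show ?thesis by (rule LIM_zero_cancel)
  qed
  define q where "q k s = (1 / e k) *\<^sub>R (H (s + e k) - H s)" for k s
  define S where "S k s = (1 / e k) *\<^sub>R (G (s + e k) - G s)" for k s
  define N' where "N' = N \<union> {a, b}"
  have negN': "negligible N'" unfolding N'_def using N by (intro negligible_Un) auto
  have GS: "(S k has_vector_derivative q k s) (at s)" for k s
  proof -
    have "((\<lambda>s. G (s + e k)) has_vector_derivative H (s + e k)) (at s)"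
    proof -
      have "((\<lambda>s. s + e k) has_vector_derivative 1) (at s)"
        by (auto simp flip: has_real_derivative_iff_has_vector_derivative intro!: derivative_eq_intros)
      from vector_diff_chain_at[OF this G] show ?thesis by (simp add: o_def)
    qed
    then show ?thesis unfolding S_def q_def
      by (auto intro!: derivative_eq_intros G)
  qed
  have int: "(q k has_integral (S k b - S k a)) {a..b}" for k
    by (rule fundamental_theorem_of_calculus[OF \<open>a \<le> b\<close>])
       (auto intro: has_vector_derivative_at_within GS)
  have "((\<lambda>s. if s \<in> N' then 0 else f s) has_integral (F b - F a)) {a..b}"
  proof (rule has_integral_dominated_convergence)
    show "((\<lambda>s. if s \<in> N' then 0 else q k s) has_integral (S k b - S k a)) {a..b}" for k
      by (rule has_integral_spike[OF negN' _ int[of k]]) auto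
    show "(\<lambda>s::real. L) integrable_on {a..b}" by (rule integrable_const_ivl)
    show "\<forall>s\<in>{a..b}. norm (if s \<in> N' then 0 else q k s) \<le> L" for k
    proof
      fix s
      have "norm (q k s) \<le> L"
        using Hlip[of "s + e k" s] e[of k]
        by (simp add: q_def dist_norm divide_simps mult.commute)
      then show "norm (if s \<in> N' then 0 else q k s) \<le> L"
        using lipschitz_on_nonneg[OF lip] by auto
    qed
    show "\<forall>s\<in>{a..b}. (\<lambda>k. if s \<in> N' then 0 else q k s) \<longlonglongrightarrow> (if s \<in> N' then 0 else f s)"
    proof
      fix s assume s: "s \<in> {a..b}"
      show "(\<lambda>k. if s \<in> N' then 0 else q k s) \<longlonglongrightarrow> (if s \<in> N' then 0 else f s)"
      proof (cases "s \<in> N'")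
        case False
        with s have s': "s \<in> {a<..<b}" "s \<in> {a..b} - N" by (auto simp: N'_def)
        have "(F has_vector_derivative f s) (at s within {a<..<b})"
          using der[OF s'(2)] by (rule has_vector_derivative_within_subset) auto
        then have "(F has_vector_derivative f s) (at s)"
          using s' by (simp add: at_within_open[where S = "{a<..<b}"])
        then have "(H has_vector_derivative f s) (at s)"
          by (rule has_vector_derivative_transform_within_open[where S = "{a<..<b}"])
             (use s' in \<open>auto simp: H_def\<close>)
        from quot[OF this] False show ?thesis by (simp add: q_def)
      qed auto
    qed
    have "(\<lambda>k. S k b - S k a) \<longlonglongrightarrow> H b - H a"
      unfolding S_def by (intro tendsto_diff quot G)
    then show "(\<lambda>k. S k b - S k a) \<longlonglongrightarrow> F b - F a"
      using \<open>a \<le> b\<close> by (simp add: H_def)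
  qed
  then show ?thesis
    by (rule has_integral_spike[OF negN', rotated]) auto
qed

definition lip :: "real set \<Rightarrow> (real \<Rightarrow> 'a::metric_space) \<Rightarrow> bool"
  where "lip S f \<longleftrightarrow> (\<exists>L. L-lipschitz_on S f)"

lemma lip_add: "lip S f \<Longrightarrow> lip S g \<Longrightarrow> lip S (\<lambda>s. f s + g s)" for f g :: "real \<Rightarrow> 'a::real_normed_vector"
  unfolding lip_def by (blast intro: lipschitz_on_add)

lemma lip_diff: "lip S f \<Longrightarrow> lip S g \<Longrightarrow> lip S (\<lambda>s. f s - g s)" for f g :: "real \<Rightarrow> 'a::real_normed_vector"
  unfolding lip_def by (blast intro: lipschitz_on_diff)

lemma lip_const: "lip S (\<lambda>s. c)"
  unfolding lip_def by (blast intro: lipschitz_on_constant)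

lemma lip_linear:
  fixes f :: "real \<Rightarrow> 'a::real_normed_vector"
  assumes "bounded_linear h" "lip S f" shows "lip S (\<lambda>s. h (f s))"
proof -
  obtain L where L: "L-lipschitz_on S f" using assms by (auto simp: lip_def)
  interpret bounded_linear h by fact
  obtain B where "B-lipschitz_on (f ` S) h" using lipschitz_boundE by blast
  from lipschitz_on_compose2[OF L this] show ?thesis by (auto simp: lip_def o_def)
qed

lemma continuous_on_Icc_norm_bound:
  fixes f :: "real \<Rightarrow> 'a::real_normed_vector"
  assumes "continuous_on {a..b} f"
  obtains B where "\<And>s. s \<in> {a..b} \<Longrightarrow> norm (f s) \<le> B"
  using compact_imp_bounded[OF compact_continuous_image[OF assms compact_Icc]]
  unfolding bounded_iff by blast
lemma lip_bilinear:
  fixes f :: "real \<Rightarrow> 'a::real_normed_vector" and g :: "real \<Rightarrow> 'b::real_normed_vector"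
  assumes "bounded_bilinear h" "lip {a..b} f" "lip {a..b} g"
  shows "lip {a..b} (\<lambda>s. h (f s) (g s))"
proof -
  obtain Lf Lg where L: "Lf-lipschitz_on {a..b} f" "Lg-lipschitz_on {a..b} g"
    using assms by (auto simp: lip_def)
  note L0 = lipschitz_on_nonneg[OF L(1)] lipschitz_on_nonneg[OF L(2)]
  interpret h: bounded_bilinear h by fact
  obtain K where K: "K > 0" "\<And>x y. norm (h x y) \<le> norm x * norm y * K"
    using h.pos_bounded by blast
  obtain Bf where Bf: "\<And>s. s \<in> {a..b} \<Longrightarrow> norm (f s) \<le> Bf"
    by (rule continuous_on_Icc_norm_bound[OF lipschitz_on_continuous_on[OF L(1)]]) blast
  obtain Bg where Bg: "\<And>s. s \<in> {a..b} \<Longrightarrow> norm (g s) \<le> Bg"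
    by (rule continuous_on_Icc_norm_bound[OF lipschitz_on_continuous_on[OF L(2)]]) blast
  have "\<bar>Lf * Bg * K + Bf * Lg * K\<bar>-lipschitz_on {a..b} (\<lambda>s. h (f s) (g s))"
  proof (rule lipschitz_onI)
    fix s r assume sr: "s \<in> {a..b}" "r \<in> {a..b}"
    have "h (f s) (g s) - h (f r) (g r) = h (f s - f r) (g s) + h (f r) (g s - g r)"
      by (simp add: h.diff_left h.diff_right)
    then have "dist (h (f s) (g s)) (h (f r) (g r)) \<le> norm (h (f s - f r) (g s)) + norm (h (f r) (g s - g r))"
      by (simp add: dist_norm norm_triangle_ineq)
    also have "\<dots> \<le> norm (f s - f r) * norm (g s) * K + norm (f r) * norm (g s - g r) * K"
      by (intro add_mono K)
    also have "\<dots> \<le> (Lf * dist s r) * Bg * K + Bf * (Lg * dist s r) * K"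
      using lipschitz_onD[OF L(1) sr] lipschitz_onD[OF L(2) sr] Bf[OF sr(2)] Bg[OF sr(1)] K(1) L0
        order_trans[OF norm_ge_zero Bf[OF sr(2)]] order_trans[OF norm_ge_zero Bg[OF sr(1)]]
      by (intro add_mono mult_mono) (auto simp: dist_norm)
    also have "\<dots> = (Lf * Bg * K + Bf * Lg * K) * dist s r" by (simp add: algebra_simps)
    also have "\<dots> \<le> \<bar>Lf * Bg * K + Bf * Lg * K\<bar> * dist s r" by (intro mult_right_mono) auto
    finally show "dist (h (f s) (g s)) (h (f r) (g r)) \<le> \<bar>Lf * Bg * K + Bf * Lg * K\<bar> * dist s r" .
  qed auto
  then show ?thesis by (auto simp: lip_def)
qed

lemma lip_C1:
  fixes f :: "real \<Rightarrow> 'a::real_normed_vector"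
  assumes "\<And>s. s \<in> {a..b} \<Longrightarrow> (f has_vector_derivative D s) (at s within {a..b})"
    and "continuous_on {a..b} D"
  shows "lip {a..b} f"
proof -
  obtain B where B: "\<And>s. s \<in> {a..b} \<Longrightarrow> norm (D s) \<le> B"
    by (rule continuous_on_Icc_norm_bound[OF assms(2)]) blast
  have "\<bar>B\<bar>-lipschitz_on {a..b} f"
  proof (rule bounded_derivative_imp_lipschitz)
    fix s assume s: "s \<in> {a..b}"
    show "(f has_derivative (\<lambda>h. h *\<^sub>R D s)) (at s within {a..b})"
      using assms(1)[OF s] by (simp only: has_vector_derivative_def)
    show "onorm (\<lambda>h. h *\<^sub>R D s) \<le> \<bar>B\<bar>"
      using B[OF s] by (simp add: onorm_scaleR_left bounded_linear_ident onorm_id)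
  qed auto
  then show ?thesis by (auto simp: lip_def)
qed

text \<open>The speed of a horizontal curve is only bounded and measurable.  The calibration needs an arc length that
  is continuously differentiable, so it runs on that of a continuous approximation of the speed; this
  lemma makes the error small.\<close>
lemma L1_approx_continuous:
  fixes f :: "real \<Rightarrow> real"
  assumes f: "f integrable_on {a..b}" and bd: "\<And>s. s \<in> {a..b} - N \<Longrightarrow> 0 \<le> f s \<and> f s \<le> C"
    and N: "negligible N" and "\<eta> > 0"
  obtains g where "continuous_on UNIV g" "\<And>s. 0 \<le> g s"
    "(\<lambda>s. \<bar>f s - g s\<bar>) integrable_on {a..b}" "integral {a..b} (\<lambda>s. \<bar>f s - g s\<bar>) \<le> \<eta>"
proof -
  define f' where "f' s = (if s \<in> N then 0 else f s)" for s
  define C' where "C' = max C 0"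
  have f'int: "f' integrable_on {a..b}"
    by (rule integrable_spike[OF f N]) (auto simp: f'_def)
  have f'bd: "0 \<le> f' s" "f' s \<le> C'" if "s \<in> {a..b}" for s
    using bd[of s] that by (auto simp: f'_def C'_def)
  have "f' measurable_on {a..b}"
    using integrable_imp_measurable[OF f'int] by (simp add: measurable_on_iff_borel_measurable)
  then obtain M g0 where M: "negligible M" and g0: "\<And>n. continuous_on UNIV (g0 n)"
    and lim: "\<And>x. x \<notin> M \<Longrightarrow> (\<lambda>n. g0 n x) \<longlonglongrightarrow> (if x \<in> {a..b} then f' x else 0)"
    unfolding measurable_on_def by metis
  define g where "g n s = max 0 (min C' (g0 n s))" for n s
  have gc: "continuous_on UNIV (g n)" for n
    unfolding g_def by (intro continuous_intros g0)
  have gb: "0 \<le> g n s" "g n s \<le> C'" for n s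
    by (auto simp: g_def C'_def)
  have f'abs: "f' absolutely_integrable_on {a..b}"
    using f'int f'bd by (intro nonnegative_absolutely_integrable_1) auto
  have di: "(\<lambda>s. \<bar>f' s - g n s\<bar>) integrable_on {a..b}" for n
  proof -
    have "g n absolutely_integrable_on {a..b}"
      using gb continuous_on_subset[OF gc]
      by (intro nonnegative_absolutely_integrable_1 integrable_continuous_real) auto
    from set_integral_diff(1)[OF f'abs this] show ?thesis
      unfolding absolutely_integrable_on_def by simp
  qed
  have di': "(\<lambda>s. if s \<in> M then 0 else \<bar>f' s - g n s\<bar>) integrable_on {a..b}" for n
    by (rule integrable_spike[OF di M]) auto
  have "(\<lambda>n. integral {a..b} (\<lambda>s. if s \<in> M then 0 else \<bar>f' s - g n s\<bar>)) \<longlonglongrightarrow> integral {a..b} (\<lambda>s. 0)"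
  proof (rule dominated_convergence(2)[OF di'])
    show "(\<lambda>s. C') integrable_on {a..b}" by (rule integrable_const_ivl)
    show "norm (if s \<in> M then 0 else \<bar>f' s - g n s\<bar>) \<le> C'" if "s \<in> {a..b}" for n s
      using f'bd[OF that] gb[of n s] by (auto simp: C'_def)
    show "(\<lambda>n. if s \<in> M then 0 else \<bar>f' s - g n s\<bar>) \<longlonglongrightarrow> 0" if "s \<in> {a..b}" for s
    proof (cases "s \<in> M")
      case False
      then have "(\<lambda>n. g0 n s) \<longlonglongrightarrow> f' s" using lim[of s] that by auto
      then have "(\<lambda>n. g n s) \<longlonglongrightarrow> max 0 (min C' (f' s))"
        unfolding g_def by (intro tendsto_intros)
      then have "(\<lambda>n. g n s) \<longlonglongrightarrow> f' s" using f'bd[OF that] by simp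
      then have "(\<lambda>n. \<bar>f' s - g n s\<bar>) \<longlonglongrightarrow> \<bar>f' s - f' s\<bar>" by (intro tendsto_intros)
      then show ?thesis using False by simp
    qed auto
  qed
  then have "\<forall>\<^sub>F n in sequentially. integral {a..b} (\<lambda>s. if s \<in> M then 0 else \<bar>f' s - g n s\<bar>) < \<eta>"
    using \<open>\<eta> > 0\<close> by (intro order_tendstoD) auto
  then obtain n where n: "integral {a..b} (\<lambda>s. if s \<in> M then 0 else \<bar>f' s - g n s\<bar>) < \<eta>"
    by (auto simp: eventually_sequentially)
  have neg: "negligible (M \<union> N)" using M N by (rule negligible_Un)
  show ?thesis
  proof (rule that[of "g n"])
    show "(\<lambda>s. \<bar>f s - g n s\<bar>) integrable_on {a..b}"
      by (rule integrable_spike[OF di'[of n] neg]) (auto simp: f'_def)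
    have "integral {a..b} (\<lambda>s. \<bar>f s - g n s\<bar>) = integral {a..b} (\<lambda>s. if s \<in> M then 0 else \<bar>f' s - g n s\<bar>)"
      by (rule integral_spike[OF neg]) (auto simp: f'_def)
    then show "integral {a..b} (\<lambda>s. \<bar>f s - g n s\<bar>) \<le> \<eta>" using n by simp
  qed (use gc gb in auto)
qed

text \<open>A velocity \<open>f\<close> dominated by a small quantity in \<open>L\<^sup>2\<close> moves \<open>F\<close> little.  The parameter \<open>\<delta>\<close> comes from
  \<open>|d| \<le> \<delta> + |d|\<^sup>2 / \<delta>\<close>, which does the work of the Cauchy-Schwarz inequality for integrals.\<close>
lemma norm_increment_le:
  fixes F :: "real \<Rightarrow> 'a::euclidean_space" and d :: "real \<Rightarrow> 'b::real_normed_vector"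
  assumes ab: "0 \<le> a" "a \<le> b" "b \<le> T" and lip: "lip {0..T} F" and N: "negligible N"
    and der: "\<And>s. s \<in> {0..T} - N \<Longrightarrow> (F has_vector_derivative f s) (at s within {0..T})"
    and bd: "\<And>s. s \<in> {a..b} - N \<Longrightarrow> norm (f s) \<le> K * norm (d s)" and K: "K \<ge> 0"
    and D: "((\<lambda>s. (norm (d s))\<^sup>2) has_integral D) {0..T}" and \<delta>: "\<delta> > 0"
  shows "norm (F b - F a) \<le> K * (\<delta> * T + D / \<delta>)"
proof -
  obtain L where L: "L-lipschitz_on {0..T} F" using lip by (auto simp: lip_def)
  have sub: "{a..b} \<subseteq> {0..T}" using ab by auto
  define f' where "f' s = (if s \<in> N then 0 else f s)" for s
  have "(f has_integral (F b - F a)) {a..b}"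
    using sub by (intro lipschitz_FTC[OF ab(2) lipschitz_on_subset[OF L sub] N])
      (auto intro: has_vector_derivative_within_subset[OF der sub])
  then have f': "(f' has_integral (F b - F a)) {a..b}"
    by (rule has_integral_spike[OF N, rotated]) (auto simp: f'_def)
  have G: "((\<lambda>s. K * (\<delta> + (norm (d s))\<^sup>2 / \<delta>)) has_integral K * (\<delta> * T + D / \<delta>)) {0..T}"
    using has_integral_mult_right[OF has_integral_add[OF has_integral_const_real[of \<delta> 0 T]
        has_integral_divide[OF D, of \<delta>]], of K] ab by (simp add: mult.commute)
  have G0: "0 \<le> K * (\<delta> + (norm (d s))\<^sup>2 / \<delta>)" for s using K \<delta> by simp
  have Gab: "(\<lambda>s. K * (\<delta> + (norm (d s))\<^sup>2 / \<delta>)) integrable_on {a..b}"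
    using G sub integrable_on_subinterval by blast
  have "norm (integral {a..b} f') \<le> integral {a..b} (\<lambda>s. K * (\<delta> + (norm (d s))\<^sup>2 / \<delta>))"
  proof (rule integral_norm_bound_integral[OF _ Gab])
    show "f' integrable_on {a..b}" using f' by blast
    show "norm (f' s) \<le> K * (\<delta> + (norm (d s))\<^sup>2 / \<delta>)" if "s \<in> {a..b}" for s
    proof (cases "s \<in> N")
      case False
      have "0 \<le> norm (d s) * \<delta>" using \<delta> by simp
      then have "norm (d s) * \<delta> \<le> \<delta>\<^sup>2 + (norm (d s))\<^sup>2"
        using sum_squares_bound[of "norm (d s)" \<delta>] by linarith
      then have "norm (d s) \<le> \<delta> + (norm (d s))\<^sup>2 / \<delta>"
        using \<delta> by (simp add: field_simps power2_eq_square)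
      then have "K * norm (d s) \<le> K * (\<delta> + (norm (d s))\<^sup>2 / \<delta>)" by (rule mult_left_mono) (rule K)
      then show ?thesis using bd[of s] that False by (simp add: f'_def)
    qed (use G0 in \<open>simp add: f'_def\<close>)
  qed
  also have "\<dots> \<le> integral {0..T} (\<lambda>s. K * (\<delta> + (norm (d s))\<^sup>2 / \<delta>))"
    using G G0 by (intro integral_subset_le sub Gab) auto
  finally show ?thesis unfolding integral_unique[OF f'] integral_unique[OF G] .
qed

section \<open>The calibration\<close>

text \<open>In the applications \<open>J = - A\<^sub>\<theta>\<close>, where \<open>\<theta>\<close> is a unit vector or zero.  The properties make \<open>J\<close> a rotation by
  a right angle on the range of \<open>P = - J\<^sup>2\<close>, and zero on its orthogonal complement.\<close>
locale skew_rotation =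
  fixes J :: "'a::euclidean_space \<Rightarrow> 'a"
  assumes linear: "linear J"
    and skew: "inner (J x) y = - inner x (J y)"
    and cube: "J (J (J x)) = - J x"
begin

definition P :: "'a \<Rightarrow> 'a" where "P x = - J (J x)"

lemma bounded_linear_J: "bounded_linear J"
  using linear by (simp add: linear_conv_bounded_linear)

sublocale bounded_linear J by (rule bounded_linear_J)

lemma bounded_linear_P: "bounded_linear P"
  unfolding P_def by (intro bounded_linear_minus bounded_linear_compose[OF bounded_linear_J] bounded_linear_J)

lemma J_simps [simp]: "J 0 = 0" "J (x + y) = J x + J y" "J (x - y) = J x - J y"
    "J (- x) = - J x" "J (c *\<^sub>R x) = c *\<^sub>R J x"
  by (simp_all add: zero add diff neg scaleR)

lemma P_simps [simp]: "P 0 = 0" "P (x + y) = P x + P y" "P (x - y) = P x - P y"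
    "P (- x) = - P x" "P (c *\<^sub>R x) = c *\<^sub>R P x"
  by (simp_all add: P_def)

lemma J_P [simp]: "J (P x) = J x" and P_J [simp]: "P (J x) = J x" and P_P [simp]: "P (P x) = P x"
  by (simp_all add: P_def cube)

lemma inner_P: "inner (P x) y = inner x (P y)" and inner_J_J: "inner (J x) (J y) = inner x (P y)"
  by (simp_all add: P_def skew)

lemma J_J [simp]: "J (J x) = - P x"
  by (simp add: P_def)

lemma inner_J_self [simp]: "inner (J x) x = 0" "inner x (J x) = 0"
  using skew[of x x] by (simp_all add: inner_commute)

lemma inner_J_P [simp]: "inner (J x) (P x) = 0" "inner (P x) (J x) = 0"
  using inner_P[of x "J x"] by (simp_all add: inner_commute)

lemma norm_J: "norm (J x) = norm (P x)"
  by (simp add: norm_eq_sqrt_inner inner_J_J inner_P)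

lemma norm_Pythagoras: "(norm x)\<^sup>2 = (norm (x - P x))\<^sup>2 + (norm (P x))\<^sup>2"
  by (simp add: power2_norm_eq_inner inner_diff inner_P)

lemma P_eq_0_iff: "P x = 0 \<longleftrightarrow> J x = 0"
  by (metis norm_J norm_eq_zero)

text \<open>The calibrating field is \<open>c = z T / l + k (cot \<phi> P z + J z)\<close>.  On a circle through the origin of length
  \<open>l\<close> in the range of \<open>P\<close>, with arc length \<open>\<sigma>\<close> and \<open>\<phi> = \<pi> \<sigma> / l\<close>, the velocity is \<open>(\<pi> / l) (cot \<phi> z + J z)\<close>;
  the summand \<open>z T / l\<close> is the velocity of the linear part.  Since \<open>\<phi>' = k g\<close>, the terms
  \<open>2 k cot \<phi> \<langle>P z, w\<rangle> - k\<^sup>2 g (1 + cot\<^sup>2 \<phi>) |P z|\<^sup>2\<close> of \<open>2 \<langle>w, c\<rangle> - g |c|\<^sup>2\<close> form the derivative of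
  \<open>k cot \<phi> \<langle>z, P z\<rangle>\<close>, which is zero at both ends.  The phase runs over \<open>[e, \<pi> - e]\<close>
  instead of \<open>[0, \<pi>]\<close>, so the cotangent stays Lipschitz, and \<open>e\<close> tends to zero in the applications.  The first three conclusions serve the estimates there.\<close>
lemma calibration_integral:
  fixes z w :: "real \<Rightarrow> 'a" and M g \<sigma> :: "real \<Rightarrow> real"
  assumes T: "T > 0" and N: "negligible N" and lipz: "lip {0..T} z" and lipM: "lip {0..T} M"
    and dz: "\<And>s. s \<in> {0..T} - N \<Longrightarrow> (z has_vector_derivative w s) (at s within {0..T})"
    and dM: "\<And>s. s \<in> {0..T} - N \<Longrightarrow> (M has_vector_derivative inner (J (z s)) (w s)) (at s within {0..T})"
    and z0: "z 0 = 0" and M0: "M 0 = 0" and JzT: "J (z T) = 0"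
    and d\<sigma>: "\<And>s. (\<sigma> has_vector_derivative g s) (at s)" and g: "continuous_on UNIV g"
    and g0: "\<And>s. g s \<ge> 0" and \<sigma>0: "\<sigma> 0 = 0" and \<sigma>T: "\<sigma> T = l" and l: "l > 0"
    and e: "0 < e" "e < pi / 2"
  defines "k \<equiv> (pi - 2 * e) / l"
  defines "\<phi> \<equiv> \<lambda>s. e + k * \<sigma> s"
  defines "c \<equiv> \<lambda>s. (1 / l) *\<^sub>R z T + k *\<^sub>R (cot (\<phi> s) *\<^sub>R P (z s) + J (z s))"
  shows "\<And>s. s \<in> {0..T} \<Longrightarrow> \<phi> s \<in> {e..pi - e}"
    and "lip {0..T} (\<lambda>s. cot (\<phi> s))"
    and "\<And>s. s \<in> {0..T} \<Longrightarrow> ((\<lambda>s. cot (\<phi> s)) has_vector_derivative - (k * g s * (1 + (cot (\<phi> s))\<^sup>2))) (at s within {0..T})"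
    and "((\<lambda>s. 2 * inner (w s) (c s) - g s * (norm (c s))\<^sup>2) has_integral
      ((norm (z T))\<^sup>2 / l + 2 * k * M T)) {0..T}"
proof -
  have k: "k > 0" using e l by (simp add: k_def)
  have d\<sigma>': "DERIV \<sigma> s :> g s" for s
    using d\<sigma> by (simp add: has_real_derivative_iff_has_vector_derivative)
  have mono: "\<sigma> s \<le> \<sigma> r" if "s \<le> r" for s r
    using DERIV_nonneg_imp_nondecreasing[OF that] d\<sigma>' g0 by blast
  show \<phi>: "\<phi> s \<in> {e..pi - e}" if "s \<in> {0..T}" for s
  proof -
    have "0 \<le> k * \<sigma> s" using mono[of 0 s] that \<sigma>0 k by auto
    moreover have "k * \<sigma> s \<le> k * l" using mono[of s T] that \<sigma>T k by auto
    moreover have "k * l = pi - 2 * e" using l by (simp add: k_def)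
    ultimately show ?thesis by (simp add: \<phi>_def)
  qed
  have sin: "sin (\<phi> s) > 0" if "s \<in> {0..T}" for s
    using \<phi>[OF that] e by (intro sin_gt_zero) auto
  have \<sigma>c: "continuous_on {0..T} \<sigma>"
    using d\<sigma>' by (meson DERIV_isCont continuous_at_imp_continuous_on)
  have cotc: "continuous_on {0..T} (\<lambda>s. cot (\<phi> s))"
  proof (rule continuous_on_cot)
    show "continuous_on {0..T} \<phi>" unfolding \<phi>_def by (intro continuous_intros \<sigma>c)
    show "\<forall>s\<in>{0..T}. sin (\<phi> s) \<noteq> 0" using sin by (metis less_irrefl)
  qed
  have cotd: "DERIV (\<lambda>s. cot (\<phi> s)) s :> - (k * g s * (1 + (cot (\<phi> s))\<^sup>2))" if "s \<in> {0..T}" for s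
  proof -
    have D: "DERIV \<phi> s :> k * g s" unfolding \<phi>_def
      by (auto intro!: derivative_eq_intros d\<sigma>')
    have "1 + (cot (\<phi> s))\<^sup>2 = inverse ((sin (\<phi> s))\<^sup>2)"
      using sin[OF that] sin_cos_squared_add[of "\<phi> s"]
      by (simp add: cot_def divide_simps power2_eq_square)
    then show ?thesis
      using DERIV_chain2[OF DERIV_cot D] sin[OF that] by (simp add: mult.commute)
  qed
  show cotd': "((\<lambda>s. cot (\<phi> s)) has_vector_derivative - (k * g s * (1 + (cot (\<phi> s))\<^sup>2))) (at s within {0..T})"
    if "s \<in> {0..T}" for s
    using cotd[OF that] has_vector_derivative_at_within
    by (simp add: has_real_derivative_iff_has_vector_derivative)
  show lipcot: "lip {0..T} (\<lambda>s. cot (\<phi> s))"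
    by (rule lip_C1[OF cotd']) (auto intro!: continuous_intros cotc continuous_on_subset[OF g])
  have lip\<sigma>: "lip {0..T} \<sigma>"
    by (rule lip_C1[OF has_vector_derivative_at_within[OF d\<sigma>]]) (rule continuous_on_subset[OF g], auto)
  define F where "F s = (2 / l) * inner (z s) (z T) - ((norm (z T))\<^sup>2 / l\<^sup>2) * \<sigma> s + 2 * k * M s
      + k * (cot (\<phi> s) * inner (z s) (P (z s)))" for s
  have "lip {0..T} F" unfolding F_def
    by (intro lip_add lip_diff lip_bilinear[OF bounded_bilinear_mult] lip_const lip\<sigma> lipM lipcot
        lip_bilinear[OF bounded_bilinear_inner] lipz lip_linear[OF bounded_linear_P])
  then obtain L where L: "L-lipschitz_on {0..T} F" by (auto simp: lip_def)
  have dF: "(F has_vector_derivative (2 * inner (w s) (c s) - g s * (norm (c s))\<^sup>2)) (at s within {0..T})"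
    if s: "s \<in> {0..T} - N" for s
  proof -
    have 1: "((\<lambda>s. inner (z s) (z T)) has_vector_derivative inner (w s) (z T)) (at s within {0..T})"
      by (rule bounded_linear.has_vector_derivative[OF bounded_linear_inner_left dz[OF s]])
    have 2: "((\<lambda>s. P (z s)) has_vector_derivative P (w s)) (at s within {0..T})"
      by (rule bounded_linear.has_vector_derivative[OF bounded_linear_P dz[OF s]])
    have 3: "((\<lambda>s. inner (z s) (P (z s))) has_vector_derivative inner (z s) (P (w s)) + inner (w s) (P (z s))) (at s within {0..T})"
      by (rule bounded_bilinear.has_vector_derivative[OF bounded_bilinear_inner dz[OF s] 2])
    note 4 = has_vector_derivative_at_within[OF d\<sigma>[of s], of "{0..T}"]
    note 5 = dM[OF s]
    note 6 = bounded_bilinear.has_vector_derivative[OF bounded_bilinear_mult cotd' 3]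
    have "(F has_vector_derivative ((2 / l) * inner (w s) (z T) - ((norm (z T))\<^sup>2 / l\<^sup>2) * g s
        + 2 * k * inner (J (z s)) (w s)
        + k * (cot (\<phi> s) * (inner (z s) (P (w s)) + inner (w s) (P (z s)))
             + - (k * g s * (1 + (cot (\<phi> s))\<^sup>2)) * inner (z s) (P (z s))))) (at s within {0..T})"
      unfolding F_def
      using s by (intro has_vector_derivative_add has_vector_derivative_diff 6
         bounded_linear.has_vector_derivative[OF bounded_linear_mult_right] 1 4 5) auto
    moreover have "(2 / l) * inner (w s) (z T) - ((norm (z T))\<^sup>2 / l\<^sup>2) * g s
        + 2 * k * inner (J (z s)) (w s)
        + k * (cot (\<phi> s) * (inner (z s) (P (w s)) + inner (w s) (P (z s)))
             + - (k * g s * (1 + (cot (\<phi> s))\<^sup>2)) * inner (z s) (P (z s)))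
      = 2 * inner (w s) (c s) - g s * (norm (c s))\<^sup>2"
    proof -
      have PzT: "P (z T) = 0" using JzT P_eq_0_iff by blast
      have 1: "inner (z T) (P x) = 0" "inner (z T) (J x) = 0" "inner (P x) (z T) = 0" "inner (J x) (z T) = 0" for x
        using inner_P[of "z T" x] inner_P[of x "z T"] skew[of "z T" x] skew[of x "z T"] JzT PzT by auto
      define p where "p = inner (z s) (P (z s))"
      have 2: "inner (P (z s)) (P (z s)) = p" "inner (J (z s)) (J (z s)) = p"
        by (simp_all add: p_def inner_P inner_J_J)
      have "(norm (c s))\<^sup>2 = (norm (z T))\<^sup>2 / l\<^sup>2 + k\<^sup>2 * ((cot (\<phi> s))\<^sup>2 + 1) * p"
        unfolding c_def power2_norm_eq_inner
        by (simp add: inner_add 1 2 inner_scaleR_left algebra_simps power2_eq_square)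
      moreover have "inner (w s) (c s) = (1 / l) * inner (w s) (z T) + k * (cot (\<phi> s) * inner (w s) (P (z s)) + inner (J (z s)) (w s))"
        unfolding c_def by (simp add: inner_add inner_commute[of "w s" "J (z s)"] algebra_simps)
      moreover have "inner (z s) (P (w s)) = inner (w s) (P (z s))"
        by (metis inner_P inner_commute)
      ultimately show ?thesis by (simp add: p_def algebra_simps power2_eq_square)
    qed
    ultimately show ?thesis by simp
  qed
  have "((\<lambda>s. 2 * inner (w s) (c s) - g s * (norm (c s))\<^sup>2) has_integral (F T - F 0)) {0..T}"
    using T by (intro lipschitz_FTC[OF _ L N dF]) auto
  moreover have "F T - F 0 = (norm (z T))\<^sup>2 / l + 2 * k * M T"
    using JzT P_eq_0_iff[of "z T"] z0 M0 \<sigma>0 \<sigma>T l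
    by (simp add: F_def field_simps power2_eq_square dot_square_norm)
  ultimately show "((\<lambda>s. 2 * inner (w s) (c s) - g s * (norm (c s))\<^sup>2) has_integral
      ((norm (z T))\<^sup>2 / l + 2 * k * M T)) {0..T}" by simp
qed

text \<open>This is an isoperimetric inequality, as \<open>M T\<close> is twice the area that the projection of \<open>z\<close> to the range of \<open>J\<close>
  encloses, and the complementary part has to travel from \<open>0\<close> to \<open>z T\<close>.  Cauchy-Schwarz gives
  \<open>2 \<langle>w, c\<rangle> \<le> |w| (1 + |c|\<^sup>2)\<close> for the calibrating field \<open>c\<close>, and the integral of \<open>2 \<langle>w, c\<rangle> - |w| |c|\<^sup>2\<close> would be
  known if \<open>|w|\<close> were continuous; the error of replacing \<open>|w|\<close> by a continuous \<open>g\<close> is at most \<open>e\<close>.\<close>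
lemma length_lower_bound:
  fixes z w :: "real \<Rightarrow> 'a" and M :: "real \<Rightarrow> real"
  assumes T: "T > 0" and N: "negligible N" and lipz: "lip {0..T} z" and lipM: "lip {0..T} M"
    and dz: "\<And>s. s \<in> {0..T} - N \<Longrightarrow> (z has_vector_derivative w s) (at s within {0..T})"
    and dM: "\<And>s. s \<in> {0..T} - N \<Longrightarrow> (M has_vector_derivative inner (J (z s)) (w s)) (at s within {0..T})"
    and z0: "z 0 = 0" and M0: "M 0 = 0" and JzT: "J (z T) = 0"
    and bd: "\<And>s. s \<in> {0..T} - N \<Longrightarrow> norm (w s) \<le> C"
    and len: "((\<lambda>s. norm (w s)) has_integral l) {0..T}"
  shows "(norm (z T))\<^sup>2 + 2 * pi * M T \<le> l\<^sup>2"
proof -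
  have l0: "l \<ge> 0" by (rule has_integral_nonneg[OF len]) auto
  have key: "(norm (z T))\<^sup>2 + 2 * (pi - 2 * e) * M T \<le> (l + e) * (l + e + e * T)"
    if e: "0 < e" "e < pi / 2" for e
  proof -
    obtain Bz where Bz: "\<And>s. s \<in> {0..T} \<Longrightarrow> norm (z s) \<le> Bz"
    proof -
      obtain L where "L-lipschitz_on {0..T} z" using lipz by (auto simp: lip_def)
      from continuous_on_Icc_norm_bound[OF lipschitz_on_continuous_on[OF this]] that show ?thesis by blast
    qed
    have Bz0: "0 \<le> Bz" using Bz[of 0] T by (auto intro: order_trans[OF norm_ge_zero])
    obtain BP where BP: "\<And>x. norm (P x) \<le> norm x * BP" "BP > 0"
      using bounded_linear.pos_bounded[OF bounded_linear_P] by blast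
    \<comment> \<open>\<open>B\<close> will bound the calibrating field: \<open>g \<ge> e\<close> makes the total arc length at least \<open>e T\<close>, whatever
      approximation of the speed is chosen afterwards.\<close>
    define B where "B = (1 / (e * T)) * Bz + (pi / (e * T)) * ((1 / sin e) * (Bz * BP) + Bz * BP)"
    have sine: "sin e > 0" using e by (intro sin_gt_zero) auto
    have B: "B \<ge> 0" unfolding B_def using e T Bz0 BP sine by (intro add_nonneg_nonneg mult_nonneg_nonneg) auto
    define \<eta> where "\<eta> = e / (1 + B\<^sup>2)"
    have \<eta>: "\<eta> > 0" "\<eta> * B\<^sup>2 \<le> e" "\<eta> \<le> e"
    proof -
      have "e * B\<^sup>2 \<le> e * (1 + B\<^sup>2)" "e * 1 \<le> e * (1 + B\<^sup>2)"
        using e by (intro mult_left_mono; simp)+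
      moreover have "0 < 1 + B\<^sup>2" by (simp add: add_pos_nonneg)
      ultimately show "\<eta> > 0" "\<eta> * B\<^sup>2 \<le> e" "\<eta> \<le> e"
        using e by (simp_all add: \<eta>_def pos_divide_le_eq)
    qed
    obtain g0 where g0: "continuous_on UNIV g0" "\<And>s. 0 \<le> g0 s"
        "(\<lambda>s. \<bar>norm (w s) - g0 s\<bar>) integrable_on {0..T}" "integral {0..T} (\<lambda>s. \<bar>norm (w s) - g0 s\<bar>) \<le> \<eta>"
      by (rule L1_approx_continuous[of "\<lambda>s. norm (w s)" 0 T N C \<eta>]) (use len bd N \<eta> in auto)
    let ?E = "integral {0..T} (\<lambda>s. \<bar>norm (w s) - g0 s\<bar>)"
    define g where "g s = g0 s + e" for s
    define \<sigma> where "\<sigma> s = (LBINT r=0..s. g r)" for s :: real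
    have gc: "continuous_on UNIV g" unfolding g_def by (intro continuous_intros g0)
    have d\<sigma>: "(\<sigma> has_vector_derivative g s) (at s)" for s
      unfolding \<sigma>_def by (rule has_vector_derivative_LBINT[OF gc])
    have \<sigma>0: "\<sigma> 0 = 0" unfolding \<sigma>_def by (simp flip: zero_ereal_def)
    have gint: "(g has_integral (\<sigma> T)) {0..T}"
      using fundamental_theorem_of_calculus[of 0 T \<sigma> g] T \<sigma>0 has_vector_derivative_at_within[OF d\<sigma>] by simp
    have \<sigma>Tge: "\<sigma> T \<ge> e * T"
      using has_integral_le[OF has_integral_const_real[of e 0 T] gint] g0(2) T
      by (simp add: g_def mult.commute)
    have \<sigma>Tle: "\<sigma> T \<le> l + e + e * T"
    proof -
      have "((\<lambda>s. norm (w s) + \<bar>norm (w s) - g0 s\<bar> + e) has_integral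
         (l + ?E + e * T)) {0..T}"
        using has_integral_add[OF has_integral_add[OF len integrable_integral[OF g0(3)]] has_integral_const_real[of e 0 T]] T
        by (simp add: mult.commute)
      from has_integral_le[OF gint this] show ?thesis
        using g0(4) \<eta> by (smt (verit) g_def abs_ge_self)
    qed
    have \<sigma>Tpos: "\<sigma> T > 0" using \<sigma>Tge mult_pos_pos[OF e(1) T] by linarith
    define k where "k = (pi - 2 * e) / \<sigma> T"
    define \<phi> where "\<phi> = (\<lambda>s. e + k * \<sigma> s)"
    define c where "c = (\<lambda>s. (1 / \<sigma> T) *\<^sub>R z T + k *\<^sub>R (cot (\<phi> s) *\<^sub>R P (z s) + J (z s)))"
    have gnn: "g s \<ge> 0" for s using g0(2)[of s] e by (simp add: g_def)
    have \<phi>: "\<phi> s \<in> {e..pi - e}" if "s \<in> {0..T}" for s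
      unfolding \<phi>_def k_def using that
      by (intro calibration_integral(1)[where z = z and w = w and M = M and g = g and N = N])
         (assumption | rule T N lipz lipM dz dM z0 M0 JzT d\<sigma> gc gnn \<sigma>0 refl \<sigma>Tpos e)+
    have I: "((\<lambda>s. 2 * inner (w s) (c s) - g s * (norm (c s))\<^sup>2) has_integral
      ((norm (z T))\<^sup>2 / \<sigma> T + 2 * k * M T)) {0..T}"
      unfolding c_def \<phi>_def k_def
      by (intro calibration_integral(4)[where z = z and w = w and M = M and g = g and N = N])
         (assumption | rule T N lipz lipM dz dM z0 M0 JzT d\<sigma> gc gnn \<sigma>0 refl \<sigma>Tpos e)+
    have cB: "norm (c s) \<le> B" if s: "s \<in> {0..T}" for s
    proof -
      have "sin (\<phi> s) \<ge> sin e"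
      proof (cases "\<phi> s \<le> pi / 2")
        case True then show ?thesis using \<phi>[OF s] e by (intro sin_monotone_2pi_le) auto
      next
        case False
        then have "sin (pi - \<phi> s) \<ge> sin e" using \<phi>[OF s] e by (intro sin_monotone_2pi_le) auto
        then show ?thesis by simp
      qed
      then have ct: "\<bar>cot (\<phi> s)\<bar> \<le> 1 / sin e"
        using sine abs_cos_le_one[of "\<phi> s"] by (simp add: cot_def frac_le)
      have i: "0 \<le> 1 / \<sigma> T" "1 / \<sigma> T \<le> 1 / (e * T)" "0 \<le> k" "k \<le> pi / (e * T)"
        using \<sigma>Tge \<sigma>Tpos e T by (auto simp: k_def intro!: frac_le)
      have PB: "norm (P (z s)) \<le> Bz * BP"
        using BP(1)[of "z s"] Bz[OF s] BP(2) by (meson less_imp_le mult_right_mono order_trans)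
      have "norm (c s) \<le> norm ((1 / \<sigma> T) *\<^sub>R z T) + norm (k *\<^sub>R (cot (\<phi> s) *\<^sub>R P (z s) + J (z s)))"
        unfolding c_def by (rule norm_triangle_ineq)
      also have "\<dots> = (1 / \<sigma> T) * norm (z T) + k * norm (cot (\<phi> s) *\<^sub>R P (z s) + J (z s))"
        using i \<sigma>Tpos by simp
      also have "norm (cot (\<phi> s) *\<^sub>R P (z s) + J (z s)) \<le> \<bar>cot (\<phi> s)\<bar> * norm (P (z s)) + norm (P (z s))"
        using norm_triangle_ineq[of "cot (\<phi> s) *\<^sub>R P (z s)" "J (z s)"] by (simp add: norm_J)
      also have "\<dots> \<le> (1 / sin e) * (Bz * BP) + Bz * BP"
        using ct PB Bz0 BP sine by (intro add_mono mult_mono) auto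
      finally have "norm (c s) \<le> (1 / \<sigma> T) * norm (z T) + k * ((1 / sin e) * (Bz * BP) + Bz * BP)"
        using i by (simp add: mult_left_mono)
      also have "\<dots> \<le> B" unfolding B_def
      proof (intro add_mono mult_mono i)
        show "0 \<le> 1 / sin e * (Bz * BP) + Bz * BP" using Bz0 BP sine by simp
        show "0 \<le> 1 / (e * T)" "0 \<le> pi / (e * T)" using e T by auto
      qed (use Bz[of T] T Bz0 BP sine in auto)
      finally show ?thesis .
    qed
    have J: "((\<lambda>s. norm (w s) + \<bar>norm (w s) - g0 s\<bar> * B\<^sup>2) has_integral
        (l + ?E * B\<^sup>2)) {0..T}"
      by (intro has_integral_add len has_integral_mult_left integrable_integral g0)
    have "(norm (z T))\<^sup>2 / \<sigma> T + 2 * k * M T \<le> l + ?E * B\<^sup>2"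
    proof (rule has_integral_le[OF I J])
      fix s assume s: "s \<in> {0..T}"
      have "2 * inner (w s) (c s) \<le> 2 * norm (w s) * norm (c s)"
        using norm_cauchy_schwarz[of "w s" "c s"] by simp
      also have "\<dots> \<le> norm (w s) * (1 + (norm (c s))\<^sup>2)"
      proof -
        have "2 * norm (c s) \<le> 1 + (norm (c s))\<^sup>2"
          using sum_squares_bound[of 1 "norm (c s)"] by simp
        from mult_left_mono[OF this, of "norm (w s)"] show ?thesis by simp
      qed
      finally have "2 * inner (w s) (c s) - g s * (norm (c s))\<^sup>2 \<le> norm (w s) + (norm (w s) - g s) * (norm (c s))\<^sup>2"
        by (simp add: algebra_simps)
      also have "(norm (w s) - g s) * (norm (c s))\<^sup>2 \<le> \<bar>norm (w s) - g0 s\<bar> * B\<^sup>2"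
      proof (rule mult_mono)
        show "norm (w s) - g s \<le> \<bar>norm (w s) - g0 s\<bar>" using e by (simp add: g_def)
        show "(norm (c s))\<^sup>2 \<le> B\<^sup>2" using cB[OF s] by (intro power_mono) auto
      qed auto
      finally show "2 * inner (w s) (c s) - g s * (norm (c s))\<^sup>2 \<le> norm (w s) + \<bar>norm (w s) - g0 s\<bar> * B\<^sup>2"
        by simp
    qed
    also have "\<dots> \<le> l + e"
      using mult_right_mono[OF g0(4), of "B\<^sup>2"] \<eta>(2) by simp
    finally have "(norm (z T))\<^sup>2 + 2 * (pi - 2 * e) * M T \<le> (l + e) * \<sigma> T"
      using \<sigma>Tpos by (simp add: k_def field_simps)
    also have "\<dots> \<le> (l + e) * (l + e + e * T)"
      using l0 e \<sigma>Tle by (intro mult_left_mono) auto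
    finally show ?thesis .
  qed
  have "((\<lambda>e. (norm (z T))\<^sup>2 + 2 * (pi - 2 * e) * M T) \<longlongrightarrow> (norm (z T))\<^sup>2 + 2 * (pi - 2 * 0) * M T) (at_right 0)"
    by (intro tendsto_intros)
  moreover have "((\<lambda>e. (l + e) * (l + e + e * T)) \<longlongrightarrow> (l + 0) * (l + 0 + 0 * T)) (at_right 0)"
    by (intro tendsto_intros)
  moreover have "\<forall>\<^sub>F e in at_right 0. (norm (z T))\<^sup>2 + 2 * (pi - 2 * e) * M T \<le> (l + e) * (l + e + e * T)"
    using key by (auto simp: eventually_at_right[of 0 "pi/2"] intro!: exI[of _ "pi/2"])
  ultimately have "(norm (z T))\<^sup>2 + 2 * (pi - 2 * 0) * M T \<le> (l + 0) * (l + 0 + 0 * T)"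
    by (intro tendsto_le[OF trivial_limit_at_right_real])
  then show ?thesis by (simp add: power2_eq_square)
qed

lemma norm_P_le: "norm (P x) \<le> norm x"
  using norm_Pythagoras[of x] by (intro power2_le_imp_le[OF _ norm_ge_zero]) simp

lemma norm_diff_P_le: "norm (x - P x) \<le> norm x"
  using norm_Pythagoras[of x] by (intro power2_le_imp_le[OF _ norm_ge_zero]) simp

text \<open>When the bound is attained at unit speed, \<open>2 \<langle>w, c\<rangle> - |c|\<^sup>2 = 1 - |w - c|\<^sup>2\<close> turns the calibration identity
  into \<open>\<integral> |w - c|\<^sup>2 = O(e)\<close>.  In the limit \<open>z\<close> solves the equation \<open>z' = c\<close>, whose first integrals
  are \<open>z - P z - (s / T) z T\<close> and \<open>cot \<phi> P z - J z\<close>: along \<open>z\<close> their derivatives are bounded by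
  multiples of \<open>|w - c|\<close>, so they are constant.  The second one determines \<open>P z\<close>.\<close>
lemma length_bound_rigidity:
  fixes z w :: "real \<Rightarrow> 'a" and M :: "real \<Rightarrow> real"
  assumes T: "T > 0" and N: "negligible N" and lipz: "lip {0..T} z" and lipM: "lip {0..T} M"
    and dz: "\<And>s. s \<in> {0..T} - N \<Longrightarrow> (z has_vector_derivative w s) (at s within {0..T})"
    and dM: "\<And>s. s \<in> {0..T} - N \<Longrightarrow> (M has_vector_derivative inner (J (z s)) (w s)) (at s within {0..T})"
    and z0: "z 0 = 0" and M0: "M 0 = 0" and JzT: "J (z T) = 0"
    and unit: "\<And>s. s \<in> {0..T} - N \<Longrightarrow> norm (w s) = 1"
    and eq: "T\<^sup>2 \<le> (norm (z T))\<^sup>2 + 2 * pi * M T"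
  obtains C where "P C = C" "\<And>s. s \<in> {0..T} \<Longrightarrow> z s = (s / T) *\<^sub>R z T
      + (sin (pi * s / T) * cos (pi * s / T)) *\<^sub>R C + (sin (pi * s / T))\<^sup>2 *\<^sub>R J C"
proof -
  define k where "k e = (pi - 2 * e) / T" for e
  define \<phi> where "\<phi> e s = e + k e * s" for e s
  define c where "c e s = (1 / T) *\<^sub>R z T + k e *\<^sub>R (cot (\<phi> e s) *\<^sub>R P (z s) + J (z s))" for e s
  define D where "D e = T - ((norm (z T))\<^sup>2 / T + 2 * k e * M T)" for e
  have PzT: "P (z T) = 0" using JzT P_eq_0_iff by blast
  have dI: "((\<lambda>s::real. s) has_vector_derivative 1) (at s)" for s :: real
    by (auto simp flip: has_real_derivative_iff_has_vector_derivative)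
  have c1: "continuous_on UNIV (\<lambda>s::real. 1::real)" by simp
  have nn1: "(0::real) \<le> 1" by simp
  have I: "((\<lambda>s. 2 * inner (w s) (c e s) - 1 * (norm (c e s))\<^sup>2) has_integral
      ((norm (z T))\<^sup>2 / T + 2 * k e * M T)) {0..T}" if e: "0 < e" "e < pi / 2" for e
    unfolding c_def \<phi>_def k_def
    by (rule calibration_integral(4)[where z = z and w = w and M = M and N = N and g = "\<lambda>s. 1" and \<sigma> = "\<lambda>s. s"])
       (assumption | rule T N lipz lipM dz dM z0 M0 JzT dI c1 nn1 refl e)+
  have lipcot: "lip {0..T} (\<lambda>s. cot (\<phi> e s))" if e: "0 < e" "e < pi / 2" for e
    unfolding \<phi>_def k_def
    by (rule calibration_integral(2)[where z = z and w = w and M = M and N = N and g = "\<lambda>s. 1" and \<sigma> = "\<lambda>s. s"])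
       (assumption | rule T N lipz lipM dz dM z0 M0 JzT dI c1 nn1 refl e)+
  have dcot: "((\<lambda>s. cot (\<phi> e s)) has_vector_derivative - (k e * 1 * (1 + (cot (\<phi> e s))\<^sup>2))) (at s within {0..T})"
    if e: "0 < e" "e < pi / 2" and s: "s \<in> {0..T}" for e s
    unfolding \<phi>_def k_def
    by (rule calibration_integral(3)[where z = z and w = w and M = M and N = N and g = "\<lambda>s. 1" and \<sigma> = "\<lambda>s. s"])
       (assumption | rule T N lipz lipM dz dM z0 M0 JzT dI c1 nn1 refl e s)+
  have Dint: "((\<lambda>s. (norm (w s - c e s))\<^sup>2) has_integral D e) {0..T}" if e: "0 < e" "e < pi / 2" for e
  proof -
    have "((\<lambda>s. 1 - (2 * inner (w s) (c e s) - 1 * (norm (c e s))\<^sup>2)) has_integral D e) {0..T}"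
      using has_integral_diff[OF has_integral_const_real[of 1 0 T] I[OF e]] T by (simp add: D_def)
    then show ?thesis
    proof (rule has_integral_spike[OF N, rotated])
      fix s assume "s \<in> {0..T} - N"
      then have "inner (w s) (w s) = 1" using unit[of s] by (simp add: norm_eq_1)
      then show "(norm (w s - c e s))\<^sup>2 = 1 - (2 * inner (w s) (c e s) - 1 * (norm (c e s))\<^sup>2)"
        by (simp add: power2_norm_eq_inner inner_diff inner_commute)
    qed
  qed
  have Dle: "D e \<le> e * (4 * \<bar>M T\<bar> / T)" if e: "0 < e" "e < pi / 2" for e
  proof -
    have "D e = (T\<^sup>2 - ((norm (z T))\<^sup>2 + 2 * pi * M T) + 4 * e * M T) / T"
      using T by (simp add: D_def k_def field_simps power2_eq_square)
    also have "\<dots> \<le> (4 * e * \<bar>M T\<bar>) / T"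
    proof (rule divide_right_mono)
      have "4 * e * M T \<le> 4 * e * \<bar>M T\<bar>" using e by (intro mult_left_mono) auto
      then show "T\<^sup>2 - ((norm (z T))\<^sup>2 + 2 * pi * M T) + 4 * e * M T \<le> 4 * e * \<bar>M T\<bar>"
        using eq by linarith
    qed (use T in simp)
    finally show ?thesis by (simp add: mult_ac)
  qed
  have incr: "norm (F b - F a) \<le> K * (T + 4 * \<bar>M T\<bar> / T) * sqrt e"
    if e: "0 < e" "e < pi / 2" and ab: "0 \<le> a" "a \<le> b" "b \<le> T" and F: "lip {0..T} F"
      and dF: "\<And>s. s \<in> {0..T} - N \<Longrightarrow> (F has_vector_derivative f s) (at s within {0..T})"
      and K: "K \<ge> 0" and fd: "\<And>s. s \<in> {a..b} - N \<Longrightarrow> norm (f s) \<le> K * norm (w s - c e s)"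
    for F f :: "real \<Rightarrow> 'a" and K a b e
  proof -
    have "norm (F b - F a) \<le> K * (sqrt e * T + D e / sqrt e)"
      using e by (intro norm_increment_le[OF ab F N dF fd K Dint]) auto
    also have "D e / sqrt e \<le> e * (4 * \<bar>M T\<bar> / T) / sqrt e"
      using Dle[OF e] e by (intro divide_right_mono) auto
    also have "e * (4 * \<bar>M T\<bar> / T) / sqrt e = sqrt e * (4 * \<bar>M T\<bar> / T)"
      using e real_sqrt_mult_self[of e] by (simp add: divide_simps)
    finally have "norm (F b - F a) \<le> K * (sqrt e * T + sqrt e * (4 * \<bar>M T\<bar> / T))"
      using K by (simp add: mult_left_mono)
    then show ?thesis by (simp add: algebra_simps)
  qed
  have lim0: "x0 = 0" if X: "(X \<longlongrightarrow> x0) (at_right 0)"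
    and b: "\<And>e. 0 < e \<Longrightarrow> e < pi / 2 \<Longrightarrow> norm (X e) \<le> B * sqrt e" for X :: "real \<Rightarrow> 'a" and x0 B
  proof -
    have "((\<lambda>e. B * sqrt e) \<longlongrightarrow> B * sqrt 0) (at_right 0)" by (intro tendsto_intros)
    moreover have "\<forall>\<^sub>F e in at_right 0. norm (X e) \<le> B * sqrt e"
      using b by (auto simp: eventually_at_right[of 0 "pi/2"] intro!: exI[of _ "pi/2"])
    ultimately have "norm x0 \<le> B * sqrt 0"
      by (intro tendsto_le[OF trivial_limit_at_right_real _ tendsto_norm[OF X]])
    then show ?thesis by simp
  qed
  have straight: "z s - P (z s) = (s / T) *\<^sub>R z T" if s: "s \<in> {0..T}" for s
  proof -
    define R where "R r = z r - P (z r) - r *\<^sub>R ((1 / T) *\<^sub>R z T)" for r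
    have "R s = 0"
    proof (rule lim0[OF tendsto_const])
      fix e :: real assume e: "0 < e" "e < pi / 2"
      have "norm (R s - R 0) \<le> 1 * (T + 4 * \<bar>M T\<bar> / T) * sqrt e"
      proof (rule incr[OF e])
        show "lip {0..T} R" unfolding R_def
          by (intro lip_diff lipz lip_linear[OF bounded_linear_P] lip_bilinear[OF bounded_bilinear_scaleR] lip_const)
             (auto simp: lip_def intro: lipschitz_on_id)
        show "(R has_vector_derivative (w r - P (w r) - (1 / T) *\<^sub>R z T)) (at r within {0..T})" if "r \<in> {0..T} - N" for r
          unfolding R_def
          by (intro has_vector_derivative_diff dz[OF that] bounded_linear.has_vector_derivative[OF bounded_linear_P dz[OF that]])
             (unfold has_vector_derivative_def, rule bounded_linear_imp_has_derivative, rule bounded_linear_scaleR_left)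
        show "norm (w r - P (w r) - (1 / T) *\<^sub>R z T) \<le> 1 * norm (w r - c e r)" for r
          using norm_diff_P_le[of "w r - c e r"] T by (simp add: c_def PzT algebra_simps)
      qed (use s in auto)
      then show "norm (R s) \<le> (T + 4 * \<bar>M T\<bar> / T) * sqrt e" by (simp add: R_def z0)
    qed
    then show ?thesis by (simp add: R_def)
  qed
  define Y where "Y e s = cot (\<phi> e s) *\<^sub>R P (z s) - J (z s)" for e s
  have \<phi>0: "0 < \<phi> 0 s" "\<phi> 0 s < pi" if "0 < s" "s < T" for s
    using that T by (simp_all add: \<phi>_def k_def pos_divide_less_eq)
  have sin0: "sin (\<phi> 0 s) > 0" if "0 < s" "s < T" for s
    using \<phi>0[OF that] by (intro sin_gt_zero)
  \<comment> \<open>The phase for \<open>e\<close> is at least as near to \<open>\<pi> / 2\<close> as the limiting phase, so \<open>cot \<phi>\<close> is bounded on compact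
    subintervals of \<open>]0, T[\<close> uniformly in \<open>e\<close>.\<close>
  have sin_ge: "sin (\<phi> e s) \<ge> sin (\<phi> 0 s)" if e: "0 < e" "e < pi / 2" and s: "0 < s" "s < T" for e s
  proof -
    have "\<phi> e s - pi / 2 = (1 - 2 * e / pi) * (\<phi> 0 s - pi / 2)"
      using T by (simp add: \<phi>_def k_def field_simps)
    then have "\<bar>\<phi> e s - pi / 2\<bar> = \<bar>1 - 2 * e / pi\<bar> * \<bar>\<phi> 0 s - pi / 2\<bar>" by (simp add: abs_mult)
    also have "\<dots> \<le> 1 * \<bar>\<phi> 0 s - pi / 2\<bar>"
    proof (rule mult_right_mono)
      have "0 \<le> 2 * e / pi" "2 * e / pi \<le> 1" using e by (simp_all add: pos_divide_le_eq)
      then show "\<bar>1 - 2 * e / pi\<bar> \<le> 1" by simp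
    qed simp
    finally have "cos \<bar>\<phi> 0 s - pi / 2\<bar> \<le> cos \<bar>\<phi> e s - pi / 2\<bar>"
    proof (intro cos_monotone_0_pi_le)
      show "\<bar>\<phi> 0 s - pi / 2\<bar> \<le> pi"
        using \<phi>0[OF s] pi_gt_zero by (intro abs_leI) linarith+
    qed simp_all
    then show ?thesis by (simp add: cos_diff)
  qed
  have Ycont: "((\<lambda>e. Y e s) \<longlongrightarrow> Y 0 s) (at_right 0)" if "0 < s" "s < T" for s
    using sin0[OF that] unfolding Y_def \<phi>_def k_def
    by (intro tendsto_intros) auto
  have Yconst: "Y 0 b = Y 0 a" if ab: "0 < a" "a \<le> b" "b < T" for a b
  proof -
    obtain K where K: "\<And>s. s \<in> {a..b} \<Longrightarrow> 1 / sin (\<phi> 0 s) + 1 \<le> K"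
    proof -
      have "continuous_on {a..b} (\<lambda>s. 1 / sin (\<phi> 0 s) + 1)"
        using sin0 ab unfolding \<phi>_def by (intro continuous_intros) (auto simp: less_imp_neq[symmetric])
      from continuous_on_Icc_norm_bound[OF this] that show ?thesis
        by (metis abs_le_D1 real_norm_def)
    qed
    have K0: "K \<ge> 0"
    proof -
      have "0 < 1 / sin (\<phi> 0 a)" using sin0[of a] ab by simp
      moreover have "1 / sin (\<phi> 0 a) + 1 \<le> K" using K[of a] ab by simp
      ultimately show ?thesis by linarith
    qed
    have "Y 0 b - Y 0 a = 0"
    proof (rule lim0)
      show "((\<lambda>e. Y e b - Y e a) \<longlongrightarrow> Y 0 b - Y 0 a) (at_right 0)"
        using ab by (intro tendsto_diff Ycont) auto
      fix e :: real assume e: "0 < e" "e < pi / 2"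
      define f where "f s = cot (\<phi> e s) *\<^sub>R P (w s) + (- (k e * 1 * (1 + (cot (\<phi> e s))\<^sup>2))) *\<^sub>R P (z s) - J (w s)" for s
      show "norm (Y e b - Y e a) \<le> K * (T + 4 * \<bar>M T\<bar> / T) * sqrt e"
      proof (rule incr[OF e _ _ _ _ _ K0])
        show "lip {0..T} (Y e)" unfolding Y_def
          by (intro lip_diff lip_bilinear[OF bounded_bilinear_scaleR] lipcot e lip_linear[OF bounded_linear_P]
              lip_linear[OF bounded_linear_J] lipz)
        show "(Y e has_vector_derivative f s) (at s within {0..T})" if s: "s \<in> {0..T} - N" for s
          unfolding Y_def f_def using s
          by (intro has_vector_derivative_diff bounded_linear.has_vector_derivative[OF bounded_linear_J]
              bounded_bilinear.has_vector_derivative[OF bounded_bilinear_scaleR]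
              bounded_linear.has_vector_derivative[OF bounded_linear_P] dz dcot[OF e]) auto
        show "norm (f s) \<le> K * norm (w s - c e s)" if s: "s \<in> {a..b} - N" for s
        proof -
          define d where "d = w s - c e s"
          have s': "0 < s" "s < T" using s ab by auto
          have "f s = cot (\<phi> e s) *\<^sub>R P d - J d"
            by (simp add: d_def c_def f_def PzT JzT algebra_simps power2_eq_square)
          then have "norm (f s) \<le> \<bar>cot (\<phi> e s)\<bar> * norm (P d) + norm (P d)"
            using norm_triangle_ineq4[of "cot (\<phi> e s) *\<^sub>R P d" "J d"] by (simp add: norm_J)
          also have "\<dots> = (\<bar>cot (\<phi> e s)\<bar> + 1) * norm (P d)" by (simp add: algebra_simps)
          also have "\<dots> \<le> K * norm d"
          proof (rule mult_mono[OF _ norm_P_le K0])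
            have "\<bar>cot (\<phi> e s)\<bar> \<le> 1 / sin (\<phi> 0 s)"
              using sin_ge[OF e s'] sin0[OF s'] by (simp add: cot_def frac_le)
            then show "\<bar>cot (\<phi> e s)\<bar> + 1 \<le> K" using K[of s] s by auto
          qed auto
          finally show ?thesis by (simp add: d_def)
        qed
      qed (use ab in auto)
    qed
    then show ?thesis by simp
  qed
  define C where "C = Y 0 (T / 2)"
  have YC: "Y 0 s = C" if "0 < s" "s < T" for s
    using Yconst[of s "T/2"] Yconst[of "T/2" s] that T unfolding C_def
    by (cases "s \<le> T / 2") auto
  show thesis
  proof (rule that)
    show "P C = C" by (simp add: C_def Y_def)
    fix s assume s: "s \<in> {0..T}"
    show "z s = (s / T) *\<^sub>R z T + (sin (pi * s / T) * cos (pi * s / T)) *\<^sub>R C + (sin (pi * s / T))\<^sup>2 *\<^sub>R J C"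
    proof (cases "0 < s \<and> s < T")
      case True
      define p where "p = \<phi> 0 s"
      have p: "pi * s / T = p" by (simp add: p_def \<phi>_def k_def)
      have sp: "sin p > 0" using sin0 True by (simp add: p_def)
      have C: "C = cot p *\<^sub>R P (z s) - J (z s)" using YC[of s] True by (simp add: Y_def p_def)
      have "(sin p * cos p) *\<^sub>R C + (sin p)\<^sup>2 *\<^sub>R J C
        = (sin p * cos p * cot p + (sin p)\<^sup>2) *\<^sub>R P (z s) + ((sin p)\<^sup>2 * cot p - sin p * cos p) *\<^sub>R J (z s)"
        by (simp add: C algebra_simps)
      also have "sin p * cos p * cot p + (sin p)\<^sup>2 = 1"
        using sp by (simp add: cot_def power2_eq_square[symmetric])
      also have "(sin p)\<^sup>2 * cot p - sin p * cos p = 0"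
        using sp by (simp add: cot_def power2_eq_square)
      finally show ?thesis using straight[OF s] by (simp add: p algebra_simps)
    next
      case False
      then have "s = 0 \<or> s = T" using s by auto
      then show ?thesis using T z0 by auto
    qed
  qed
qed

end

section \<open>The algebra of the Reiter-Heisenberg group\<close>

definition outer :: "real^'q::finite \<Rightarrow> real^'p::finite \<Rightarrow> real^'p^'q"
  where "outer \<tau> \<eta> = (\<chi> i j. \<tau> $ i * \<eta> $ j)"

lemma A_op_eq: "A_op \<tau> z = (outer \<tau> (snd z), - (\<tau> v* fst z))"
  by (cases z) (simp add: A_op_def outer_def)

lemma outer_mult_vec: "outer \<tau> \<eta> *v y = inner \<eta> y *\<^sub>R \<tau>"
  by (simp add: vec_eq_iff outer_def matrix_vector_mult_def inner_vec_def sum_distrib_left mult_ac)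

lemma vec_mult_outer: "\<sigma> v* outer \<tau> \<eta> = inner \<sigma> \<tau> *\<^sub>R \<eta>"
  by (simp add: vec_eq_iff outer_def vector_matrix_mult_def inner_vec_def sum_distrib_right sum_distrib_left mult_ac)

lemma bounded_bilinear_outer: "bounded_bilinear outer"
  by (auto simp: bilinear_def outer_def vec_eq_iff algebra_simps simp flip: bilinear_conv_bounded_bilinear
      intro!: linearI)

lemma outer_simps: "outer (\<tau> + \<tau>') \<eta> = outer \<tau> \<eta> + outer \<tau>' \<eta>" "outer \<tau> (\<eta> + \<eta>') = outer \<tau> \<eta> + outer \<tau> \<eta>'"
    "outer (c *\<^sub>R \<tau>) \<eta> = c *\<^sub>R outer \<tau> \<eta>" "outer \<tau> (c *\<^sub>R \<eta>) = c *\<^sub>R outer \<tau> \<eta>"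
    "outer \<tau> (- \<eta>) = - outer \<tau> \<eta>" "outer \<tau> 0 = 0" "outer 0 \<eta> = 0" "outer \<tau> (\<eta> - \<eta>') = outer \<tau> \<eta> - outer \<tau> \<eta>'"
  by (simp_all add: outer_def vec_eq_iff algebra_simps)

lemma inner_outer: "inner u (outer \<tau> b) = inner (\<tau> v* u) b"
proof -
  have "inner u (outer \<tau> b) = (\<Sum>i\<in>UNIV. \<Sum>j\<in>UNIV. u $ i $ j * (\<tau> $ i * b $ j))"
    by (simp add: outer_def inner_vec_def)
  also have "\<dots> = (\<Sum>j\<in>UNIV. \<Sum>i\<in>UNIV. u $ i $ j * (\<tau> $ i * b $ j))"
    by (rule sum.swap)
  also have "\<dots> = inner (\<tau> v* u) b"
    by (simp add: vector_matrix_mult_def inner_vec_def sum_distrib_right sum_distrib_left mult_ac)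
  finally show ?thesis .
qed

lemma inner_outer': "inner (outer \<tau> b) u = inner b (\<tau> v* u)"
  by (simp add: inner_commute[of _ u] inner_outer inner_commute)

lemma inner_mat_vec:
  fixes x :: "real^'p::finite^'q::finite"
  shows "inner \<tau> (x *v y) = inner (\<tau> v* x) y"
  by (rule dot_lmul_matrix[symmetric])

lemma bounded_bilinear_vec_mat: "bounded_bilinear (\<lambda>(\<tau>::real^'q::finite) (x::real^'p::finite^'q). \<tau> v* x)"
  by (auto simp: bilinear_def vector_matrix_mult_def vec_eq_iff algebra_simps sum.distrib sum_distrib_left simp flip: bilinear_conv_bounded_bilinear
      intro!: linearI)

lemmas vec_mat_simps =
  bounded_bilinear_vec_mat[THEN bounded_bilinear.add_left]
  bounded_bilinear_vec_mat[THEN bounded_bilinear.add_right]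
  bounded_bilinear_vec_mat[THEN bounded_bilinear.scaleR_left]
  bounded_bilinear_vec_mat[THEN bounded_bilinear.scaleR_right]
  bounded_bilinear_vec_mat[THEN bounded_bilinear.minus_right]
  bounded_bilinear_vec_mat[THEN bounded_bilinear.zero_right]
  bounded_bilinear_vec_mat[THEN bounded_bilinear.zero_left]
  bounded_bilinear_vec_mat[THEN bounded_bilinear.diff_right]

lemma bounded_bilinear_mat_vec: "bounded_bilinear (\<lambda>(x::real^'p::finite^'q::finite) (y::real^'p). x *v y)"
  by (auto simp: bilinear_def matrix_vector_mult_def vec_eq_iff algebra_simps sum.distrib sum_distrib_left simp flip: bilinear_conv_bounded_bilinear
      intro!: linearI)

lemmas mat_vec_simps =
  bounded_bilinear_mat_vec[THEN bounded_bilinear.add_left]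
  bounded_bilinear_mat_vec[THEN bounded_bilinear.add_right]
  bounded_bilinear_mat_vec[THEN bounded_bilinear.scaleR_left]
  bounded_bilinear_mat_vec[THEN bounded_bilinear.scaleR_right]
  bounded_bilinear_mat_vec[THEN bounded_bilinear.minus_left]
  bounded_bilinear_mat_vec[THEN bounded_bilinear.minus_right]
  bounded_bilinear_mat_vec[THEN bounded_bilinear.zero_left]
  bounded_bilinear_mat_vec[THEN bounded_bilinear.zero_right]
  bounded_bilinear_mat_vec[THEN bounded_bilinear.diff_left]
  bounded_bilinear_mat_vec[THEN bounded_bilinear.diff_right]

lemma rhQ_eq: "rhQ z w = (1/2) *\<^sub>R (fst z *v snd w - fst w *v snd z)"
  by (simp add: rhQ_def case_prod_beta)

lemma bounded_bilinear_rhQ: "bounded_bilinear (rhQ :: ('q::finite, 'p::finite) V1 \<Rightarrow> _)"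
  by (auto simp: bilinear_def rhQ_eq mat_vec_simps algebra_simps simp flip: bilinear_conv_bounded_bilinear
      intro!: linearI)

lemma rhQ_swap: "rhQ w z = - rhQ z w"
  by (simp add: rhQ_eq algebra_simps)

lemma rhQ_self [simp]: "rhQ z z = 0"
  by (simp add: rhQ_eq)

lemma A_op_simps: "A_op \<tau> (z + w) = A_op \<tau> z + A_op \<tau> w" "A_op \<tau> (z - w) = A_op \<tau> z - A_op \<tau> w"
    "A_op \<tau> (c *\<^sub>R z) = c *\<^sub>R A_op \<tau> z" "A_op \<tau> (- z) = - A_op \<tau> z" "A_op \<tau> 0 = 0"
    "A_op (c *\<^sub>R \<tau>) z = c *\<^sub>R A_op \<tau> z" "A_op 0 z = 0"
  by (simp_all add: A_op_eq outer_simps vec_mat_simps algebra_simps prod_eq_iff)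

lemma A_op_skew: "inner (A_op \<tau> z) w = - inner z (A_op \<tau> w)"
  by (simp add: A_op_eq inner_prod_def inner_outer inner_outer' inner_commute)

lemma A_op_A_op: "A_op \<tau> (A_op \<tau> z) = (- outer \<tau> (\<tau> v* fst z), - ((norm \<tau>)\<^sup>2 *\<^sub>R snd z))"
  by (simp add: A_op_eq outer_simps vec_mult_outer power2_norm_eq_inner)

lemma A_op_cube: "A_op \<tau> (A_op \<tau> (A_op \<tau> z)) = - ((norm \<tau>)\<^sup>2 *\<^sub>R A_op \<tau> z)"
  unfolding A_op_A_op[of \<tau> "A_op \<tau> z"]
  by (simp add: A_op_eq outer_simps vec_mult_outer power2_norm_eq_inner)

text \<open>Pairing the vertical direction with \<open>\<tau>\<close> turns the vector-valued form \<open>Q\<close> into the scalar symplectic form of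
  \<open>A\<^sub>\<tau>\<close>; here the group structure meets the calibration.\<close>
lemma inner_rhQ: "inner \<tau> (rhQ z w) = - (1/2) * inner (A_op \<tau> z) w"
  by (simp add: rhQ_eq A_op_eq inner_prod_def inner_outer inner_outer' inner_mat_vec inner_diff_right
      inner_commute algebra_simps)

lemma skew_rotation_A_op:
  assumes "norm \<theta> = 1 \<or> \<theta> = 0" shows "skew_rotation (\<lambda>z. - A_op \<theta> z)"
proof (rule skew_rotation.intro)
  show "Real_Vector_Spaces.linear (\<lambda>z. - A_op \<theta> z)"
    by (rule linear_compose_neg[OF linear_A_op])
qed (use assms in \<open>auto simp: A_op_skew A_op_simps A_op_cube\<close>)

section \<open>Orthogonal projections and the Moore-Penrose inverse\<close>

lemma proj_on_eqI:
  assumes "subspace S" "w \<in> S" "\<And>z. z \<in> S \<Longrightarrow> orthogonal (t - w) z"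
  shows "proj_on S t = w"
  unfolding proj_on_def
proof (rule the_equality)
  show "w \<in> S \<and> (\<forall>z\<in>S. orthogonal (t - w) z)" using assms by blast
  fix v assume v: "v \<in> S \<and> (\<forall>z\<in>S. orthogonal (t - v) z)"
  have "w - v \<in> S" using v assms subspace_diff by blast
  then have "inner (t - v) (w - v) = 0" "inner (t - w) (w - v) = 0"
    using v assms by (auto simp: orthogonal_def)
  then have "inner (w - v) (w - v) = 0" by (simp add: inner_diff_left)
  then show "v = w" by simp
qed

lemma subspace_mat_im: "subspace (mat_im x)"
  unfolding mat_im_def
  by (intro linear_subspace_image matrix_vector_mul_linear subspace_UNIV)

lemma orthogonal_comp_mat_im_iff:
  fixes x :: "real^'p::finite^'q::finite"
  shows "v \<in> orthogonal_comp (mat_im x) \<longleftrightarrow> v v* x = 0"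
proof -
  have "v \<in> orthogonal_comp (mat_im x) \<longleftrightarrow> (\<forall>y. inner (v v* x) y = 0)"
    by (auto simp: orthogonal_comp_def mat_im_def orthogonal_def inner_commute[of _ v] dot_lmul_matrix)
  also have "\<dots> \<longleftrightarrow> v v* x = 0" by (metis inner_eq_zero_iff inner_zero_left)
  finally show ?thesis .
qed

lemma proj_on_mat_im:
  fixes x :: "real^'p::finite^'q::finite"
  assumes "v v* x = 0"
  shows "proj_on (mat_im x) (x *v b + v) = x *v b"
    and "proj_on (orthogonal_comp (mat_im x)) (x *v b + v) = v"
proof -
  have v: "v \<in> orthogonal_comp (mat_im x)" using assms by (simp add: orthogonal_comp_mat_im_iff)
  have b: "x *v b \<in> mat_im x" by (simp add: mat_im_def)
  show "proj_on (mat_im x) (x *v b + v) = x *v b"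
    using v b by (intro proj_on_eqI subspace_mat_im) (auto simp: orthogonal_comp_def orthogonal_commute)
  show "proj_on (orthogonal_comp (mat_im x)) (x *v b + v) = v"
    using v b by (intro proj_on_eqI subspace_orthogonal_comp) (auto simp: orthogonal_comp_def orthogonal_commute)
qed

lemma mat_im_decomp:
  fixes x :: "real^'p::finite^'q::finite"
  obtains b v where "t = x *v b + v" "v v* x = 0"
proof -
  have sp: "span (mat_im x) = mat_im x" using subspace_mat_im by (simp add: span_eq_iff)
  obtain y v where y: "y \<in> mat_im x" and v: "\<And>w. w \<in> mat_im x \<Longrightarrow> orthogonal v w" and t: "t = y + v"
    using orthogonal_subspace_decomp_exists[of "mat_im x" t] unfolding sp by metis
  obtain b where "y = x *v b" using y by (auto simp: mat_im_def)
  moreover have "v v* x = 0"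
    using v by (simp add: orthogonal_comp_def orthogonal_commute flip: orthogonal_comp_mat_im_iff)
  ultimately show ?thesis using t that by blast
qed

lemma ker_decomp:
  fixes x :: "real^'p::finite^'q::finite"
  obtains n where "x *v n = x *v b" "\<And>k. x *v k = 0 \<Longrightarrow> orthogonal n k"
proof -
  have K: "subspace {k. x *v k = 0}" by (auto simp: subspace_def mat_vec_simps)
  obtain y n where "y \<in> span {k. x *v k = 0}" "\<And>w. w \<in> span {k. x *v k = 0} \<Longrightarrow> orthogonal n w" "b = y + n"
    using orthogonal_subspace_decomp_exists[of "{k. x *v k = 0}" b] by metis
  moreover have "span {k. x *v k = 0} = {k. x *v k = 0}" using K by (simp add: span_eq_iff)
  ultimately show ?thesis using that[of n] by (auto simp: mat_vec_simps)
qed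

lemma ker_orth_unique:
  fixes x :: "real^'p::finite^'q::finite"
  assumes "x *v n = x *v m" "\<And>k. x *v k = 0 \<Longrightarrow> orthogonal n k" "\<And>k. x *v k = 0 \<Longrightarrow> orthogonal m k"
  shows "n = m"
proof -
  have "x *v (n - m) = 0" using assms(1) by (simp add: mat_vec_simps)
  then have "inner n (n - m) = 0" "inner m (n - m) = 0" using assms by (auto simp: orthogonal_def)
  then have "inner (n - m) (n - m) = 0" by (simp add: inner_diff_left)
  then show ?thesis by simp
qed

text \<open>The vector that the Moore-Penrose inverse assigns to \<open>t\<close> exists and is unique for each \<open>t\<close>, by
  orthogonal decomposition along \<open>Im x\<close> and \<open>ker x\<close>; uniqueness makes it linear in \<open>t\<close>, hence a matrix.\<close>
lemma moore_penrose_works: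
  fixes x :: "real^'p::finite^'q::finite" and t :: "real^'q"
  shows "x *v (moore_penrose x *v t) = proj_on (mat_im x) t"
    and "x *v k = 0 \<Longrightarrow> orthogonal (moore_penrose x *v t) k"
proof -
  let ?spec = "\<lambda>t n. x *v n = proj_on (mat_im x) t \<and> (\<forall>k. x *v k = 0 \<longrightarrow> orthogonal n k)"
  have "\<exists>n. ?spec t n" for t
  proof -
    obtain b v where t: "t = x *v b + v" "v v* x = 0" by (rule mat_im_decomp)
    obtain n where "x *v n = x *v b" "\<And>k. x *v k = 0 \<Longrightarrow> orthogonal n k" by (rule ker_decomp) blast
    then show ?thesis using proj_on_mat_im(1)[OF t(2), of b] t(1) by auto
  qed
  then obtain f where f: "\<And>t. ?spec t (f t)" by metis
  have uniq: "n = f t" if "?spec t n" for t n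
    using f[of t] that by (intro ker_orth_unique[of x]) auto
  have padd: "proj_on (mat_im x) (s + t) = proj_on (mat_im x) s + proj_on (mat_im x) t"
    and pscale: "proj_on (mat_im x) (c *\<^sub>R t) = c *\<^sub>R proj_on (mat_im x) t" for s t c
  proof -
    obtain b v where t: "t = x *v b + v" "v v* x = 0" by (rule mat_im_decomp)
    obtain b' v' where s: "s = x *v b' + v'" "v' v* x = 0" by (rule mat_im_decomp)
    show "proj_on (mat_im x) (s + t) = proj_on (mat_im x) s + proj_on (mat_im x) t"
      using proj_on_mat_im(1)[of v x b] proj_on_mat_im(1)[of v' x b'] proj_on_mat_im(1)[of "v' + v" x "b' + b"] s t
      by (simp add: vec_mat_simps mat_vec_simps algebra_simps)
    show "proj_on (mat_im x) (c *\<^sub>R t) = c *\<^sub>R proj_on (mat_im x) t"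
      using proj_on_mat_im(1)[of v x b] proj_on_mat_im(1)[of "c *\<^sub>R v" x "c *\<^sub>R b"] t
      by (simp add: vec_mat_simps mat_vec_simps algebra_simps)
  qed
  have "linear f"
  proof (rule linearI)
    show "f (s + t) = f s + f t" for s t
      using f[of s] f[of t] by (intro uniq[symmetric]) (auto simp: mat_vec_simps padd orthogonal_clauses)
    show "f (c *\<^sub>R t) = c *\<^sub>R f t" for c t
      using f[of t] by (intro uniq[symmetric]) (auto simp: mat_vec_simps pscale orthogonal_clauses)
  qed
  then have mf: "matrix f *v t = f t" for t by (simp add: matrix_works)
  have "moore_penrose x = matrix f"
    unfolding moore_penrose_def
  proof (rule the_equality)
    show "\<forall>t. x *v (matrix f *v t) = proj_on (mat_im x) t \<and> (\<forall>k. x *v k = 0 \<longrightarrow> orthogonal (matrix f *v t) k)"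
      using f by (simp add: mf)
    fix z assume "\<forall>t. x *v (z *v t) = proj_on (mat_im x) t \<and> (\<forall>k. x *v k = 0 \<longrightarrow> orthogonal (z *v t) k)"
    then have "z *v t = matrix f *v t" for t using uniq[where t = t and n = "z *v t"] mf by simp
    then show "z = matrix f" by (simp add: matrix_eq)
  qed
  then show "x *v (moore_penrose x *v t) = proj_on (mat_im x) t"
    "x *v k = 0 \<Longrightarrow> orthogonal (moore_penrose x *v t) k"
    using f[of t] mf by simp_all
qed

lemma moore_penrose_decomp:
  fixes x :: "real^'p::finite^'q::finite"
  defines "n t \<equiv> moore_penrose x *v t" and "N t \<equiv> proj_on (orthogonal_comp (mat_im x)) t"
  shows "t = x *v n t + N t" and "N t v* x = 0" and "t \<in> mat_im x \<longleftrightarrow> N t = 0"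
proof -
  obtain b v where t: "t = x *v b + v" "v v* x = 0" by (rule mat_im_decomp)
  have N: "N t = v" using proj_on_mat_im(2)[OF t(2)] t(1) by (simp add: N_def)
  have "x *v n t = x *v b" using proj_on_mat_im(1)[OF t(2)] t(1) moore_penrose_works(1)[of x t] by (simp add: n_def)
  then show 1: "t = x *v n t + N t" using t N by simp
  show 2: "N t v* x = 0" using N t by simp
  show "t \<in> mat_im x \<longleftrightarrow> N t = 0"
  proof
    assume "t \<in> mat_im x"
    then obtain y where "t = x *v y" by (auto simp: mat_im_def)
    then show "N t = 0" using proj_on_mat_im(2)[of 0 x y] by (simp add: N_def vec_mat_simps)
  next
    assume "N t = 0"
    then show "t \<in> mat_im x" using 1 by (metis add.right_neutral mat_im_def rangeI)
  qed
qed

text \<open>\<open>x\<^sup>\<dagger> t\<close> is the shortest vector that \<open>x\<close> maps to the projection of \<open>t\<close>, and the only one of its length.\<close>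
lemma norm_moore_penrose_le:
  fixes x :: "real^'p::finite^'q::finite"
  fixes b :: "real^'p"
  assumes v: "v v* x = 0"
  defines "n \<equiv> moore_penrose x *v (x *v b + v)"
  shows "norm n \<le> norm b" and "norm b \<le> norm n \<Longrightarrow> b = n"
proof -
  have "x *v n = x *v b" using moore_penrose_works(1)[of x "x *v b + v"] proj_on_mat_im(1)[OF v, of b] by (simp add: n_def)
  then have "x *v (b - n) = 0" by (simp add: mat_vec_simps)
  then have "inner n (b - n) = 0" unfolding n_def using moore_penrose_works(2) by (auto simp: orthogonal_def)
  then have *: "(norm b)\<^sup>2 = (norm n)\<^sup>2 + (norm (b - n))\<^sup>2"
    by (simp add: power2_norm_eq_inner inner_diff inner_commute)
  then show "norm n \<le> norm b" by (intro power2_le_imp_le[OF _ norm_ge_zero]) simp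
  assume "norm b \<le> norm n"
  then have "(norm b)\<^sup>2 \<le> (norm n)\<^sup>2" by (intro power_mono) auto
  with * have "(norm (b - n))\<^sup>2 \<le> 0" by linarith
  then show "b = n" by simp
qed

section \<open>Horizontal curves and lower bounds for their length\<close>

abbreviation hor :: "('q::finite, 'p::finite) RH \<Rightarrow> ('q, 'p) V1"
  where "hor g \<equiv> (fst g, fst (snd g))"

lemma horizontal_velocity_eq: "horizontal_velocity g w = (fst w, snd w, rhQ (hor g) w)"
  by (simp add: horizontal_velocity_def case_prod_beta)

lemma bounded_linear_hor: "bounded_linear (hor :: ('q::finite, 'p::finite) RH \<Rightarrow> ('q, 'p) V1)"
  by (intro bounded_linear_Pair bounded_linear_fst bounded_linear_compose[OF bounded_linear_fst bounded_linear_snd])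

lemma bounded_linear_vert: "bounded_linear (\<lambda>g :: ('q::finite, 'p::finite) RH. snd (snd g))"
  by (intro bounded_linear_compose[OF bounded_linear_snd bounded_linear_snd])

lemma has_vector_derivative_horizontal:
  assumes "(\<gamma> has_vector_derivative horizontal_velocity (\<gamma> s) w) F"
  shows "((\<lambda>s. hor (\<gamma> s)) has_vector_derivative w) F"
    and "((\<lambda>s. snd (snd (\<gamma> s))) has_vector_derivative rhQ (hor (\<gamma> s)) w) F"
  using bounded_linear.has_vector_derivative[OF bounded_linear_hor assms]
    bounded_linear.has_vector_derivative[OF bounded_linear_vert assms]
  by (simp_all add: horizontal_velocity_eq)

lemma has_vector_derivative_horizontalI:
  assumes "(z has_vector_derivative w) (at s within S)" "(t has_vector_derivative rhQ (z s) w) (at s within S)"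
  shows "((\<lambda>s. (fst (z s), snd (z s), t s)) has_vector_derivative
    horizontal_velocity (fst (z s), snd (z s), t s) w) (at s within S)"
  unfolding horizontal_velocity_eq fst_conv snd_conv prod.collapse
  by (intro has_vector_derivative_Pair assms
      bounded_linear.has_vector_derivative[OF bounded_linear_fst assms(1)]
      bounded_linear.has_vector_derivative[OF bounded_linear_snd assms(1)])

text \<open>The calibration estimates an area function \<open>M\<close> with \<open>M' = \<langle>J z, w\<rangle>\<close>.  For a horizontal curve and
  \<open>J = - A\<^sub>\<theta>\<close> that function is twice the \<open>\<theta>\<close>-component of the vertical coordinate.\<close>
lemma twice_vertical:
  fixes \<gamma> :: "real \<Rightarrow> ('q::finite, 'p::finite) RH"
  shows "lip {a..b} \<gamma> \<Longrightarrow> lip {a..b} (\<lambda>s. 2 * inner \<theta> (snd (snd (\<gamma> s))))"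
    and "(\<gamma> has_vector_derivative horizontal_velocity (\<gamma> s) (w s)) F \<Longrightarrow>
      ((\<lambda>s. 2 * inner \<theta> (snd (snd (\<gamma> s)))) has_vector_derivative inner (- A_op \<theta> (hor (\<gamma> s))) (w s)) F"
proof -
  show "lip {a..b} \<gamma> \<Longrightarrow> lip {a..b} (\<lambda>s. 2 * inner \<theta> (snd (snd (\<gamma> s))))"
    by (intro lip_bilinear[OF bounded_bilinear_mult] lip_const lip_bilinear[OF bounded_bilinear_inner]
        lip_linear[OF bounded_linear_vert])
  assume d: "(\<gamma> has_vector_derivative horizontal_velocity (\<gamma> s) (w s)) F"
  have "((\<lambda>s. 2 * inner \<theta> (snd (snd (\<gamma> s)))) has_vector_derivative 2 * inner \<theta> (rhQ (hor (\<gamma> s)) (w s))) F"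
    by (intro bounded_linear.has_vector_derivative[OF bounded_linear_mult_right]
        bounded_linear.has_vector_derivative[OF bounded_linear_inner_right] has_vector_derivative_horizontal(2) d)
  then show "((\<lambda>s. 2 * inner \<theta> (snd (snd (\<gamma> s)))) has_vector_derivative inner (- A_op \<theta> (hor (\<gamma> s))) (w s)) F"
    by (simp add: inner_rhQ)
qed
lemma AE_negligible_iff:
  "(AE s\<in>S in lebesgue. P s) \<longleftrightarrow> (\<exists>N. negligible N \<and> (\<forall>s\<in>S - N. P s))"
proof
  assume "AE s\<in>S in lebesgue. P s"
  then obtain N where "N \<in> null_sets lebesgue" "{s. \<not> (s \<in> S \<longrightarrow> P s)} \<subseteq> N"
    by (auto simp: eventually_ae_filter)
  then show "\<exists>N. negligible N \<and> (\<forall>s\<in>S - N. P s)"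
    by (intro exI[of _ N]) (auto simp: negligible_iff_null_sets)
next
  assume "\<exists>N. negligible N \<and> (\<forall>s\<in>S - N. P s)"
  then obtain N where "negligible N" "\<forall>s\<in>S - N. P s" by blast
  then show "AE s\<in>S in lebesgue. P s"
    by (intro AE_I'[of N]) (auto simp: negligible_iff_null_sets)
qed

lemma horizontal_curve_lengthD:
  assumes "horizontal_curve T \<gamma> w"
  shows "((\<lambda>s. norm (w s)) has_integral control_length T w) {0..T}"
proof -
  obtain C where C: "AE s\<in>{0..T} in lebesgue. norm (w s) \<le> C"
    and m: "set_borel_measurable lebesgue {0..T} w"
    using assms by (auto simp: horizontal_curve_def)
  have m': "(\<lambda>s. indicator {0..T} s *\<^sub>R norm (w s)) \<in> borel_measurable lebesgue"
  proof -
    have "(\<lambda>s. norm (indicator {0..T} s *\<^sub>R w s)) \<in> borel_measurable lebesgue"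
      using m unfolding set_borel_measurable_def by measurable
    then show ?thesis by (simp add: indicator_def if_distrib cong: if_cong)
  qed
  have "set_integrable lebesgue {0..T} (\<lambda>s. norm (w s))"
    unfolding set_integrable_def
  proof (rule Bochner_Integration.integrable_bound[OF _ m'])
    show "integrable lebesgue (\<lambda>s. indicator {0..T} s *\<^sub>R C)"
      using integrable_const_ivl[of C 0 T] absolutely_integrable_on_const[of "{0..T}" C]
      by (simp add: set_integrable_def)
    show "AE s in lebesgue. norm (indicator {0..T} s *\<^sub>R norm (w s)) \<le> norm (indicator {0..T} s *\<^sub>R C)"
      using C by eventually_elim (auto simp: indicator_def)
  qed
  from has_integral_set_lebesgue[OF this] show ?thesis by (simp add: control_length_def)
qed

lemma horizontal_curveE:
  assumes "horizontal_curve T \<gamma> w"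
  obtains N C where "T > 0" "negligible N" "lip {0..T} \<gamma>"
    "\<And>s. s \<in> {0..T} - N \<Longrightarrow> (\<gamma> has_vector_derivative horizontal_velocity (\<gamma> s) (w s)) (at s within {0..T})"
    "\<And>s. s \<in> {0..T} - N \<Longrightarrow> norm (w s) \<le> C"
proof -
  obtain N N' C where "negligible N" "negligible N'"
    "\<forall>s\<in>{0..T} - N. (\<gamma> has_vector_derivative horizontal_velocity (\<gamma> s) (w s)) (at s within {0..T})"
    "\<forall>s\<in>{0..T} - N'. norm (w s) \<le> C"
    using assms unfolding horizontal_curve_def AE_negligible_iff by metis
  then show ?thesis
    using assms by (intro that[of "N \<union> N'" C]) (auto simp: horizontal_curve_def lip_def intro: negligible_Un)
qed

lemma horizontal_curveI:
  assumes T: "T > 0" and w: "continuous_on UNIV w"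
    and d: "\<And>s. (\<gamma> has_vector_derivative horizontal_velocity (\<gamma> s) (w s)) (at s)"
  shows "horizontal_curve T \<gamma> w"
proof -
  have wT: "continuous_on {0..T} w" using w by (rule continuous_on_subset) auto
  have g: "continuous_on {0..T} \<gamma>"
    using d by (meson continuous_at_imp_continuous_on has_vector_derivative_continuous)
  have D: "continuous_on {0..T} (\<lambda>s. horizontal_velocity (\<gamma> s) (w s))"
    unfolding horizontal_velocity_eq
    by (intro continuous_intros continuous_on_rhQ g wT)
  have "lip {0..T} \<gamma>"
    by (rule lip_C1[OF has_vector_derivative_at_within[OF d] D])
  moreover have "\<exists>C. AE s\<in>{0..T} in lebesgue. norm (w s) \<le> C"
  proof -
    obtain C where "\<And>s. s \<in> {0..T} \<Longrightarrow> norm (w s) \<le> C"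
      by (rule continuous_on_Icc_norm_bound[OF wT]) blast
    then show ?thesis by (intro exI[of _ C] AE_I2) auto
  qed
  moreover have "set_borel_measurable lebesgue {0..T} w"
    using wT borel_measurable_continuous_on_indicator[of "{0..T}" w]
    by (auto simp: set_borel_measurable_def intro!: measurable_completion)
  ultimately show ?thesis
    using T has_vector_derivative_at_within[OF d] unfolding horizontal_curve_def lip_def
    by (intro conjI) auto
qed

lemma control_length_nonneg: "control_length T w \<ge> 0"
  unfolding control_length_def set_lebesgue_integral_def by (rule integral_nonneg_AE) auto

text \<open>If \<open>A\<^sub>\<theta>\<close> annihilates the horizontal endpoint, the projection of the curve to the range of \<open>A\<^sub>\<theta>\<close> is a closed
  loop, whose area the \<open>\<theta>\<close>-component of the vertical coordinate measures.  With \<open>\<theta> = 0\<close> no area is counted,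
  and the bound reduces to the Euclidean length of the horizontal part.\<close>
lemma length_ge_isoperimetric:
  fixes \<gamma> :: "real \<Rightarrow> ('q::finite, 'p::finite) RH"
  assumes h: "horizontal_curve T \<gamma> w" and 0: "\<gamma> 0 = 0"
    and \<theta>: "norm \<theta> = 1 \<or> \<theta> = 0" "A_op \<theta> (hor (\<gamma> T)) = 0"
  shows "(norm (hor (\<gamma> T)))\<^sup>2 + 4 * pi * inner \<theta> (snd (snd (\<gamma> T))) \<le> (control_length T w)\<^sup>2"
proof -
  interpret skew_rotation "\<lambda>z. - A_op \<theta> z" by (rule skew_rotation_A_op) fact
  obtain N C where N: "T > 0" "negligible N" and lip: "lip {0..T} \<gamma>"
    and d: "\<And>s. s \<in> {0..T} - N \<Longrightarrow> (\<gamma> has_vector_derivative horizontal_velocity (\<gamma> s) (w s)) (at s within {0..T})"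
    and C: "\<And>s. s \<in> {0..T} - N \<Longrightarrow> norm (w s) \<le> C"
    by (rule horizontal_curveE[OF h]) blast
  have "(norm (hor (\<gamma> T)))\<^sup>2 + 2 * pi * (2 * inner \<theta> (snd (snd (\<gamma> T)))) \<le> (control_length T w)\<^sup>2"
  proof (rule length_lower_bound[OF N])
    show "lip {0..T} (\<lambda>s. hor (\<gamma> s))" by (rule lip_linear[OF bounded_linear_hor lip])
    show "lip {0..T} (\<lambda>s. 2 * inner \<theta> (snd (snd (\<gamma> s))))" by (rule twice_vertical(1)[OF lip])
    show "((\<lambda>s. 2 * inner \<theta> (snd (snd (\<gamma> s)))) has_vector_derivative inner (- A_op \<theta> (hor (\<gamma> s))) (w s)) (at s within {0..T})"
      if "s \<in> {0..T} - N" for s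
      by (rule twice_vertical(2)) (rule d, rule that)
  qed (use 0 \<theta> has_vector_derivative_horizontal(1)[OF d] C horizontal_curve_lengthD[OF h] in \<open>auto simp: zero_prod_def\<close>)
  then show ?thesis by simp
qed

lemma length_ge_horizontal_distance:
  assumes "horizontal_curve T \<gamma> w" "\<gamma> 0 = 0"
  shows "norm (hor (\<gamma> T)) \<le> control_length T w"
  using length_ge_isoperimetric[OF assms, of 0]
  by (intro power2_le_imp_le[OF _ control_length_nonneg]) (simp add: A_op_simps)

lemma rh_dist_le: "horizontal_curve T \<gamma> w \<Longrightarrow> rh_dist (\<gamma> 0) (\<gamma> T) \<le> control_length T w"
  unfolding rh_dist_def
  by (rule cInf_lower) (auto intro!: bdd_belowI[of _ 0] control_length_nonneg)

lemma shortest_imp_minimizes: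
  assumes h: "horizontal_curve T \<gamma> w"
    and le: "\<And>T' \<gamma>' w'. horizontal_curve T' \<gamma>' w' \<Longrightarrow> \<gamma>' 0 = \<gamma> 0 \<Longrightarrow> \<gamma>' T' = \<gamma> T \<Longrightarrow> control_length T w \<le> control_length T' w'"
  shows "rh_dist (\<gamma> 0) (\<gamma> T) = control_length T w" and "minimizes_length T \<gamma>"
proof -
  show "rh_dist (\<gamma> 0) (\<gamma> T) = control_length T w"
    unfolding rh_dist_def
    by (rule cInf_eq_minimum) (use h le in auto)
  then show "minimizes_length T \<gamma>" using h by (auto simp: minimizes_length_def)
qed

section \<open>The extremals in closed form\<close>

lemma vderiv_scaleR_fun:
  "DERIV f s :> D \<Longrightarrow> ((\<lambda>s. f s *\<^sub>R v) has_vector_derivative D *\<^sub>R v) (at s)"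
  using bounded_linear.has_vector_derivative[OF bounded_linear_scaleR_left]
  by (simp add: has_real_derivative_iff_has_vector_derivative)
lemma eq_if_same_derivative:
  fixes f g :: "real \<Rightarrow> 'a::real_normed_vector"
  assumes "\<And>s. (f has_vector_derivative D s) (at s)" "\<And>s. (g has_vector_derivative D s) (at s)" "f 0 = g 0"
  shows "f s = g s"
proof -
  have "((\<lambda>s. f s - g s) has_vector_derivative 0) (at s within UNIV)" for s
    using has_vector_derivative_diff[OF assms(1,2)] by simp
  then obtain c where "\<And>s. f s - g s = c"
    using has_vector_derivative_zero_constant[of UNIV "\<lambda>s. f s - g s"] by auto
  from this[of 0] this[of s] assms(3) show ?thesis by simp
qed

text \<open>By \<open>A\<^sup>3 = - \<omega>\<^sup>2 A\<close> the exponential series splits into the series of sine, multiplying \<open>A w\<close>, and of cosine,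
  multiplying \<open>A\<^sup>2 w\<close>.\<close>
lemma extremal_control_closed:
  fixes \<tau> :: "real^'q::finite" and w :: "('q, 'p::finite) V1"
  assumes \<tau>: "\<tau> \<noteq> 0"
  defines "\<omega> \<equiv> norm \<tau>"
  shows "extremal_control (fst w, snd w, \<tau>) s =
    w - (sin (\<omega> * s) / \<omega>) *\<^sub>R A_op \<tau> w + ((1 - cos (\<omega> * s)) / \<omega>\<^sup>2) *\<^sub>R A_op \<tau> (A_op \<tau> w)"
proof -
  let ?A = "A_op \<tau> :: ('q, 'p) V1 \<Rightarrow> _"
  have \<omega>: "\<omega> > 0" using \<tau> by (simp add: \<omega>_def)
  have odd: "(?A ^^ (2 * k + 1)) w = (- (\<omega>\<^sup>2)) ^ k *\<^sub>R ?A w" for k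
    by (induction k) (auto simp: A_op_simps A_op_cube \<omega>_def)
  have even: "(?A ^^ (2 * k + 2)) w = (- (\<omega>\<^sup>2)) ^ k *\<^sub>R ?A (?A w)" for k
    using arg_cong[OF odd[of k], of ?A] by (simp add: A_op_simps)
  have q: "(y ^ k)\<^sup>2 = (y\<^sup>2) ^ k" for y :: real and k by (simp add: mult.commute flip: power_mult)
  define a :: "nat \<Rightarrow> real" where "a n = (if n = 0 then 1 else 0)" for n
  define b where "b n = - (1 / \<omega>) * (sin_coeff n * (\<omega> * s) ^ n)" for n
  define c where "c n = (1 / \<omega>\<^sup>2) * (a n - cos_coeff n * (\<omega> * s) ^ n)" for n
  have series: "((- s) ^ n / fact n) *\<^sub>R (?A ^^ n) w = a n *\<^sub>R w + b n *\<^sub>R ?A w + c n *\<^sub>R ?A (?A w)" for n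
  proof -
    have "n = 0 \<or> n = 2 * (n div 2) + 1 \<or> n = 2 * (n div 2 - 1) + 2" by presburger
    then consider "n = 0" | k where "n = 2 * k + 1" | k where "n = 2 * k + 2" by blast
    then show ?thesis
    proof cases
      case 1 then show ?thesis by (simp add: a_def b_def c_def)
    next
      case (2 k)
      have "(- s) ^ n / fact n * (- (\<omega>\<^sup>2)) ^ k = b n"
        using \<omega> by (simp add: 2 b_def sin_coeff_def power_mult_distrib power_mult power_minus[of "\<omega>\<^sup>2"] field_simps q)
      moreover have "a n = 0" "c n = 0" by (simp_all add: 2 a_def c_def cos_coeff_def)
      ultimately show ?thesis unfolding 2 odd by (simp add: 2)
    next
      case (3 k)
      have "(- s) ^ n / fact n * (- (\<omega>\<^sup>2)) ^ k = c n"
      proof -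
        have "(- s) ^ n = s ^ n" using 3 by (simp add: uminus_power_if)
        moreover have "(\<omega> * s) ^ n = \<omega>\<^sup>2 * ((\<omega>\<^sup>2) ^ k * s ^ n)"
          by (simp add: 3 power_mult_distrib power_add power_mult) (simp add: power2_eq_square)
        moreover have "(- (\<omega>\<^sup>2)) ^ k = (- 1) ^ k * (\<omega>\<^sup>2) ^ k" by (rule power_minus)
        moreover have "cos_coeff n = - ((- 1) ^ k / fact n)" "a n = 0"
          by (simp_all add: 3 cos_coeff_def a_def)
        ultimately show ?thesis using \<omega> by (simp add: c_def)
      qed
      moreover have "a n = 0" "b n = 0" by (simp_all add: 3 a_def b_def sin_coeff_def)
      ultimately show ?thesis unfolding 3 even by (simp add: 3)
    qed
  qed
  have as: "a sums 1" using sums_single[of 0 "\<lambda>_. 1::real"] by (simp add: a_def[abs_def])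
  have "(\<lambda>n. a n *\<^sub>R w + b n *\<^sub>R ?A w + c n *\<^sub>R ?A (?A w)) sums
      (1 *\<^sub>R w + (- (1 / \<omega>) * sin (\<omega> * s)) *\<^sub>R ?A w + ((1 / \<omega>\<^sup>2) * (1 - cos (\<omega> * s))) *\<^sub>R ?A (?A w))"
    unfolding b_def c_def
    using sin_converges[of "\<omega> * s"] cos_converges[of "\<omega> * s"]
    by (intro sums_add sums_scaleR_left sums_mult sums_diff as) auto
  then show ?thesis
    unfolding extremal_control_def by (simp add: series sums_iff)
qed

lemma extremal_control_straight:
  assumes "A_op \<tau> w = 0"
  shows "extremal_control (fst w, snd w, \<tau>) s = w"
proof -
  have "(A_op \<tau> ^^ n) w = (if n = 0 then w else 0)" for n
    by (induction n) (auto simp: assms A_op_simps)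
  then have "(\<lambda>n. ((- s) ^ n / fact n) *\<^sub>R (A_op \<tau> ^^ n) w) = (\<lambda>n. if n = 0 then w else 0)"
    by auto
  then have "(\<lambda>n. ((- s) ^ n / fact n) *\<^sub>R (A_op \<tau> ^^ n) w) sums w"
    using sums_single[of 0 "\<lambda>_. w"] by (simp cong: if_cong)
  then show ?thesis by (simp add: extremal_control_def sums_iff)
qed

text \<open>The extremal is the only curve through the origin with its velocity, so a closed form need only be
  differentiated.\<close>
lemma extremal_eqI:
  assumes z: "\<And>s. (z has_vector_derivative extremal_control \<zeta> s) (at s)"
    and t: "\<And>s. (t has_vector_derivative rhQ (z s) (extremal_control \<zeta> s)) (at s)"
    and 0: "z 0 = 0" "t 0 = 0"
  shows "extremal \<zeta> s = (fst (z s), snd (z s), t s)"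
proof -
  note d = has_vector_derivative_horizontal[OF extremal_has_vector_derivative]
  have z': "hor (extremal \<zeta> s) = z s" for s
    by (rule eq_if_same_derivative[OF d(1) z]) (simp add: 0 zero_prod_def)
  have "snd (snd (extremal \<zeta> s)) = t s" for s
    by (rule eq_if_same_derivative[OF d(2)]) (simp_all add: 0 z' t)
  with z'[of s] show ?thesis by (metis fst_conv prod.collapse snd_conv)
qed

lemma extremal_straight:
  assumes "A_op \<tau> w = 0"
  shows "extremal (fst w, snd w, \<tau>) s = (fst (s *\<^sub>R w), snd (s *\<^sub>R w), 0)"
proof (rule extremal_eqI)
  show "((\<lambda>s. s *\<^sub>R w) has_vector_derivative extremal_control (fst w, snd w, \<tau>) s) (at s)" for s
    unfolding extremal_control_straight[OF assms] has_vector_derivative_def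
    by (rule bounded_linear_imp_has_derivative, rule bounded_linear_scaleR_left)
  have "rhQ (s *\<^sub>R w) w = 0" for s :: real
    by (simp add: bounded_bilinear.scaleR_left[OF bounded_bilinear_rhQ])
  then show "((\<lambda>s. 0) has_vector_derivative rhQ (s *\<^sub>R w) (extremal_control (fst w, snd w, \<tau>) s)) (at s)" for s
    by (simp add: extremal_control_straight[OF assms])
qed auto

definition rot_hor :: "real \<Rightarrow> real^'q::finite \<Rightarrow> ('q, 'p::finite) V1 \<Rightarrow> real \<Rightarrow> ('q, 'p) V1"
  where "rot_hor \<omega> \<tau> w s = s *\<^sub>R w - ((1 - cos (\<omega> * s)) / \<omega>\<^sup>2) *\<^sub>R A_op \<tau> w
    + ((s - sin (\<omega> * s) / \<omega>) / \<omega>\<^sup>2) *\<^sub>R A_op \<tau> (A_op \<tau> w)"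

text \<open>The coefficients are the primitives of \<open>f g' - f' g\<close>, where \<open>f\<close> and \<open>g\<close> run through pairs of
  coefficients of \<open>rot_hor\<close>.\<close>
definition rot_vert :: "real \<Rightarrow> real^'q::finite \<Rightarrow> ('q, 'p::finite) V1 \<Rightarrow> real \<Rightarrow> real^'q"
  where "rot_vert \<omega> \<tau> w s =
    ((s * cos (\<omega> * s) + s) / \<omega>\<^sup>2 - 2 * sin (\<omega> * s) / \<omega> ^ 3) *\<^sub>R rhQ w (A_op \<tau> w)
    + ((2 / \<omega>\<^sup>2 - 2 * cos (\<omega> * s) / \<omega>\<^sup>2 - s * sin (\<omega> * s) / \<omega>) / \<omega>\<^sup>2) *\<^sub>R rhQ w (A_op \<tau> (A_op \<tau> w))
    + ((3 * sin (\<omega> * s) / \<omega> - s * cos (\<omega> * s) - 2 * s) / \<omega> ^ 4) *\<^sub>R rhQ (A_op \<tau> w) (A_op \<tau> (A_op \<tau> w))"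

lemma extremal_rotating:
  fixes \<tau> :: "real^'q::finite" and w :: "('q, 'p::finite) V1"
  assumes \<tau>: "\<tau> \<noteq> 0"
  shows "extremal (fst w, snd w, \<tau>) s =
    (fst (rot_hor (norm \<tau>) \<tau> w s), snd (rot_hor (norm \<tau>) \<tau> w s), rot_vert (norm \<tau>) \<tau> w s)"
proof -
  define \<omega> where "\<omega> = norm \<tau>"
  have \<omega>: "\<omega> > 0" using \<tau> by (simp add: \<omega>_def)
  let ?A = "A_op \<tau> w" and ?B = "A_op \<tau> (A_op \<tau> w)"
  note ctrl = extremal_control_closed[OF \<tau>, of w, folded \<omega>_def]
  have "extremal (fst w, snd w, \<tau>) s = (fst (rot_hor \<omega> \<tau> w s), snd (rot_hor \<omega> \<tau> w s), rot_vert \<omega> \<tau> w s)"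
  proof (rule extremal_eqI)
    fix s
    have "(rot_hor \<omega> \<tau> w has_vector_derivative 1 *\<^sub>R w - (sin (\<omega> * s) / \<omega>) *\<^sub>R ?A + ((1 - cos (\<omega> * s)) / \<omega>\<^sup>2) *\<^sub>R ?B) (at s)"
      unfolding rot_hor_def
      by (intro has_vector_derivative_add has_vector_derivative_diff vderiv_scaleR_fun)
         (use \<omega> in \<open>auto intro!: derivative_eq_intros simp: field_simps power2_eq_square\<close>)
    then show "(rot_hor \<omega> \<tau> w has_vector_derivative extremal_control (fst w, snd w, \<tau>) s) (at s)"
      by (simp add: ctrl)
    define k01 where "k01 = (1 - cos (\<omega> * s)) / \<omega>\<^sup>2 - s * sin (\<omega> * s) / \<omega>"
    define k02 where "k02 = (sin (\<omega> * s) / \<omega> - s * cos (\<omega> * s)) / \<omega>\<^sup>2"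
    define k12 where "k12 = (2 * cos (\<omega> * s) - 2 + \<omega> * s * sin (\<omega> * s)) / \<omega> ^ 4"
    have "(rot_vert \<omega> \<tau> w has_vector_derivative k01 *\<^sub>R rhQ w ?A + k02 *\<^sub>R rhQ w ?B + k12 *\<^sub>R rhQ ?A ?B) (at s)"
      unfolding rot_vert_def k01_def k02_def k12_def
      by (intro has_vector_derivative_add vderiv_scaleR_fun)
         (use \<omega> in \<open>auto intro!: derivative_eq_intros simp: field_simps power2_eq_square power3_eq_cube power4_eq_xxxx\<close>)
    moreover have "rhQ (rot_hor \<omega> \<tau> w s) (w - (sin (\<omega> * s) / \<omega>) *\<^sub>R ?A + ((1 - cos (\<omega> * s)) / \<omega>\<^sup>2) *\<^sub>R ?B)
        = k01 *\<^sub>R rhQ w ?A + k02 *\<^sub>R rhQ w ?B + k12 *\<^sub>R rhQ ?A ?B"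
    proof -
      interpret Q: bounded_bilinear "rhQ :: ('q, 'p) V1 \<Rightarrow> _" by (rule bounded_bilinear_rhQ)
      define f1 f2 g1 g2 where fg: "f1 = (1 - cos (\<omega> * s)) / \<omega>\<^sup>2" "f2 = (s - sin (\<omega> * s) / \<omega>) / \<omega>\<^sup>2"
        "g1 = sin (\<omega> * s) / \<omega>" "g2 = (1 - cos (\<omega> * s)) / \<omega>\<^sup>2"
      have "rhQ (s *\<^sub>R w - f1 *\<^sub>R ?A + f2 *\<^sub>R ?B) (w - g1 *\<^sub>R ?A + g2 *\<^sub>R ?B)
        = (f1 - s * g1) *\<^sub>R rhQ w ?A + (s * g2 - f2) *\<^sub>R rhQ w ?B + (f2 * g1 - f1 * g2) *\<^sub>R rhQ ?A ?B"
        by (simp add: Q.add_left Q.add_right Q.diff_left Q.diff_right Q.scaleR_left Q.scaleR_right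
            rhQ_swap[of ?A w] rhQ_swap[of ?B w] rhQ_swap[of ?B ?A] algebra_simps)
      moreover have "f1 - s * g1 = k01" by (simp add: fg k01_def)
      moreover have "s * g2 - f2 = k02" using \<omega> by (simp add: fg k02_def field_simps)
      moreover have "f2 * g1 - f1 * g2 = k12"
      proof -
        have "f2 * g1 - f1 * g2 = (\<omega> * s * sin (\<omega> * s) - (sin (\<omega> * s))\<^sup>2 - (1 - cos (\<omega> * s))\<^sup>2) / \<omega> ^ 4"
        proof -
          have "f2 * g1 = s * sin (\<omega> * s) / \<omega> ^ 3 - (sin (\<omega> * s))\<^sup>2 / \<omega> ^ 4"
            using \<omega> by (simp add: fg field_simps power2_eq_square power3_eq_cube power4_eq_xxxx)
          moreover have "f1 * g2 = (1 - cos (\<omega> * s))\<^sup>2 / \<omega> ^ 4"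
            by (simp add: fg power2_eq_square power4_eq_xxxx)
          moreover have "s * sin (\<omega> * s) / \<omega> ^ 3 = \<omega> * s * sin (\<omega> * s) / \<omega> ^ 4"
            using \<omega> by (simp add: power3_eq_cube power4_eq_xxxx)
          ultimately show ?thesis by (simp add: diff_divide_distrib)
        qed
        also have "(sin (\<omega> * s))\<^sup>2 = 1 - (cos (\<omega> * s))\<^sup>2" by (rule sin_squared_eq)
        finally show ?thesis by (simp add: k12_def power2_diff algebra_simps)
      qed
      ultimately show ?thesis by (simp add: rot_hor_def fg)
    qed
    ultimately show "(rot_vert \<omega> \<tau> w has_vector_derivative rhQ (rot_hor \<omega> \<tau> w s) (extremal_control (fst w, snd w, \<tau>) s)) (at s)"
      by (simp add: ctrl)
  qed (auto simp: rot_hor_def rot_vert_def)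
  then show ?thesis by (simp add: \<omega>_def)
qed

lemma norm_extremal_control:
  fixes w :: "('q::finite, 'p::finite) V1"
  shows "norm (extremal_control (fst w, snd w, \<tau>) s) = norm w"
proof (cases "\<tau> = 0")
  case True
  then show ?thesis using extremal_control_straight[of \<tau> w s] by (simp add: A_op_eq outer_simps vec_mat_simps zero_prod_def)
next
  case False
  define \<omega> where "\<omega> = norm \<tau>"
  have \<omega>: "\<omega> > 0" using False by (simp add: \<omega>_def)
  let ?A = "A_op \<tau> w" and ?B = "A_op \<tau> (A_op \<tau> w)"
  define p where "p = inner ?A ?A"
  have 1: "inner w ?A = 0" "inner ?A w = 0" using A_op_skew[of \<tau> w w] by (simp_all add: inner_commute)
  have 2: "inner ?A ?B = 0" "inner ?B ?A = 0" using A_op_skew[of \<tau> ?A ?A] by (simp_all add: inner_commute)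
  have 3: "inner w ?B = - p" "inner ?B w = - p" using A_op_skew[of \<tau> w ?A] by (simp_all add: p_def inner_commute)
  have 4: "inner ?B ?B = \<omega>\<^sup>2 * p"
    using A_op_skew[of \<tau> ?A ?B] by (simp add: A_op_cube p_def \<omega>_def)
  define a b where "a = sin (\<omega> * s) / \<omega>" and "b = (1 - cos (\<omega> * s)) / \<omega>\<^sup>2"
  have "inner (w - a *\<^sub>R ?A + b *\<^sub>R ?B) (w - a *\<^sub>R ?A + b *\<^sub>R ?B) = inner w w + p * (a\<^sup>2 + b\<^sup>2 * \<omega>\<^sup>2 - 2 * b)"
    by (simp add: inner_add inner_diff 1 2 3 4 flip: p_def) (simp add: algebra_simps power2_eq_square)
  also have "a\<^sup>2 = (1 - (cos (\<omega> * s))\<^sup>2) / \<omega>\<^sup>2"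
    by (simp add: a_def power_divide sin_squared_eq)
  also have "b\<^sup>2 * \<omega>\<^sup>2 = (1 - cos (\<omega> * s))\<^sup>2 / \<omega>\<^sup>2"
    using \<omega> by (simp add: b_def power_divide power2_eq_square)
  also have "(1 - (cos (\<omega> * s))\<^sup>2) / \<omega>\<^sup>2 + (1 - cos (\<omega> * s))\<^sup>2 / \<omega>\<^sup>2 - 2 * b = 0"
    by (simp add: b_def power2_diff flip: add_divide_distrib diff_divide_distrib)
  finally show ?thesis
    unfolding extremal_control_closed[OF False] by (simp add: norm_eq_sqrt_inner a_def b_def \<omega>_def)
qed

text \<open>The vector \<open>a = \<xi>\<^sup>T \<theta>\<close> is the part of \<open>\<xi>\<close> that rotates together with \<open>\<eta>\<close>.  The coefficient of \<open>\<theta>\<close> is the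
  area of a circle of length \<open>T |(a, \<eta>)|\<close>, and the other summand of the vertical coordinate
  lies in \<open>Im x\<close>.\<close>
lemma extremal_at_period:
  fixes \<xi> :: "real^'p::finite^'q::finite"
  assumes \<theta>: "norm \<theta> = 1" and T: "T > 0"
  defines "a \<equiv> \<theta> v* \<xi>"
  defines "x \<equiv> T *\<^sub>R (\<xi> - outer \<theta> a)"
  shows "extremal (\<xi>, \<eta>, (2 * pi / T) *\<^sub>R \<theta>) T =
    (x, 0, x *v (- (T / (2 * pi)) *\<^sub>R a) + (T\<^sup>2 / (4 * pi) * ((norm a)\<^sup>2 + (norm \<eta>)\<^sup>2)) *\<^sub>R \<theta>)"
    and "\<theta> v* x = 0"
proof -
  define \<omega> where "\<omega> = 2 * pi / T"
  define \<tau> where "\<tau> = \<omega> *\<^sub>R \<theta>"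
  have \<omega>: "\<omega> > 0" using T by (simp add: \<omega>_def)
  have \<omega>T: "\<omega> * T = 2 * pi" using T by (simp add: \<omega>_def)
  have n\<tau>: "norm \<tau> = \<omega>" using \<omega> \<theta> by (simp add: \<tau>_def)
  have \<tau>0: "\<tau> \<noteq> 0" using n\<tau> \<omega> by auto
  have \<theta>\<theta>: "inner \<theta> \<theta> = 1" using \<theta> by (simp add: norm_eq_1)
  let ?w = "(\<xi>, \<eta>)"
  have A: "A_op \<tau> ?w = (\<omega> *\<^sub>R outer \<theta> \<eta>, - (\<omega> *\<^sub>R a))"
    by (simp add: A_op_eq \<tau>_def outer_simps vec_mat_simps a_def)
  have B: "A_op \<tau> (A_op \<tau> ?w) = (- (\<omega>\<^sup>2 *\<^sub>R outer \<theta> a), - (\<omega>\<^sup>2 *\<^sub>R \<eta>))"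
    unfolding A_op_A_op n\<tau> by (simp add: \<tau>_def outer_simps vec_mat_simps a_def power2_eq_square)
  have z: "rot_hor \<omega> \<tau> ?w T = (x, 0)"
    unfolding rot_hor_def B \<omega>T using \<omega> by (simp add: x_def algebra_simps)
  have "rot_vert \<omega> \<tau> ?w T = (2 * T / \<omega>\<^sup>2) *\<^sub>R rhQ ?w (A_op \<tau> ?w) - (3 * T / \<omega> ^ 4) *\<^sub>R rhQ (A_op \<tau> ?w) (A_op \<tau> (A_op \<tau> ?w))"
    unfolding rot_vert_def \<omega>T by simp
  also have "rhQ ?w (A_op \<tau> ?w) = - ((\<omega> / 2) *\<^sub>R (\<xi> *v a + (norm \<eta>)\<^sup>2 *\<^sub>R \<theta>))"
    unfolding A rhQ_eq by (simp add: mat_vec_simps outer_mult_vec power2_norm_eq_inner algebra_simps)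
  also have "rhQ (A_op \<tau> ?w) (A_op \<tau> (A_op \<tau> ?w)) = - ((\<omega> ^ 3 / 2 * ((norm \<eta>)\<^sup>2 + (norm a)\<^sup>2)) *\<^sub>R \<theta>)"
    unfolding B unfolding A rhQ_eq
    by (simp add: mat_vec_simps outer_mult_vec dot_square_norm power2_eq_square power3_eq_cube algebra_simps)
  finally have "rot_vert \<omega> \<tau> ?w T = - ((2 * T / \<omega>\<^sup>2 * (\<omega> / 2)) *\<^sub>R (\<xi> *v a))
      + (3 * T / \<omega> ^ 4 * (\<omega> ^ 3 / 2 * ((norm \<eta>)\<^sup>2 + (norm a)\<^sup>2)) - 2 * T / \<omega>\<^sup>2 * (\<omega> / 2) * (norm \<eta>)\<^sup>2) *\<^sub>R \<theta>"
    by (simp add: scaleR_diff_left scaleR_diff_right scaleR_add_right)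
  moreover have "2 * T / \<omega>\<^sup>2 * (\<omega> / 2) = T / \<omega>"
    using \<omega> by (simp add: power2_eq_square)
  moreover have "3 * T / \<omega> ^ 4 * (\<omega> ^ 3 / 2 * ((norm \<eta>)\<^sup>2 + (norm a)\<^sup>2)) - T / \<omega> * (norm \<eta>)\<^sup>2
      = T / \<omega> * ((norm \<eta>)\<^sup>2 / 2 + 3 / 2 * (norm a)\<^sup>2)"
  proof -
    have "\<omega> ^ 4 = \<omega> ^ 3 * \<omega>" by (simp add: power3_eq_cube power4_eq_xxxx)
    then show ?thesis using \<omega> by (simp add: field_simps)
  qed
  ultimately have t: "rot_vert \<omega> \<tau> ?w T = - ((T / \<omega>) *\<^sub>R (\<xi> *v a)) + (T / \<omega> * ((norm \<eta>)\<^sup>2 / 2 + 3 / 2 * (norm a)\<^sup>2)) *\<^sub>R \<theta>"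
    by (simp only:)
  have "extremal (\<xi>, \<eta>, \<tau>) T = (x, 0, rot_vert \<omega> \<tau> ?w T)"
    using extremal_rotating[OF \<tau>0, of ?w T] by (simp add: z n\<tau>)
  also have "rot_vert \<omega> \<tau> ?w T = x *v (- (T / (2 * pi)) *\<^sub>R a) + (T\<^sup>2 / (4 * pi) * ((norm a)\<^sup>2 + (norm \<eta>)\<^sup>2)) *\<^sub>R \<theta>"
  proof -
    have "x *v (- (T / (2 * pi)) *\<^sub>R a) = - ((T\<^sup>2 / (2 * pi)) *\<^sub>R (\<xi> *v a)) + (T\<^sup>2 / (2 * pi) * (norm a)\<^sup>2) *\<^sub>R \<theta>"
      by (simp add: x_def mat_vec_simps outer_mult_vec dot_square_norm power2_eq_square algebra_simps)
    moreover have "T / \<omega> = T\<^sup>2 / (2 * pi)" using T by (simp add: \<omega>_def power2_eq_square)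
    moreover have "T\<^sup>2 / (2 * pi) * ((norm \<eta>)\<^sup>2 / 2 + 3 / 2 * (norm a)\<^sup>2)
        = T\<^sup>2 / (2 * pi) * (norm a)\<^sup>2 + T\<^sup>2 / (4 * pi) * ((norm a)\<^sup>2 + (norm \<eta>)\<^sup>2)"
      by (simp add: field_simps)
    ultimately show ?thesis unfolding t by (simp add: scaleR_add_left)
  qed
  finally show "extremal (\<xi>, \<eta>, (2 * pi / T) *\<^sub>R \<theta>) T =
    (x, 0, x *v (- (T / (2 * pi)) *\<^sub>R a) + (T\<^sup>2 / (4 * pi) * ((norm a)\<^sup>2 + (norm \<eta>)\<^sup>2)) *\<^sub>R \<theta>)"
    by (simp add: \<tau>_def \<omega>_def)
  show "\<theta> v* x = 0" by (simp add: x_def vec_mat_simps vec_mult_outer \<theta>\<theta> a_def)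
qed

section \<open>Loss of minimality after one period\<close>

lemma extremal_control_derivative:
  fixes w :: "('q::finite, 'p::finite) V1"
  assumes \<tau>: "\<tau> \<noteq> 0"
  shows "(extremal_control (fst w, snd w, \<tau>) has_vector_derivative
    - A_op \<tau> (extremal_control (fst w, snd w, \<tau>) s)) (at s)"
proof -
  define \<omega> where "\<omega> = norm \<tau>"
  have \<omega>: "\<omega> > 0" using \<tau> by (simp add: \<omega>_def)
  let ?A = "A_op \<tau> w" and ?B = "A_op \<tau> (A_op \<tau> w)"
  have eq: "extremal_control (fst w, snd w, \<tau>) = (\<lambda>s. w - (sin (\<omega> * s) / \<omega>) *\<^sub>R ?A + ((1 - cos (\<omega> * s)) / \<omega>\<^sup>2) *\<^sub>R ?B)"
    using extremal_control_closed[OF \<tau>, of w] by (auto simp: \<omega>_def)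
  have "(extremal_control (fst w, snd w, \<tau>) has_vector_derivative
     0 - cos (\<omega> * s) *\<^sub>R ?A + (sin (\<omega> * s) / \<omega>) *\<^sub>R ?B) (at s)"
    unfolding eq
    by (intro has_vector_derivative_add has_vector_derivative_diff vderiv_scaleR_fun has_vector_derivative_const)
       (use \<omega> in \<open>auto intro!: derivative_eq_intros simp: power2_eq_square\<close>)
  moreover have "- A_op \<tau> (extremal_control (fst w, snd w, \<tau>) s) = 0 - cos (\<omega> * s) *\<^sub>R ?A + (sin (\<omega> * s) / \<omega>) *\<^sub>R ?B"
    using \<omega> unfolding eq by (simp add: A_op_simps A_op_cube flip: \<omega>_def) (simp add: algebra_simps)
  ultimately show ?thesis by simp
qed

lemma control_length_extremal:
  assumes "S > 0"
  shows "control_length S (extremal_control (fst w, snd w, \<tau>)) = S * norm w"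
proof -
  have "((\<lambda>s. norm (extremal_control (fst w, snd w, \<tau>) s)) has_integral S * norm w) {0..S}"
    unfolding norm_extremal_control using has_integral_const_real[of "norm w" 0 S] assms by simp
  with horizontal_curve_lengthD[OF horizontal_curve_extremal[OF assms]] show ?thesis
    by (rule has_integral_unique)
qed

lemma integral_derivative_loop:
  fixes f :: "real \<Rightarrow> 'a::banach"
  assumes "S \<ge> 0" "\<And>r. (f has_vector_derivative D r) (at r)"
  shows "(D has_integral (f S - f 0)) {0..S}"
  by (rule fundamental_theorem_of_calculus[OF assms(1) has_vector_derivative_at_within[OF assms(2)]])

text \<open>Perturb the horizontal part by \<open>k h\<close>.  The vertical endpoint moves by \<open>(2 k l + k\<^sup>2 q) \<theta>\<close>, so it stays for
  \<open>k = - 2 l / q\<close>.  Because the control satisfies \<open>w' = - A\<^sub>\<tau> w\<close>, the linear term of the energy \<open>1/2 \<integral> |w|\<^sup>2\<close> is the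
  linear term of \<open>\<langle>\<tau>, t\<rangle>\<close>, which this choice of \<open>k\<close> expresses by \<open>q\<close>; in total \<open>\<integral> |w|\<^sup>2\<close> changes by
  \<open>- k\<^sup>2 (2 \<omega> q - e) < 0\<close>.  The original curve has constant speed, so lower energy on the same interval means
  lower length.\<close>
lemma perturbation_shortens:
  fixes w0 :: "('q::finite, 'p::finite) V1"
  assumes \<theta>: "norm \<theta> = 1" and \<omega>: "\<omega> > 0" and S: "S > 0" and w0: "w0 \<noteq> 0"
  defines "\<tau> \<equiv> \<omega> *\<^sub>R \<theta>"
  defines "w \<equiv> extremal_control (fst w0, snd w0, \<tau>)"
  assumes h: "\<And>r. (h has_vector_derivative h' r) (at r)" and h': "continuous_on UNIV h'"
    and h0: "h 0 = 0" and hS: "h S = 0"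
    and L: "((\<lambda>r. rhQ (h r) (w r)) has_integral l *\<^sub>R \<theta>) {0..S}" and l: "l \<noteq> 0"
    and Q: "((\<lambda>r. rhQ (h r) (h' r)) has_integral q *\<^sub>R \<theta>) {0..S}"
    and E: "((\<lambda>r. (norm (h' r))\<^sup>2) has_integral e) {0..S}" and eq: "e < 2 * \<omega> * q"
  shows "\<not> minimizes_length S (extremal (fst w0, snd w0, \<tau>))"
proof
  let ?\<gamma> = "extremal (fst w0, snd w0, \<tau>)"
  assume "minimizes_length S ?\<gamma>"
  then obtain w' where w': "horizontal_curve S ?\<gamma> w'" "control_length S w' = rh_dist (?\<gamma> 0) (?\<gamma> S)"
    by (auto simp: minimizes_length_def)
  have hw: "horizontal_curve S ?\<gamma> w" unfolding w_def by (rule horizontal_curve_extremal[OF S])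
  have dist: "rh_dist (?\<gamma> 0) (?\<gamma> S) = S * norm w0"
    using control_length_unique[OF hw w'(1)] w'(2) control_length_extremal[OF S, of w0 \<tau>] unfolding w_def by simp
  have \<tau>: "\<tau> \<noteq> 0" using \<omega> \<theta> by (auto simp: \<tau>_def)
  have \<theta>\<theta>: "inner \<theta> \<theta> = 1" using \<theta> by (simp add: norm_eq_1)
  define c where "c = norm w0"
  have c: "c > 0" using w0 by (simp add: c_def)
  have nw: "norm (w r) = c" for r unfolding w_def c_def by (rule norm_extremal_control)
  have dw: "(w has_vector_derivative - A_op \<tau> (w r)) (at r)" for r
    unfolding w_def by (rule extremal_control_derivative[OF \<tau>])
  have cw: "continuous_on UNIV w" unfolding w_def by (rule continuous_on_extremal_control)
  define z where "z r = hor (?\<gamma> r)" for r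
  define t where "t r = snd (snd (?\<gamma> r))" for r
  have dz: "(z has_vector_derivative w r) (at r)" for r
    unfolding z_def[abs_def] w_def by (rule has_vector_derivative_horizontal(1)[OF extremal_has_vector_derivative])
  have dt: "(t has_vector_derivative rhQ (z r) (w r)) (at r)" for r
    unfolding z_def t_def[abs_def] w_def by (rule has_vector_derivative_horizontal(2)[OF extremal_has_vector_derivative])
  have z0: "z 0 = 0" "t 0 = 0" by (simp_all add: z_def t_def zero_prod_def)
  have "e \<ge> 0" by (rule has_integral_nonneg[OF E]) auto
  then have q: "q > 0" using eq \<omega> by (smt (verit) mult_nonneg_nonpos)
  define k where "k = - 2 * l / q"
  have k: "2 * l = - k * q" "k \<noteq> 0" using q l by (auto simp: k_def)
  define zc where "zc r = z r + k *\<^sub>R h r" for r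
  define wc where "wc r = w r + k *\<^sub>R h' r" for r
  have cwc: "continuous_on UNIV wc" unfolding wc_def by (intro continuous_intros cw h')
  have dzc: "(zc has_vector_derivative wc r) (at r)" for r
    unfolding zc_def wc_def
    by (intro has_vector_derivative_add dz bounded_linear.has_vector_derivative[OF bounded_linear_scaleR_right h])
  have czc: "continuous_on UNIV zc"
    using dzc by (meson continuous_at_imp_continuous_on has_vector_derivative_continuous)
  define tc where "tc r = (LBINT s=0..r. rhQ (zc s) (wc s))" for r :: real
  have dtc: "(tc has_vector_derivative rhQ (zc r) (wc r)) (at r)" for r
    unfolding tc_def by (intro has_vector_derivative_LBINT continuous_on_rhQ czc cwc)
  have tc0: "tc 0 = 0" unfolding tc_def by (simp flip: zero_ereal_def)
  define \<gamma>c where "\<gamma>c r = (fst (zc r), snd (zc r), tc r)" for r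
  have hc: "horizontal_curve S \<gamma>c wc"
    by (rule horizontal_curveI[OF S cwc]) (unfold \<gamma>c_def, rule has_vector_derivative_horizontalI[OF dzc dtc])
  have "tc S = t S"
  proof -
    interpret Q: bounded_bilinear "rhQ :: ('q, 'p) V1 \<Rightarrow> _" by (rule bounded_bilinear_rhQ)
    have two: "2 * y = (2::real) *\<^sub>R y" for y :: "real^'q" by (simp add: vec_eq_iff)
    have 1: "((\<lambda>r. rhQ (z r) (w r)) has_integral t S) {0..S}"
      using integral_derivative_loop[OF less_imp_le[OF S] dt] by (simp add: z0)
    have 2: "((\<lambda>r. rhQ (z r) (h' r) + rhQ (w r) (h r)) has_integral 0) {0..S}"
      using integral_derivative_loop[OF less_imp_le[OF S] Q.has_vector_derivative[OF dz h]]
      by (simp add: hS h0 Q.zero_right)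
    let ?Q = "\<lambda>r. rhQ (z r) (w r) + k *\<^sub>R (rhQ (z r) (h' r) + rhQ (w r) (h r))
          + (2 * k) *\<^sub>R rhQ (h r) (w r) + (k * k) *\<^sub>R rhQ (h r) (h' r)"
    have "(?Q has_integral
        (t S + k *\<^sub>R 0 + (2 * k) *\<^sub>R l *\<^sub>R \<theta> + (k * k) *\<^sub>R q *\<^sub>R \<theta>)) {0..S}"
      by (intro has_integral_add has_integral_cmul 1 2 L Q)
    moreover have "?Q r = rhQ (zc r) (wc r)" for r
      unfolding zc_def wc_def
      by (simp add: Q.add_left Q.add_right Q.scaleR_left Q.scaleR_right rhQ_swap[of "w r" "h r"] two algebra_simps)
    moreover have "t S + k *\<^sub>R 0 + (2 * k) *\<^sub>R l *\<^sub>R \<theta> + (k * k) *\<^sub>R q *\<^sub>R \<theta> = t S"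
    proof -
      have "2 * k * l + k * k * q = k * (2 * l + k * q)" by (simp add: algebra_simps)
      also have "\<dots> = 0" using k by simp
      finally have "(2 * k * l + k * k * q) *\<^sub>R \<theta> = 0" by simp
      then show ?thesis by (simp add: scaleR_add_left add.assoc)
    qed
    ultimately have "((\<lambda>r. rhQ (zc r) (wc r)) has_integral t S) {0..S}" by (simp only:)
    with integral_derivative_loop[OF less_imp_le[OF S] dtc] tc0 show ?thesis
      by (simp add: has_integral_unique)
  qed
  then have ends: "\<gamma>c 0 = ?\<gamma> 0" "\<gamma>c S = ?\<gamma> S"
    using z0 h0 hS tc0 by (auto simp: \<gamma>c_def zc_def z_def t_def zero_prod_def)
  let ?E = "S * c\<^sup>2 - k\<^sup>2 * (2 * \<omega> * q - e)"
  have "((\<lambda>r. (norm (wc r))\<^sup>2) has_integral (?E)) {0..S}"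
  proof -
    have "((\<lambda>r. inner (w r) (h' r) + inner (- A_op \<tau> (w r)) (h r)) has_integral 0) {0..S}"
      using integral_derivative_loop[OF less_imp_le[OF S]
          bounded_bilinear.has_vector_derivative[OF bounded_bilinear_inner dw h]]
      by (simp add: hS h0)
    moreover have "inner (- A_op \<tau> (w r)) (h r) = - 2 * inner \<tau> (rhQ (h r) (w r))" for r
      using A_op_skew[of \<tau> "w r" "h r"] by (simp add: inner_rhQ inner_commute)
    ultimately have "((\<lambda>r. inner (w r) (h' r) + - 2 * inner \<tau> (rhQ (h r) (w r))) has_integral 0) {0..S}" by simp
    moreover have "((\<lambda>r. 2 * inner \<tau> (rhQ (h r) (w r))) has_integral 2 * inner \<tau> (l *\<^sub>R \<theta>)) {0..S}"
      using has_integral_mult_right[OF has_integral_linear[OF L bounded_linear_inner_right[of \<tau>]], of 2]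
      by (simp add: o_def)
    ultimately have "((\<lambda>r. (inner (w r) (h' r) + - 2 * inner \<tau> (rhQ (h r) (w r)))
        + 2 * inner \<tau> (rhQ (h r) (w r))) has_integral (0 + 2 * inner \<tau> (l *\<^sub>R \<theta>))) {0..S}"
      by (rule has_integral_add)
    moreover have "0 + 2 * inner \<tau> (l *\<^sub>R \<theta>) = 2 * \<omega> * l" by (simp add: \<tau>_def \<theta>\<theta>)
    ultimately have "((\<lambda>r. (inner (w r) (h' r) + - 2 * inner \<tau> (rhQ (h r) (w r)))
        + 2 * inner \<tau> (rhQ (h r) (w r))) has_integral (2 * \<omega> * l)) {0..S}" by (simp only:)
    then have wh: "((\<lambda>r. inner (w r) (h' r)) has_integral 2 * \<omega> * l) {0..S}" by simp
    have "((\<lambda>r. c\<^sup>2 + (2 * k) * inner (w r) (h' r) + k\<^sup>2 * (norm (h' r))\<^sup>2) has_integral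
        (S * c\<^sup>2 + (2 * k) * (2 * \<omega> * l) + k\<^sup>2 * e)) {0..S}"
      using has_integral_const_real[of "c\<^sup>2" 0 S] S
      by (intro has_integral_add has_integral_mult_right wh E) auto
    moreover have "c\<^sup>2 + (2 * k) * inner (w r) (h' r) + k\<^sup>2 * (norm (h' r))\<^sup>2 = (norm (wc r))\<^sup>2" for r
    proof -
      have "inner (w r) (w r) = c\<^sup>2" by (simp add: dot_square_norm nw)
      then show ?thesis
        unfolding wc_def power2_norm_eq_inner
        by (simp add: inner_add inner_commute[of "h' r" "w r"] power2_eq_square[of k] algebra_simps)
    qed
    moreover have "S * c\<^sup>2 + (2 * k) * (2 * \<omega> * l) + k\<^sup>2 * e = ?E"
    proof -
      have "(2 * k) * (2 * \<omega> * l) = (2 * l) * (2 * k * \<omega>)" by simp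
      also have "\<dots> = - (k\<^sup>2 * (2 * \<omega> * q))" unfolding k(1) by (simp add: power2_eq_square)
      finally have f: "(2 * k) * (2 * \<omega> * l) = - (k\<^sup>2 * (2 * \<omega> * q))" .
      show ?thesis unfolding f by (simp add: right_diff_distrib)
    qed
    ultimately show ?thesis by (simp only:)
  qed
  from has_integral_mult_left[OF this, of "1 / (2 * c)"]
  have en: "((\<lambda>r. (norm (wc r))\<^sup>2 * (1 / (2 * c)) + c / 2) has_integral
      ((?E) * (1 / (2 * c)) + S * (c / 2))) {0..S}"
    using has_integral_const_real[of "c / 2" 0 S] S by (intro has_integral_add) auto
  have "control_length S wc \<le> (?E) * (1 / (2 * c)) + S * (c / 2)"
  proof (rule has_integral_le[OF horizontal_curve_lengthD[OF hc] en])
    show "norm (wc r) \<le> (norm (wc r))\<^sup>2 * (1 / (2 * c)) + c / 2" for r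
      \<comment> \<open>The tangent to the square root at \<open>c\<^sup>2\<close>, the square of the constant speed, turns the energy estimate into one for length.\<close>
      using sum_squares_bound[of "norm (wc r)" c] c by (simp add: field_simps power2_eq_square)
  qed
  also have "\<dots> < S * c"
  proof -
    have "0 < k\<^sup>2 * (2 * \<omega> * q - e)" using k eq by simp
    then show ?thesis using c by (simp add: field_simps power2_eq_square)
  qed
  finally have "control_length S wc < S * c" .
  moreover have "rh_dist (?\<gamma> 0) (?\<gamma> S) \<le> control_length S wc"
    using rh_dist_le[OF hc] by (simp add: ends)
  ultimately show False using dist by (simp add: c_def)
qed

text \<open>The perturbation is a circle of period \<open>S\<close>: its speed is \<open>1\<close> and its energy minus area functional is
  \<open>S (1 - \<omega> / \<mu>)\<close> with \<open>\<mu> = 2 \<pi> / S < \<omega>\<close>.  Its phase is chosen such that the second component \<open>\<beta>\<close> has mean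
  zero; otherwise the vertical endpoint would move in the direction of \<open>U\<close>, the constant part of the control.
  The vertical displacement must also be nonzero to first order.  A small multiple \<open>\<delta>\<close> of the field
  \<open>B = r (S - r) v\<close> ensures it, because its own first-order displacement is \<open>\<integral> r (S - r) |v|\<^sup>2 > 0\<close>.\<close>
lemma not_minimizing_after_period:
  fixes w0 :: "('q::finite, 'p::finite) V1"
  assumes \<theta>: "norm \<theta> = 1" and \<omega>: "\<omega> > 0" and S: "S > 2 * pi / \<omega>"
  defines "\<tau> \<equiv> \<omega> *\<^sub>R \<theta>"
  assumes A: "A_op \<tau> w0 \<noteq> 0"
  shows "\<not> minimizes_length S (extremal (fst w0, snd w0, \<tau>))"
proof -
  have S0: "S > 0" using S \<omega> by (smt (verit) divide_pos_pos pi_gt_zero)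
  have w0: "w0 \<noteq> 0" using A by (auto simp: A_op_simps)
  have \<tau>: "\<tau> \<noteq> 0" using \<omega> \<theta> by (auto simp: \<tau>_def)
  have n\<tau>: "norm \<tau> = \<omega>" using \<omega> \<theta> by (simp add: \<tau>_def)
  have \<theta>\<theta>: "inner \<theta> \<theta> = 1" using \<theta> by (simp add: norm_eq_1)
  define \<mu> where "\<mu> = 2 * pi / S"
  have \<mu>: "\<mu> > 0" "\<mu> < \<omega>" "\<mu> * S = 2 * pi" using S S0 \<omega> by (auto simp: \<mu>_def field_simps)
  define w where "w = extremal_control (fst w0, snd w0, \<tau>)"
  define v where "v r = snd (w r)" for r
  define u where "u r = fst (w r)" for r
  define a where "a r = \<theta> v* u r" for r
  have dw: "(w has_vector_derivative - A_op \<tau> (w r)) (at r)" for r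
    unfolding w_def by (rule extremal_control_derivative[OF \<tau>])
  have dv: "(v has_vector_derivative \<omega> *\<^sub>R a r) (at r)" for r
    using bounded_linear.has_vector_derivative[OF bounded_linear_snd dw, of r]
    by (simp add: v_def[abs_def] A_op_eq a_def u_def \<tau>_def vec_mat_simps)
  have du: "(u has_vector_derivative - (\<omega> *\<^sub>R outer \<theta> (v r))) (at r)" for r
    using bounded_linear.has_vector_derivative[OF bounded_linear_fst dw, of r]
    by (simp add: u_def[abs_def] A_op_eq v_def \<tau>_def outer_simps)
  have da: "(a has_vector_derivative - (\<omega> *\<^sub>R v r)) (at r)" for r
    using bounded_linear.has_vector_derivative[OF bounded_bilinear.bounded_linear_right[OF bounded_bilinear_vec_mat] du, of \<theta> r]
    by (simp add: a_def[abs_def] vec_mat_simps vec_mult_outer \<theta>\<theta>)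
  have cont: "continuous_on X v" "continuous_on X a" for X
    using dv da by (meson continuous_at_imp_continuous_on has_vector_derivative_continuous)+
  define U where "U = u 0 - outer \<theta> (a 0)"
  have uU: "u r = U + outer \<theta> (a r)" for r
  proof -
    have "((\<lambda>r. outer \<theta> (a r)) has_vector_derivative outer \<theta> (- (\<omega> *\<^sub>R v r))) (at r)" for r
      by (rule bounded_linear.has_vector_derivative[OF bounded_bilinear.bounded_linear_right[OF bounded_bilinear_outer] da])
    from has_vector_derivative_diff[OF du this]
    have "((\<lambda>r. u r - outer \<theta> (a r)) has_vector_derivative 0) (at r)" for r
      by (simp add: outer_simps)
    then have "u r - outer \<theta> (a r) = U"
      by (rule eq_if_same_derivative) (auto simp: U_def)
    then show ?thesis by (simp add: algebra_simps)
  qed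
  have norm_outer: "(norm (outer \<theta> b))\<^sup>2 = (norm b)\<^sup>2" for b :: "real^'p"
    by (simp add: power2_norm_eq_inner inner_outer vec_mult_outer \<theta>\<theta>)
  \<comment> \<open>The circle \<open>(A0, \<beta>)\<close> in the plane of a unit vector \<open>f\<close>, and the correction \<open>B\<close>; primes are derivatives.\<close>
  obtain f :: "real^'p" where f: "norm f = 1" using vector_choose_size[of 1] by auto
  have ff: "inner f f = 1" using f by (simp add: norm_eq_1)
  define A0 where "A0 r = ((cos (\<mu> * r) - 1) / \<mu>) *\<^sub>R f" for r
  define A0' where "A0' r = - sin (\<mu> * r) *\<^sub>R f" for r
  define \<beta> where "\<beta> r = (sin (\<mu> * r) / \<mu>) *\<^sub>R f" for r
  define \<beta>' where "\<beta>' r = cos (\<mu> * r) *\<^sub>R f" for r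
  define B where "B r = (r * (S - r)) *\<^sub>R v r" for r
  define B' where "B' r = (r * (S - r)) *\<^sub>R (\<omega> *\<^sub>R a r) + (S - 2 * r) *\<^sub>R v r" for r
  have dA0: "(A0 has_vector_derivative A0' r) (at r)" for r
    unfolding A0_def A0'_def by (rule vderiv_scaleR_fun) (use \<mu> in \<open>auto intro!: derivative_eq_intros\<close>)
  have d\<beta>: "(\<beta> has_vector_derivative \<beta>' r) (at r)" for r
    unfolding \<beta>_def \<beta>'_def by (rule vderiv_scaleR_fun) (use \<mu> in \<open>auto intro!: derivative_eq_intros\<close>)
  have dB: "(B has_vector_derivative B' r) (at r)" for r
  proof -
    have "((\<lambda>r. r * (S - r)) has_vector_derivative S - 2 * r) (at r)"
      by (auto simp flip: has_real_derivative_iff_has_vector_derivative intro!: derivative_eq_intros)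
    from bounded_bilinear.has_vector_derivative[OF bounded_bilinear_scaleR this dv]
    show ?thesis by (simp add: B_def[abs_def] B'_def)
  qed
  have contA: "continuous_on X A0" "continuous_on X A0'" "continuous_on X \<beta>" "continuous_on X \<beta>'"
     "continuous_on X B" "continuous_on X B'" for X
    unfolding A0_def A0'_def \<beta>_def \<beta>'_def B_def B'_def by (intro continuous_intros cont; use \<mu> in simp)+
  define g1 where "g1 r = 2 * inner (A0' r) (B' r) - \<omega> * (inner (B r) (\<beta>' r) - inner (B' r) (\<beta> r))" for r
  have cg1: "continuous_on X g1" for X unfolding g1_def by (intro continuous_intros contA)
  define n1 where "n1 = integral {0..S} g1"
  define n2 where "n2 = integral {0..S} (\<lambda>r. inner (B' r) (B' r))"
  define lf where "lf r = inner (A0 r) (v r) - inner (a r) (\<beta> r)" for r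
  have clf: "continuous_on X lf" for X unfolding lf_def by (intro continuous_intros contA cont)
  define l0 where "l0 = integral {0..S} lf"
  define l1 where "l1 = integral {0..S} (\<lambda>r. inner (B r) (v r))"
  define n0 where "n0 = S - \<omega> * (S / \<mu>)"
  have n0: "n0 < 0"
  proof -
    have "S * 1 < S * (\<omega> / \<mu>)" using S0 \<mu> by (intro mult_strict_left_mono) auto
    then show ?thesis by (simp add: n0_def field_simps)
  qed
  have l1: "l1 \<noteq> 0"
  proof
    assume "l1 = 0"
    then have "\<forall>r\<in>{0..S}. inner (B r) (v r) = 0"
      unfolding l1_def using S0
      by (subst (asm) integral_eq_0_iff) (auto intro!: continuous_intros contA cont simp: B_def)
    then have Bv: "inner (B r) (v r) = 0" if "0 < r" "r < S" for r using that by simp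
    have v0: "v r = 0" if r: "0 < r" "r < S" for r
    proof -
      have "(r * (S - r)) * inner (v r) (v r) = 0" using Bv[OF r] by (simp only: B_def inner_scaleR_left)
      moreover have "r * (S - r) \<noteq> 0" using r by simp
      ultimately show ?thesis by simp
    qed
    have vr: "v r = cos (\<omega> * r) *\<^sub>R snd w0 + (sin (\<omega> * r) / \<omega>) *\<^sub>R (\<tau> v* fst w0)" for r
      unfolding v_def w_def extremal_control_closed[OF \<tau>] A_op_A_op n\<tau>
      using \<omega> by (simp add: A_op_eq) (simp add: scaleR_diff_left)
    have "pi / \<omega> > 0" "pi / (2 * \<omega>) = (pi / \<omega>) / 2" "2 * pi / \<omega> = 2 * (pi / \<omega>)"
      using \<omega> by auto
    \<comment> \<open>Half and quarter period see \<open>\<eta>\<close> and the rotating part of \<open>\<xi>\<close> separately.\<close>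
    then have "v (pi / \<omega>) = 0" "v (pi / (2 * \<omega>)) = 0"
      using S by (intro v0; linarith)+
    then have "snd w0 = 0" "\<tau> v* fst w0 = 0" using \<omega> by (auto simp: vr)
    then have "A_op \<tau> w0 = 0" by (simp add: A_op_eq outer_simps zero_prod_def)
    then show False using A by simp
  qed
  obtain \<delta> where \<delta>: "n0 + \<delta> * n1 + \<delta> * \<delta> * n2 < 0" "l0 + \<delta> * l1 \<noteq> 0"
  proof -
    have "((\<lambda>\<delta>. n0 + \<delta> * n1 + \<delta> * \<delta> * n2) \<longlongrightarrow> n0 + 0 * n1 + 0 * 0 * n2) (at_right 0)"
      by (intro tendsto_intros)
    then have 1: "\<forall>\<^sub>F \<delta> in at_right 0. n0 + \<delta> * n1 + \<delta> * \<delta> * n2 < 0"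
      using n0 by (intro order_tendstoD) auto
    have "\<forall>\<^sub>F \<delta> in at_right (0::real). \<delta> \<noteq> - l0 / l1"
      by (rule eventually_neq_at_within)
    with 1 have "\<forall>\<^sub>F \<delta> in at_right 0. n0 + \<delta> * n1 + \<delta> * \<delta> * n2 < 0 \<and> \<delta> \<noteq> - l0 / l1"
      by (rule eventually_conj)
    then obtain \<delta> where "n0 + \<delta> * n1 + \<delta> * \<delta> * n2 < 0" "\<delta> \<noteq> - l0 / l1"
      using eventually_happens'[OF trivial_limit_at_right_real] by blast
    then show ?thesis using l1 by (intro that[of \<delta>]) (auto simp: field_simps add_eq_0_iff)
  qed
  define h where "h r = (outer \<theta> (A0 r + \<delta> *\<^sub>R B r), \<beta> r)" for r
  define h' where "h' r = (outer \<theta> (A0' r + \<delta> *\<^sub>R B' r), \<beta>' r)" for r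
  define qf where "qf r = inner (A0 r + \<delta> *\<^sub>R B r) (\<beta>' r) - inner (A0' r + \<delta> *\<^sub>R B' r) (\<beta> r)" for r
  define ef where "ef r = (norm (A0' r + \<delta> *\<^sub>R B' r))\<^sup>2 + (norm (\<beta>' r))\<^sup>2" for r
  have cqf: "continuous_on X qf" "continuous_on X ef" for X
    unfolding qf_def ef_def by (intro continuous_intros contA)+
  have intc: "(g has_integral integral {0..S} g) {0..S}" if "continuous_on {0..S} g" for g :: "real \<Rightarrow> real"
    using that by (intro integrable_integral integrable_continuous_real)
  have sin0: "((\<lambda>r. sin (\<mu> * r) / \<mu>) has_integral 0) {0..S}"
  proof -
    have "((\<lambda>r. - cos (\<mu> * r) / \<mu>\<^sup>2) has_vector_derivative sin (\<mu> * r) / \<mu>) (at r)" for r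
      using \<mu> by (auto simp: power2_eq_square simp flip: has_real_derivative_iff_has_vector_derivative intro!: derivative_eq_intros)
    from integral_derivative_loop[OF less_imp_le[OF S0] this] show ?thesis using \<mu> by simp
  qed
  have cos0: "((\<lambda>r. cos (\<mu> * r)) has_integral 0) {0..S}"
  proof -
    have "((\<lambda>r. sin (\<mu> * r) / \<mu>) has_vector_derivative cos (\<mu> * r)) (at r)" for r
      using \<mu> by (auto simp flip: has_real_derivative_iff_has_vector_derivative intro!: derivative_eq_intros)
    from integral_derivative_loop[OF less_imp_le[OF S0] this] show ?thesis using \<mu> by simp
  qed
  show ?thesis unfolding \<tau>_def
  proof (rule perturbation_shortens[OF \<theta> \<omega> S0 w0])
    show "(h has_vector_derivative h' r) (at r)" for r
      unfolding h_def h'_def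
      by (intro has_vector_derivative_Pair d\<beta>
          bounded_linear.has_vector_derivative[OF bounded_bilinear.bounded_linear_right[OF bounded_bilinear_outer]]
          has_vector_derivative_add dA0 bounded_linear.has_vector_derivative[OF bounded_linear_scaleR_right dB])
    show "continuous_on UNIV h'"
      unfolding h'_def
      by (intro continuous_intros contA bounded_linear.continuous_on[OF bounded_bilinear.bounded_linear_right[OF bounded_bilinear_outer]])
    show "h 0 = 0" by (simp add: h_def A0_def B_def \<beta>_def outer_simps zero_prod_def)
    show "h S = 0" using \<mu> by (simp add: h_def A0_def B_def \<beta>_def outer_simps zero_prod_def)
    show "((\<lambda>r. rhQ (h r) (extremal_control (fst w0, snd w0, \<omega> *\<^sub>R \<theta>) r)) has_integral ((l0 + \<delta> * l1) / 2) *\<^sub>R \<theta>) {0..S}"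
    proof -
      have "((\<lambda>r. ((lf r) + \<delta> * inner (B r) (v r)) / 2) has_integral (l0 + \<delta> * l1) / 2) {0..S}"
        unfolding l0_def l1_def
        by (intro has_integral_divide has_integral_add has_integral_mult_right intc continuous_intros contA cont clf)
      from has_integral_diff[OF has_integral_scaleR_left[OF this, of \<theta>] has_integral_scaleR_left[OF sin0, of "(1/2) *\<^sub>R (U *v f)"]]
      have "((\<lambda>r. (((lf r) + \<delta> * inner (B r) (v r)) / 2) *\<^sub>R \<theta> -
          (sin (\<mu> * r) / \<mu>) *\<^sub>R (1/2) *\<^sub>R (U *v f)) has_integral ((l0 + \<delta> * l1) / 2) *\<^sub>R \<theta>) {0..S}" by simp
      moreover have "(((lf r) + \<delta> * inner (B r) (v r)) / 2) *\<^sub>R \<theta> -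
          (sin (\<mu> * r) / \<mu>) *\<^sub>R (1/2) *\<^sub>R (U *v f) = rhQ (h r) (w r)" for r
        unfolding rhQ_eq u_def[symmetric] v_def[symmetric] uU
        by (simp add: h_def lf_def mat_vec_simps outer_mult_vec inner_add_left) (simp add: \<beta>_def mat_vec_simps add_divide_distrib diff_divide_distrib algebra_simps)
      ultimately show ?thesis by (simp add: w_def \<tau>_def)
    qed
    show "(l0 + \<delta> * l1) / 2 \<noteq> 0" using \<delta> by simp
    show "((\<lambda>r. rhQ (h r) (h' r)) has_integral (integral {0..S} qf / 2) *\<^sub>R \<theta>) {0..S}"
    proof -
      have "((\<lambda>r. (qf r / 2) *\<^sub>R \<theta>) has_integral (integral {0..S} qf / 2) *\<^sub>R \<theta>) {0..S}"
        by (intro has_integral_scaleR_left has_integral_divide intc cqf)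
      moreover have "(qf r / 2) *\<^sub>R \<theta> = rhQ (h r) (h' r)" for r
        unfolding rhQ_eq by (simp add: h_def h'_def outer_mult_vec qf_def add_divide_distrib diff_divide_distrib algebra_simps)
      ultimately show ?thesis by simp
    qed
    show "((\<lambda>r. (norm (h' r))\<^sup>2) has_integral integral {0..S} ef) {0..S}"
    proof -
      have "(norm (h' r))\<^sup>2 = ef r" for r
        by (simp add: h'_def norm_Pair norm_outer ef_def)
      then show ?thesis using intc[OF cqf(2)] by simp
    qed
    show "integral {0..S} ef < 2 * \<omega> * (integral {0..S} qf / 2)"
    proof -
      have 0: "((\<lambda>r. 1 - \<omega> * ((1 - cos (\<mu> * r)) / \<mu>)) has_integral n0) {0..S}"
        using has_integral_diff[OF has_integral_const_real[of 1 0 S]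
           has_integral_mult_right[OF has_integral_divide[OF has_integral_diff[OF has_integral_const_real[of 1 0 S] cos0], of \<mu>], of \<omega>]] S0
        by (simp add: n0_def)
      have "((\<lambda>r. (1 - \<omega> * ((1 - cos (\<mu> * r)) / \<mu>)) +
          \<delta> * (g1 r)
          + \<delta> * \<delta> * inner (B' r) (B' r)) has_integral (n0 + \<delta> * n1 + \<delta> * \<delta> * n2)) {0..S}"
        unfolding n1_def n2_def
        by (intro has_integral_add has_integral_mult_right 0 intc continuous_intros contA cg1)
      moreover have "(1 - \<omega> * ((1 - cos (\<mu> * r)) / \<mu>)) +
          \<delta> * (g1 r)
          + \<delta> * \<delta> * inner (B' r) (B' r) = ef r - \<omega> * qf r" for r
      proof -
        have "(norm (A0' r))\<^sup>2 + (norm (\<beta>' r))\<^sup>2 = 1"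
          by (simp add: A0'_def \<beta>'_def f power_mult_distrib)
        moreover have "inner (A0 r) (\<beta>' r) - inner (A0' r) (\<beta> r) = (1 - cos (\<mu> * r)) / \<mu>"
        proof -
          have "inner (A0 r) (\<beta>' r) - inner (A0' r) (\<beta> r) = ((cos (\<mu> * r) - 1) * cos (\<mu> * r) + (sin (\<mu> * r))\<^sup>2) / \<mu>"
            by (simp add: A0_def A0'_def \<beta>_def \<beta>'_def ff power2_eq_square add_divide_distrib)
          then show ?thesis by (simp add: sin_squared_eq power2_eq_square algebra_simps)
        qed
        moreover have "ef r - \<omega> * qf r = ((norm (A0' r))\<^sup>2 + (norm (\<beta>' r))\<^sup>2) - \<omega> * (inner (A0 r) (\<beta>' r) - inner (A0' r) (\<beta> r)) +
          \<delta> * (g1 r)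
          + \<delta> * \<delta> * inner (B' r) (B' r)"
          unfolding ef_def qf_def g1_def power2_norm_eq_inner
          by (simp add: inner_add inner_commute[of "B' r" "A0' r"]) (simp add: algebra_simps)
        ultimately show ?thesis by simp
      qed
      ultimately have "((\<lambda>r. ef r - \<omega> * qf r) has_integral (n0 + \<delta> * n1 + \<delta> * \<delta> * n2)) {0..S}" by simp
      moreover have "((\<lambda>r. ef r - \<omega> * qf r) has_integral (integral {0..S} ef - \<omega> * integral {0..S} qf)) {0..S}"
        by (intro has_integral_diff has_integral_mult_right intc cqf)
      ultimately have "integral {0..S} ef - \<omega> * integral {0..S} qf = n0 + \<delta> * n1 + \<delta> * \<delta> * n2"
        using has_integral_unique by blast
      then show ?thesis using \<delta> by simp
    qed
  qed
qed

section \<open>Cut times and cut points\<close>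

lemma A_op_eq_0_iff:
  assumes "norm \<theta> = 1" shows "A_op \<theta> (\<xi>, \<eta>) = 0 \<longleftrightarrow> \<theta> v* \<xi> = 0 \<and> \<eta> = 0"
proof -
  have "inner \<theta> \<theta> = 1" using assms by (simp add: norm_eq_1)
  then have "\<eta> = 0" if "outer \<theta> \<eta> = 0"
    using vec_mult_outer[of \<theta> \<theta> \<eta>] that by (simp add: vec_mat_simps)
  then show ?thesis by (auto simp: A_op_eq zero_prod_def outer_simps)
qed

lemma cut_time_straight:
  assumes "A_op \<tau> (\<xi>, \<eta>) = 0"
  shows "cut_time (\<xi>, \<eta>, \<tau>) = \<infinity>"
proof -
  have min: "minimizes_length s (extremal (\<xi>, \<eta>, \<tau>))" if s: "s > 0" for s
  proof (rule shortest_imp_minimizes(2)[OF horizontal_curve_extremal[OF s]])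
    fix T' \<gamma>' w'
    assume h: "horizontal_curve T' \<gamma>' w'" and 0: "\<gamma>' 0 = extremal (\<xi>, \<eta>, \<tau>) 0"
      and e: "\<gamma>' T' = extremal (\<xi>, \<eta>, \<tau>) s"
    have "hor (\<gamma>' T') = s *\<^sub>R (\<xi>, \<eta>)"
      using extremal_straight[OF assms, of s] by (simp add: e)
    moreover have "control_length s (extremal_control (\<xi>, \<eta>, \<tau>)) = s * norm (\<xi>, \<eta>)"
      using control_length_extremal[OF s, of "(\<xi>, \<eta>)"] by simp
    ultimately show "control_length s (extremal_control (\<xi>, \<eta>, \<tau>)) \<le> control_length T' w'"
      using length_ge_horizontal_distance[OF h] 0 s by (metis abs_of_pos extremal_0 norm_scaleR)
  qed
  show ?thesis
  proof (rule ereal_top)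
    fix B :: real
    have "ereal (max 1 B) \<le> cut_time (\<xi>, \<eta>, \<tau>)"
      unfolding cut_time_def by (intro Sup_upper CollectI exI[of _ "max 1 B"] conjI refl min) simp_all
    then show "ereal B \<le> cut_time (\<xi>, \<eta>, \<tau>)"
      by (rule order_trans[rotated]) simp
  qed
qed

text \<open>At the end of the period the length of the extremal is the isoperimetric bound for its endpoint.\<close>
lemma minimizes_until_period:
  fixes \<xi> :: "real^'p::finite^'q::finite" and \<eta> :: "real^'p"
  assumes \<theta>: "norm \<theta> = 1" and T: "T > 0"
  defines "\<zeta> \<equiv> (\<xi>, \<eta>, (2 * pi / T) *\<^sub>R \<theta>)"
  shows "minimizes_length T (extremal \<zeta>)" and "rh_dist 0 (extremal \<zeta> T) = T * norm (\<xi>, \<eta>)"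
proof -
  define a where "a = \<theta> v* \<xi>"
  define x where "x = T *\<^sub>R (\<xi> - outer \<theta> a)"
  define b where "b = - (T / (2 * pi)) *\<^sub>R a"
  define \<nu> where "\<nu> = T\<^sup>2 / (4 * pi) * ((norm a)\<^sup>2 + (norm \<eta>)\<^sup>2)"
  have end_pt: "extremal \<zeta> T = (x, 0, x *v b + \<nu> *\<^sub>R \<theta>)" and \<theta>x: "\<theta> v* x = 0"
    using extremal_at_period(1)[OF \<theta> T, of \<xi> \<eta>] extremal_at_period(2)[OF \<theta> T, of \<xi>]
    by (simp_all add: x_def a_def \<zeta>_def \<nu>_def b_def)
  have \<theta>\<theta>: "inner \<theta> \<theta> = 1" using \<theta> by (simp add: norm_eq_1)
  have len: "control_length T (extremal_control \<zeta>) = T * norm (\<xi>, \<eta>)"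
    using control_length_extremal[OF T, of "(\<xi>, \<eta>)"] by (simp add: \<zeta>_def)
  have "inner \<theta> (x *v b + \<nu> *\<^sub>R \<theta>) = \<nu>"
    by (simp add: inner_add inner_mat_vec \<theta>x \<theta>\<theta>)
  moreover have "(norm x)\<^sup>2 = T\<^sup>2 * ((norm \<xi>)\<^sup>2 - (norm a)\<^sup>2)"
  proof -
    have "inner (\<xi> - outer \<theta> a) (\<xi> - outer \<theta> a) = inner \<xi> \<xi> - inner a a"
      by (simp add: inner_diff inner_outer inner_outer' vec_mult_outer vec_mat_simps \<theta>\<theta> flip: a_def)
    then show ?thesis by (simp add: x_def power_mult_distrib power2_norm_eq_inner)
  qed
  ultimately have eq: "(norm x)\<^sup>2 + 4 * pi * inner \<theta> (x *v b + \<nu> *\<^sub>R \<theta>) = (T * norm (\<xi>, \<eta>))\<^sup>2"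
    by (simp add: \<nu>_def norm_Pair power_mult_distrib algebra_simps)
  have le: "control_length T (extremal_control \<zeta>) \<le> control_length T' w'"
    if "horizontal_curve T' \<gamma>' w'" "\<gamma>' 0 = extremal \<zeta> 0" "\<gamma>' T' = extremal \<zeta> T" for T' \<gamma>' w'
  proof -
    have "(T * norm (\<xi>, \<eta>))\<^sup>2 \<le> (control_length T' w')\<^sup>2"
      unfolding eq[symmetric]
      using length_ge_isoperimetric[OF that(1), of \<theta>] that A_op_eq_0_iff[OF \<theta>, of x 0] \<theta> \<theta>x
      by (simp add: end_pt norm_Pair)
    then show ?thesis unfolding len by (rule power2_le_imp_le[OF _ control_length_nonneg])
  qed
  show "minimizes_length T (extremal \<zeta>)"
    by (rule shortest_imp_minimizes(2)[OF horizontal_curve_extremal[OF T]]) (rule le)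
  have "rh_dist (extremal \<zeta> 0) (extremal \<zeta> T) = control_length T (extremal_control \<zeta>)"
    by (rule shortest_imp_minimizes(1)[OF horizontal_curve_extremal[OF T]]) (rule le)
  then show "rh_dist 0 (extremal \<zeta> T) = T * norm (\<xi>, \<eta>)" by (simp add: len)
qed

lemma cut_time_rotating:
  assumes \<theta>: "norm \<theta> = 1" and T: "T > 0" and A: "A_op \<theta> (\<xi>, \<eta>) \<noteq> 0"
  shows "cut_time (\<xi>, \<eta>, (2 * pi / T) *\<^sub>R \<theta>) = ereal T"
  unfolding cut_time_def
proof (rule Sup_eqI)
  let ?\<zeta> = "(\<xi>, \<eta>, (2 * pi / T) *\<^sub>R \<theta>)"
  show "y \<le> ereal T" if y: "y \<in> {ereal s |s. 0 < s \<and> minimizes_length s (extremal ?\<zeta>)}" for y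
  proof -
    obtain s where s: "y = ereal s" "minimizes_length s (extremal ?\<zeta>)" using y by auto
    have "s \<le> T"
    proof (rule ccontr)
      assume "\<not> s \<le> T"
      then have "\<not> minimizes_length s (extremal (fst (\<xi>, \<eta>), snd (\<xi>, \<eta>), (2 * pi / T) *\<^sub>R \<theta>))"
        using \<theta> T A by (intro not_minimizing_after_period) (auto simp: A_op_simps)
      then show False using s by simp
    qed
    then show ?thesis using s by simp
  qed
  show "ereal T \<le> z" if "\<And>y. y \<in> {ereal s |s. 0 < s \<and> minimizes_length s (extremal ?\<zeta>)} \<Longrightarrow> y \<le> z" for z
    using that[of "ereal T"] T minimizes_until_period(1)[OF \<theta> T, of \<xi> \<eta>] by auto
qed

lemma finite_cut_timeE:
  fixes \<xi> :: "real^'p::finite^'q::finite"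
  assumes "cut_time (\<xi>, \<eta>, \<tau>) = ereal s"
  obtains \<theta> where "norm \<theta> = 1" "s > 0" "\<tau> = (2 * pi / s) *\<^sub>R \<theta>" "A_op \<theta> (\<xi>, \<eta>) \<noteq> 0"
proof -
  have A: "A_op \<tau> (\<xi>, \<eta>) \<noteq> 0"
    using assms cut_time_straight[of \<tau> \<xi> \<eta>] by auto
  then have \<tau>: "\<tau> \<noteq> 0" by (auto simp: A_op_eq outer_simps vec_mat_simps zero_prod_def)
  define \<theta> where "\<theta> = (1 / norm \<tau>) *\<^sub>R \<tau>"
  define T where "T = 2 * pi / norm \<tau>"
  have \<theta>: "norm \<theta> = 1" and T: "T > 0" and \<tau>': "\<tau> = (2 * pi / T) *\<^sub>R \<theta>"
    using \<tau> by (auto simp: \<theta>_def T_def)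
  have A': "A_op \<theta> (\<xi>, \<eta>) \<noteq> 0" using A \<tau> unfolding \<theta>_def by (simp add: A_op_simps)
  have "s = T" using cut_time_rotating[OF \<theta> T A'] assms \<tau>' by simp
  then show ?thesis using that \<theta> T \<tau>' A' by blast
qed

definition vert_perp :: "real^'p::finite^'q::finite \<Rightarrow> real^'q \<Rightarrow> real^'q"
  where "vert_perp x t = proj_on (orthogonal_comp (mat_im x)) t"

text \<open>Here \<open>t = x b + \<nu> \<theta>\<close> with \<open>b = - (T / 2 \<pi>) a\<close>, and \<open>\<nu> = \<pi> |b|\<^sup>2 + T\<^sup>2 |\<eta>|\<^sup>2 / 4 \<pi>\<close>.  As \<open>x\<^sup>\<dagger> t\<close> is the
  shortest choice of \<open>b\<close>, this is at least \<open>\<pi> |x\<^sup>\<dagger> t|\<^sup>2\<close>, with equality only for \<open>\<eta> = 0\<close> and \<open>b = x\<^sup>\<dagger> t\<close>.\<close>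
lemma endpoint_at_cut_time:
  fixes \<xi> :: "real^'p::finite^'q::finite"
  assumes \<theta>: "norm \<theta> = 1" and T: "T > 0" and A: "A_op \<theta> (\<xi>, \<eta>) \<noteq> 0"
    and e: "extremal (\<xi>, \<eta>, (2 * pi / T) *\<^sub>R \<theta>) T = (x, y, t)"
  defines "a \<equiv> \<theta> v* \<xi>"
  shows "y = 0" and "x = T *\<^sub>R (\<xi> - outer \<theta> a)"
    and "vert_perp x t = (T\<^sup>2 / (4 * pi) * ((norm a)\<^sup>2 + (norm \<eta>)\<^sup>2)) *\<^sub>R \<theta>"
    and "norm (vert_perp x t) = T\<^sup>2 / (4 * pi) * ((norm a)\<^sup>2 + (norm \<eta>)\<^sup>2)"
    and "vert_perp x t \<noteq> 0"
    and "pi * (norm (moore_penrose x *v t))\<^sup>2 \<le> norm (vert_perp x t)"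
    and "norm (vert_perp x t) = pi * (norm (moore_penrose x *v t))\<^sup>2 \<Longrightarrow>
      \<eta> = 0 \<and> a = - (2 * pi / T) *\<^sub>R (moore_penrose x *v t)"
proof -
  define b where "b = - (T / (2 * pi)) *\<^sub>R a"
  define \<nu> where "\<nu> = T\<^sup>2 / (4 * pi) * ((norm a)\<^sup>2 + (norm \<eta>)\<^sup>2)"
  show y: "y = 0" and x: "x = T *\<^sub>R (\<xi> - outer \<theta> a)"
    using extremal_at_period(1)[OF \<theta> T, of \<xi> \<eta>] e by (simp_all add: a_def)
  have t: "t = x *v b + \<nu> *\<^sub>R \<theta>"
    using extremal_at_period(1)[OF \<theta> T, of \<xi> \<eta>] e by (simp add: a_def b_def \<nu>_def)
  have "\<theta> v* x = 0" using extremal_at_period(2)[OF \<theta> T, of \<xi>] by (simp add: x a_def)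
  then have v: "(\<nu> *\<^sub>R \<theta>) v* x = 0" by (simp add: vec_mat_simps)
  have V: "vert_perp x t = \<nu> *\<^sub>R \<theta>" using proj_on_mat_im(2)[OF v, of b] by (simp add: vert_perp_def t)
  then show "vert_perp x t = (T\<^sup>2 / (4 * pi) * ((norm a)\<^sup>2 + (norm \<eta>)\<^sup>2)) *\<^sub>R \<theta>" by (simp add: \<nu>_def)
  have "a \<noteq> 0 \<or> \<eta> \<noteq> 0" using A A_op_eq_0_iff[OF \<theta>] by (auto simp: a_def)
  then have "(norm a)\<^sup>2 + (norm \<eta>)\<^sup>2 > 0" by (auto simp: add_pos_nonneg add_nonneg_pos)
  then have \<nu>: "\<nu> > 0" using T by (simp add: \<nu>_def)
  have nV: "norm (vert_perp x t) = \<nu>" using \<theta> \<nu> by (simp add: V)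
  then show "norm (vert_perp x t) = T\<^sup>2 / (4 * pi) * ((norm a)\<^sup>2 + (norm \<eta>)\<^sup>2)" by (simp add: \<nu>_def)
  show "vert_perp x t \<noteq> 0" using nV \<nu> by auto
  let ?n = "moore_penrose x *v t"
  have nb: "norm ?n \<le> norm b" and bn: "norm b \<le> norm ?n \<Longrightarrow> b = ?n"
    using norm_moore_penrose_le[OF v, of b] by (simp_all add: t)
  have pb: "pi * (norm b)\<^sup>2 = T\<^sup>2 / (4 * pi) * (norm a)\<^sup>2"
    by (simp add: b_def power_mult_distrib power_divide power2_eq_square)
  have \<nu>b: "\<nu> = pi * (norm b)\<^sup>2 + T\<^sup>2 / (4 * pi) * (norm \<eta>)\<^sup>2"
    unfolding pb by (simp add: \<nu>_def algebra_simps add_divide_distrib)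
  have le: "pi * (norm ?n)\<^sup>2 \<le> pi * (norm b)\<^sup>2"
    using nb by (intro mult_left_mono power_mono) auto
  moreover have "0 \<le> T\<^sup>2 / (4 * pi) * (norm \<eta>)\<^sup>2" by simp
  ultimately show "pi * (norm ?n)\<^sup>2 \<le> norm (vert_perp x t)" unfolding nV \<nu>b by linarith
  assume "norm (vert_perp x t) = pi * (norm ?n)\<^sup>2"
  then have "pi * (norm b)\<^sup>2 + T\<^sup>2 / (4 * pi) * (norm \<eta>)\<^sup>2 = pi * (norm ?n)\<^sup>2" unfolding nV \<nu>b .
  with le \<open>0 \<le> T\<^sup>2 / (4 * pi) * (norm \<eta>)\<^sup>2\<close>
  have 1: "T\<^sup>2 / (4 * pi) * (norm \<eta>)\<^sup>2 = 0" and 2: "pi * (norm b)\<^sup>2 \<le> pi * (norm ?n)\<^sup>2" by linarith+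
  have "b = ?n"
    using 2 by (intro bn power2_le_imp_le[OF _ norm_ge_zero]) simp
  then have "a = - (2 * pi / T) *\<^sub>R ?n" using T unfolding b_def[symmetric] by (simp add: b_def flip: \<open>b = ?n\<close>)
  then show "\<eta> = 0 \<and> a = - (2 * pi / T) *\<^sub>R ?n" using 1 T by simp
qed

text \<open>Conversely, the projections of \<open>t\<close> prescribe \<open>\<theta>\<close> and the rotating part \<open>a = - (2 \<pi> / T) x\<^sup>\<dagger> t\<close> of \<open>\<xi>\<close>, and what
  the area needs beyond \<open>a\<close> is supplied by \<open>\<eta>\<close>, of which only the norm matters.  The period \<open>T\<close> is free; it
  will be \<open>1\<close>, or the length of the curve when unit speed is required.\<close>
lemma extremal_to_cut_point:
  fixes x :: "real^'p::finite^'q::finite" and t :: "real^'q" and \<eta> :: "real^'p"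
  assumes N: "vert_perp x t \<noteq> 0" and T: "T > 0"
    and \<eta>: "T\<^sup>2 / (4 * pi) * (norm \<eta>)\<^sup>2 = norm (vert_perp x t) - pi * (norm (moore_penrose x *v t))\<^sup>2"
  defines "\<theta> \<equiv> (1 / norm (vert_perp x t)) *\<^sub>R vert_perp x t"
  defines "\<xi> \<equiv> (1 / T) *\<^sub>R x + outer \<theta> (- (2 * pi / T) *\<^sub>R (moore_penrose x *v t))"
  shows "norm \<theta> = 1" and "extremal (\<xi>, \<eta>, (2 * pi / T) *\<^sub>R \<theta>) T = (x, 0, t)"
    and "A_op \<theta> (\<xi>, \<eta>) \<noteq> 0"
    and "T * norm (\<xi>, \<eta>) = sqrt ((norm x)\<^sup>2 + 4 * pi * norm (vert_perp x t))"
proof -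
  define n where "n = moore_penrose x *v t"
  define a where "a = - (2 * pi / T) *\<^sub>R n"
  show \<theta>: "norm \<theta> = 1" using N by (simp add: \<theta>_def)
  have \<theta>\<theta>: "inner \<theta> \<theta> = 1" using \<theta> by (simp add: norm_eq_1)
  have N\<theta>: "vert_perp x t = norm (vert_perp x t) *\<^sub>R \<theta>" using N by (simp add: \<theta>_def)
  have \<theta>x: "\<theta> v* x = 0" using moore_penrose_decomp(2)[where x = x and t = t] by (simp add: \<theta>_def vert_perp_def vec_mat_simps)
  have t: "t = x *v n + vert_perp x t" using moore_penrose_decomp(1)[where x = x and t = t] by (simp add: n_def vert_perp_def)
  have \<xi>: "\<xi> = (1 / T) *\<^sub>R x + outer \<theta> a" by (simp add: \<xi>_def a_def n_def)
  have a: "\<theta> v* \<xi> = a" by (simp add: \<xi> vec_mat_simps \<theta>x vec_mult_outer \<theta>\<theta>)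
  have x: "T *\<^sub>R (\<xi> - outer \<theta> a) = x" using T by (simp add: \<xi>)
  have b: "- (T / (2 * pi)) *\<^sub>R a = n" using T by (simp add: a_def)
  have na: "T\<^sup>2 / (4 * pi) * (norm a)\<^sup>2 = pi * (norm n)\<^sup>2"
    using T by (simp add: a_def power_mult_distrib power_divide power2_eq_square)
  have \<nu>: "T\<^sup>2 / (4 * pi) * ((norm a)\<^sup>2 + (norm \<eta>)\<^sup>2) = norm (vert_perp x t)"
    unfolding distrib_left na \<eta> by (simp add: n_def)
  show e: "extremal (\<xi>, \<eta>, (2 * pi / T) *\<^sub>R \<theta>) T = (x, 0, t)"
  proof -
    have "extremal (\<xi>, \<eta>, (2 * pi / T) *\<^sub>R \<theta>) T = (x, 0, x *v n + norm (vert_perp x t) *\<^sub>R \<theta>)"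
      using extremal_at_period(1)[OF \<theta> T, of \<xi> \<eta>] unfolding a x b \<nu> .
    also have "x *v n + norm (vert_perp x t) *\<^sub>R \<theta> = t"
      unfolding N\<theta>[symmetric] by (rule t[symmetric])
    finally show ?thesis .
  qed
  show "A_op \<theta> (\<xi>, \<eta>) \<noteq> 0"
  proof
    assume "A_op \<theta> (\<xi>, \<eta>) = 0"
    then have "a = 0" "\<eta> = 0" using A_op_eq_0_iff[OF \<theta>] a by auto
    then show False using \<nu> N by simp
  qed
  have "(T * norm (\<xi>, \<eta>))\<^sup>2 = (norm x)\<^sup>2 + 4 * pi * norm (vert_perp x t)"
  proof -
    have "T\<^sup>2 * (norm \<xi>)\<^sup>2 = (norm x)\<^sup>2 + T\<^sup>2 * (norm a)\<^sup>2"
      using T unfolding power2_norm_eq_inner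
      by (simp add: \<xi> inner_add inner_outer inner_outer' vec_mat_simps vec_mult_outer \<theta>\<theta> \<theta>x power2_eq_square field_simps)
    moreover have "4 * pi * norm (vert_perp x t) = T\<^sup>2 * (norm a)\<^sup>2 + T\<^sup>2 * (norm \<eta>)\<^sup>2"
      unfolding \<nu>[symmetric] by (simp add: distrib_left)
    ultimately show ?thesis by (simp add: norm_Pair power_mult_distrib distrib_left)
  qed
  then show "T * norm (\<xi>, \<eta>) = sqrt ((norm x)\<^sup>2 + 4 * pi * norm (vert_perp x t))"
    using T by (intro real_sqrt_unique[symmetric]) auto
qed

lemma cut_point_reached:
  fixes x :: "real^'p::finite^'q::finite" and t :: "real^'q"
  assumes N: "vert_perp x t \<noteq> 0" and le: "pi * (norm (moore_penrose x *v t))\<^sup>2 \<le> norm (vert_perp x t)"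
  obtains \<xi> and \<eta> :: "real^'p" and \<theta> where "norm \<theta> = 1" "extremal (\<xi>, \<eta>, (2 * pi / 1) *\<^sub>R \<theta>) 1 = (x, 0, t)"
    "A_op \<theta> (\<xi>, \<eta>) \<noteq> 0" "norm (\<xi>, \<eta>) = sqrt ((norm x)\<^sup>2 + 4 * pi * norm (vert_perp x t))"
proof -
  obtain \<eta> :: "real^'p" where "norm \<eta> = sqrt (4 * pi * (norm (vert_perp x t) - pi * (norm (moore_penrose x *v t))\<^sup>2))"
    using vector_choose_size[of "sqrt (4 * pi * (norm (vert_perp x t) - pi * (norm (moore_penrose x *v t))\<^sup>2))"] le by auto
  then have "1\<^sup>2 / (4 * pi) * (norm \<eta>)\<^sup>2 = norm (vert_perp x t) - pi * (norm (moore_penrose x *v t))\<^sup>2"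
    using le by simp
  note E = extremal_to_cut_point[OF N zero_less_one this]
  show ?thesis using that[OF E(1,2,3)] E(4) by simp
qed

lemma mem_cut_locus_iff:
  fixes x :: "real^'p::finite^'q::finite" and t :: "real^'q"
  shows "(x, y, t) \<in> cut_locus \<longleftrightarrow>
    y = 0 \<and> vert_perp x t \<noteq> 0 \<and> pi * (norm (moore_penrose x *v t))\<^sup>2 \<le> norm (vert_perp x t)"
proof
  assume "(x, y, t) \<in> cut_locus"
  then obtain \<xi> \<eta> \<tau> s where e: "(x, y, t) = extremal (\<xi>, \<eta>, \<tau>) s" and c: "cut_time (\<xi>, \<eta>, \<tau>) = ereal s"
    by (auto simp: cut_locus_def)
  obtain \<theta> where \<theta>: "norm \<theta> = 1" "s > 0" "\<tau> = (2 * pi / s) *\<^sub>R \<theta>" "A_op \<theta> (\<xi>, \<eta>) \<noteq> 0"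
    using finite_cut_timeE[OF c] by metis
  have "extremal (\<xi>, \<eta>, (2 * pi / s) *\<^sub>R \<theta>) s = (x, y, t)" using e \<theta>(3) by simp
  from endpoint_at_cut_time(1,5,6)[OF \<theta>(1,2,4) this]
  show "y = 0 \<and> vert_perp x t \<noteq> 0 \<and> pi * (norm (moore_penrose x *v t))\<^sup>2 \<le> norm (vert_perp x t)"
    by (intro conjI)
next
  assume *: "y = 0 \<and> vert_perp x t \<noteq> 0 \<and> pi * (norm (moore_penrose x *v t))\<^sup>2 \<le> norm (vert_perp x t)"
  then obtain \<xi> and \<eta> :: "real^'p" and \<theta> where \<theta>: "norm \<theta> = 1"
    "extremal (\<xi>, \<eta>, (2 * pi / 1) *\<^sub>R \<theta>) 1 = (x, 0, t)" "A_op \<theta> (\<xi>, \<eta>) \<noteq> 0"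
    using cut_point_reached[of x t] by metis
  have "(\<xi>, \<eta>) \<noteq> 0" using \<theta>(3) A_op_simps(5) by metis
  moreover have "cut_time (\<xi>, \<eta>, (2 * pi / 1) *\<^sub>R \<theta>) = ereal 1" by (rule cut_time_rotating[OF \<theta>(1) _ \<theta>(3)]) simp
  ultimately show "(x, y, t) \<in> cut_locus"
    unfolding cut_locus_def using \<theta>(2)[symmetric] * by blast
qed

lemma cut_point_dist:
  fixes x :: "real^'p::finite^'q::finite" and t :: "real^'q"
  assumes "(x, 0, t) \<in> (cut_locus :: ('q, 'p) RH set)"
  shows "rh_dist 0 ((x, 0, t) :: ('q, 'p) RH) = sqrt ((norm x)\<^sup>2 + 4 * pi * norm (vert_perp x t))"
proof -
  obtain \<xi> and \<eta> :: "real^'p" and \<theta> where \<theta>: "norm \<theta> = 1"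
    "extremal (\<xi>, \<eta>, (2 * pi / 1) *\<^sub>R \<theta>) 1 = (x, 0, t)"
    "norm (\<xi>, \<eta>) = sqrt ((norm x)\<^sup>2 + 4 * pi * norm (vert_perp x t))"
    using assms cut_point_reached[of x t] unfolding mem_cut_locus_iff by metis
  from minimizes_until_period(2)[OF \<theta>(1) zero_less_one, of \<xi> \<eta>] \<theta> show ?thesis by simp
qed

section \<open>Uniqueness of minimizers\<close>

lemma unit_speed_minimizer_duration:
  assumes "unit_speed_minimizer g T \<gamma>"
  obtains w where "horizontal_curve T \<gamma> w" "AE s\<in>{0..T} in lebesgue. norm (w s) = 1" "T = rh_dist 0 g"
proof -
  from assms obtain w w' where w: "horizontal_curve T \<gamma> w" "AE s\<in>{0..T} in lebesgue. norm (w s) = 1"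
    and w': "horizontal_curve T \<gamma> w'" "control_length T w' = rh_dist 0 g"
    by (auto simp: unit_speed_minimizer_def unit_speed_def minimizes_length_def)
  have T: "T > 0" using w by (simp add: horizontal_curve_def)
  obtain N where N: "negligible N" "\<And>s. s \<in> {0..T} - N \<Longrightarrow> norm (w s) = 1"
    using w(2)[unfolded AE_negligible_iff] by auto
  have "((\<lambda>s. 1) has_integral control_length T w) {0..T}"
    by (rule has_integral_spike[OF N(1) _ horizontal_curve_lengthD[OF w(1)]]) (simp add: N(2))
  moreover have "((\<lambda>s. 1) has_integral T) {0..T}"
    using has_integral_const_real[of "1::real" 0 T] T by simp
  ultimately have "control_length T w = T" by (rule has_integral_unique)
  then show ?thesis using that[OF w] control_length_unique[OF w(1) w'(1)] w'(2) by simp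
qed

text \<open>For a minimizer to a cut point, with \<open>\<theta>\<close> in the direction of the projection of \<open>t\<close>, the isoperimetric bound is
  attained.  Rigidity gives the horizontal part, and the vertical one follows by integration.\<close>
lemma unit_speed_minimizer_is_extremal:
  fixes x :: "real^'p::finite^'q::finite" and \<gamma> :: "real \<Rightarrow> ('q, 'p) RH"
  assumes \<gamma>: "unit_speed_minimizer (x, 0, t) T \<gamma>" and \<theta>: "norm \<theta> = 1" "\<theta> v* x = 0"
    and T2: "T\<^sup>2 = (norm x)\<^sup>2 + 4 * pi * inner \<theta> t"
  obtains \<xi> \<eta> where "\<And>s. s \<in> {0..T} \<Longrightarrow> \<gamma> s = extremal (\<xi>, \<eta>, (2 * pi / T) *\<^sub>R \<theta>) s"
proof -
  interpret skew_rotation "\<lambda>z. - A_op \<theta> z" by (rule skew_rotation_A_op) (simp add: \<theta>)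
  obtain w where h: "horizontal_curve T \<gamma> w" and u: "AE s\<in>{0..T} in lebesgue. norm (w s) = 1"
    using unit_speed_minimizer_duration[OF \<gamma>] .
  have 0: "\<gamma> 0 = 0" and e: "\<gamma> T = (x, 0, t)" using \<gamma> by (auto simp: unit_speed_minimizer_def)
  obtain N1 where N1: "negligible N1" "\<And>s. s \<in> {0..T} - N1 \<Longrightarrow> norm (w s) = 1"
    using u[unfolded AE_negligible_iff] by auto
  obtain N2 where T: "T > 0" and N2: "negligible N2" and lip: "lip {0..T} \<gamma>"
    and d2: "\<And>s. s \<in> {0..T} - N2 \<Longrightarrow> (\<gamma> has_vector_derivative horizontal_velocity (\<gamma> s) (w s)) (at s within {0..T})"
    by (rule horizontal_curveE[OF h]) blast
  define N where "N = N1 \<union> N2"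
  have N: "negligible N" using N1(1) N2 by (simp add: N_def negligible_Un)
  have unit: "norm (w s) = 1" if "s \<in> {0..T} - N" for s using N1(2) that by (simp add: N_def)
  have d: "(\<gamma> has_vector_derivative horizontal_velocity (\<gamma> s) (w s)) (at s within {0..T})" if "s \<in> {0..T} - N" for s
    using d2 that by (simp add: N_def)
  note dz = has_vector_derivative_horizontal(1)[OF d] and dt = has_vector_derivative_horizontal(2)[OF d]
  have JT: "- A_op \<theta> (hor (\<gamma> T)) = 0" using e \<theta> by (simp add: A_op_eq outer_simps zero_prod_def)
  obtain C where C: "P C = C" "\<And>s. s \<in> {0..T} \<Longrightarrow> hor (\<gamma> s) = (s / T) *\<^sub>R hor (\<gamma> T)
      + (sin (pi * s / T) * cos (pi * s / T)) *\<^sub>R C + (sin (pi * s / T))\<^sup>2 *\<^sub>R (- A_op \<theta> C)"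
  proof (rule length_bound_rigidity[OF T N, where z = "\<lambda>s. hor (\<gamma> s)" and w = w and M = "\<lambda>s. 2 * inner \<theta> (snd (snd (\<gamma> s)))"])
    show "lip {0..T} (\<lambda>s. hor (\<gamma> s))" by (rule lip_linear[OF bounded_linear_hor lip])
    show "lip {0..T} (\<lambda>s. 2 * inner \<theta> (snd (snd (\<gamma> s))))"
      by (rule twice_vertical(1)[OF lip])
    show "((\<lambda>s. 2 * inner \<theta> (snd (snd (\<gamma> s)))) has_vector_derivative inner (- A_op \<theta> (hor (\<gamma> s))) (w s)) (at s within {0..T})"
      if "s \<in> {0..T} - N" for s
      by (rule twice_vertical(2)) (rule d, rule that)
    show "- A_op \<theta> (hor (\<gamma> T)) = 0" by (rule JT)
    show "T\<^sup>2 \<le> (norm (hor (\<gamma> T)))\<^sup>2 + 2 * pi * (2 * inner \<theta> (snd (snd (\<gamma> T))))"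
      using T2 by (simp add: e norm_Pair)
    show "hor (\<gamma> 0) = 0" "2 * inner \<theta> (snd (snd (\<gamma> 0))) = 0" by (simp_all add: 0 zero_prod_def)
    show "((\<lambda>s. hor (\<gamma> s)) has_vector_derivative w s) (at s within {0..T})" "norm (w s) = 1"
      if "s \<in> {0..T} - N" for s using dz[OF that] unit[OF that] by simp_all
  qed blast
  define \<omega> where "\<omega> = 2 * pi / T"
  have \<omega>: "\<omega> > 0" using T by (simp add: \<omega>_def)
  define \<tau> where "\<tau> = \<omega> *\<^sub>R \<theta>"
  have n\<tau>: "norm \<tau> = \<omega>" and \<tau>0: "\<tau> \<noteq> 0" using \<omega> \<theta> by (auto simp: \<tau>_def)
  define w0 where "w0 = (1 / T) *\<^sub>R hor (\<gamma> T) + (\<omega> / 2) *\<^sub>R C"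
  define \<zeta> where "\<zeta> = (fst w0, snd w0, \<tau>)"
  have ext: "extremal \<zeta> s = (fst (rot_hor \<omega> \<tau> w0 s), snd (rot_hor \<omega> \<tau> w0 s), rot_vert \<omega> \<tau> w0 s)" for s
    using extremal_rotating[OF \<tau>0, of w0 s] by (simp add: \<zeta>_def n\<tau>)
  have A0: "A_op \<theta> (hor (\<gamma> T)) = 0" using JT by simp
  have A1: "A_op \<tau> w0 = (\<omega>\<^sup>2 / 2) *\<^sub>R A_op \<theta> C"
    unfolding w0_def \<tau>_def A_op_simps A0 by (simp add: power2_eq_square)
  have "A_op \<theta> (A_op \<theta> C) = - C"
    using C(1) by (simp add: P_def A_op_simps) (metis minus_minus)
  then have A2: "A_op \<tau> (A_op \<tau> w0) = - ((\<omega> ^ 3 / 2) *\<^sub>R C)"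
    unfolding A1 unfolding \<tau>_def A_op_simps by (simp add: power2_eq_square power3_eq_cube)
  have hor_eq: "hor (\<gamma> s) = rot_hor \<omega> \<tau> w0 s" if s: "s \<in> {0..T}" for s
  proof -
    define p where "p = pi * s / T"
    have p: "\<omega> * s = 2 * p" by (simp add: \<omega>_def p_def)
    have "rot_hor \<omega> \<tau> w0 s = s *\<^sub>R w0 - ((1 - cos (2 * p)) / \<omega>\<^sup>2 * (\<omega>\<^sup>2 / 2)) *\<^sub>R A_op \<theta> C
        - ((s - sin (2 * p) / \<omega>) / \<omega>\<^sup>2 * (\<omega> ^ 3 / 2)) *\<^sub>R C"
      unfolding rot_hor_def p A2 unfolding A1 by simp
    also have "(1 - cos (2 * p)) / \<omega>\<^sup>2 * (\<omega>\<^sup>2 / 2) = (sin p)\<^sup>2"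
      using \<omega> by (simp add: cos_double_sin)
    also have "(s - sin (2 * p) / \<omega>) / \<omega>\<^sup>2 * (\<omega> ^ 3 / 2) = s * (\<omega> / 2) - sin p * cos p"
      unfolding sin_double using \<omega> by (simp add: field_simps power2_eq_square power3_eq_cube)
    finally show ?thesis
      unfolding C(2)[OF s] by (simp add: w0_def p_def algebra_simps scaleR_diff_left)
  qed
  have dext: "(extremal \<zeta> has_vector_derivative horizontal_velocity (extremal \<zeta> s) (extremal_control \<zeta> s)) (at s)" for s
    by (rule extremal_has_vector_derivative)
  have horext: "hor (extremal \<zeta> s) = rot_hor \<omega> \<tau> w0 s" for s by (simp add: ext)
  have ctrl: "w s = extremal_control \<zeta> s" if s: "s \<in> {0..T} - N" for s
  proof -
    have "((\<lambda>s. rot_hor \<omega> \<tau> w0 s) has_vector_derivative extremal_control \<zeta> s) (at s within {0..T})"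
      using has_vector_derivative_at_within[OF has_vector_derivative_horizontal(1)[OF dext]] by (simp add: horext)
    moreover have "((\<lambda>s. rot_hor \<omega> \<tau> w0 s) has_vector_derivative w s) (at s within {0..T})"
      by (rule has_vector_derivative_transform[OF _ _ dz[OF s]]) (use s hor_eq in auto)
    ultimately show ?thesis
      using s T by (intro vector_derivative_unique_within_closed_interval[of 0 T s]) auto
  qed
  have vert_eq: "snd (snd (\<gamma> s)) = snd (snd (extremal \<zeta> s))" if s: "s \<in> {0..T}" for s
  proof -
    have lipe: "lip {0..T} (extremal \<zeta>)"
      using horizontal_curve_extremal[OF T, of \<zeta>] unfolding horizontal_curve_def lip_def by blast
    define F where "F s = snd (snd (\<gamma> s)) - snd (snd (extremal \<zeta> s))" for s
    have "lip {0..T} F" unfolding F_def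
      by (intro lip_diff lip_linear[OF bounded_linear_vert] lip lipe)
    then obtain L where L: "L-lipschitz_on {0..T} F" by (auto simp: lip_def)
    have dF: "(F has_vector_derivative 0) (at r within {0..T})" if r: "r \<in> {0..T} - N" for r
    proof -
      have "(F has_vector_derivative rhQ (hor (\<gamma> r)) (w r) - rhQ (hor (extremal \<zeta> r)) (extremal_control \<zeta> r)) (at r within {0..T})"
        unfolding F_def
        by (intro has_vector_derivative_diff dt[OF r] has_vector_derivative_at_within[OF has_vector_derivative_horizontal(2)[OF dext]])
      then show ?thesis using r ctrl[OF r] hor_eq[of r] by (simp add: horext)
    qed
    have sub: "{0..s} \<subseteq> {0..T}" using s by auto
    have "((\<lambda>r. 0) has_integral (F s - F 0)) {0..s}"
      using s by (intro lipschitz_FTC[OF _ lipschitz_on_subset[OF L sub] N])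
        (auto intro: has_vector_derivative_within_subset[OF dF sub])
    then have "F s - F 0 = 0" using has_integral_unique has_integral_0 by blast
    then show ?thesis by (simp add: F_def 0)
  qed
  have "\<gamma> s = extremal \<zeta> s" if s: "s \<in> {0..T}" for s
    using hor_eq[OF s] vert_eq[OF s] horext[of s] by (metis fst_conv prod.collapse snd_conv)
  then show ?thesis using that by (simp add: \<zeta>_def \<tau>_def \<omega>_def)
qed

lemma snd_rot_hor:
  assumes "\<tau> \<noteq> 0"
  shows "snd (rot_hor (norm \<tau>) \<tau> w s) = (sin (norm \<tau> * s) / norm \<tau>) *\<^sub>R snd w
    + ((1 - cos (norm \<tau> * s)) / (norm \<tau>)\<^sup>2) *\<^sub>R (\<tau> v* fst w)"
  using assms unfolding rot_hor_def A_op_A_op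
  by (simp add: A_op_eq) (simp add: scaleR_diff_left)

lemma unit_speed_minimizer_extremal:
  fixes \<xi> :: "real^'p::finite^'q::finite" and \<eta> :: "real^'p"
  assumes \<theta>: "norm \<theta> = 1" and T: "T > 0" and e: "extremal (\<xi>, \<eta>, (2 * pi / T) *\<^sub>R \<theta>) T = g" and n: "norm (\<xi>, \<eta>) = 1"
  shows "unit_speed_minimizer g T (extremal (\<xi>, \<eta>, (2 * pi / T) *\<^sub>R \<theta>))"
proof -
  have "norm (extremal_control (\<xi>, \<eta>, \<tau>) s) = 1" for \<tau> s
    using norm_extremal_control[of "(\<xi>, \<eta>)" \<tau> s] n by simp
  then have "unit_speed T (extremal (\<xi>, \<eta>, (2 * pi / T) *\<^sub>R \<theta>))"
    unfolding unit_speed_def using horizontal_curve_extremal[OF T]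
    by (intro exI[of _ "extremal_control (\<xi>, \<eta>, (2 * pi / T) *\<^sub>R \<theta>)"] conjI AE_I2 impI)
  then show ?thesis
    using minimizes_until_period(1)[OF \<theta> T] e by (simp add: unit_speed_minimizer_def)
qed

text \<open>Without equality the extremals to \<open>\<eta>0 \<noteq> 0\<close> and \<open>- \<eta>0\<close> both minimize and differ after a quarter of the period.
  With equality every minimizer is an extremal whose covector is determined by the endpoint.\<close>
lemma unique_unit_speed_minimizer_iff:
  fixes x :: "real^'p::finite^'q::finite" and t :: "real^'q"
  assumes cut: "(x, 0, t) \<in> (cut_locus :: ('q, 'p) RH set)"
  shows "unique_unit_speed_minimizer ((x, 0, t) :: ('q, 'p) RH) \<longleftrightarrow>
    norm (vert_perp x t) = pi * (norm (moore_penrose x *v t))\<^sup>2"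
proof -
  have N: "vert_perp x t \<noteq> 0" and le: "pi * (norm (moore_penrose x *v t))\<^sup>2 \<le> norm (vert_perp x t)"
    using cut by (auto simp: mem_cut_locus_iff)
  let ?d = "norm (vert_perp x t) - pi * (norm (moore_penrose x *v t))\<^sup>2"
  define T where "T = sqrt ((norm x)\<^sup>2 + 4 * pi * norm (vert_perp x t))"
  have T: "T > 0" unfolding T_def using N by (auto intro!: add_nonneg_pos)
  have dist: "rh_dist 0 ((x, 0, t) :: ('q, 'p) RH) = T" using cut_point_dist[OF cut] by (simp add: T_def)
  define \<theta> where "\<theta> = (1 / norm (vert_perp x t)) *\<^sub>R vert_perp x t"
  let ?\<tau> = "(2 * pi / T) *\<^sub>R \<theta>"
  define \<xi> where "\<xi> = (1 / T) *\<^sub>R x + outer \<theta> (- (2 * pi / T) *\<^sub>R (moore_penrose x *v t))"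
  have ex: "norm \<theta> = 1 \<and> A_op \<theta> (\<xi>, \<eta>) \<noteq> 0 \<and> extremal (\<xi>, \<eta>, ?\<tau>) T = (x, 0, t)
      \<and> unit_speed_minimizer (x, 0, t) T (extremal (\<xi>, \<eta>, ?\<tau>))"
    if \<eta>: "T\<^sup>2 / (4 * pi) * (norm \<eta>)\<^sup>2 = ?d" for \<eta> :: "real^'p"
  proof -
    note E = extremal_to_cut_point[OF N T \<eta>, folded \<theta>_def, folded \<xi>_def, folded T_def]
    have "norm (\<xi>, \<eta>) = 1" using E(4) T by simp
    then show ?thesis using E unit_speed_minimizer_extremal[OF E(1) T E(2)] by blast
  qed
  obtain \<eta>0 :: "real^'p" where "norm \<eta>0 = sqrt (4 * pi * (?d)) / T"
    using vector_choose_size[of "sqrt (4 * pi * (?d)) / T"] le T by auto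
  then have \<eta>0: "T\<^sup>2 / (4 * pi) * (norm \<eta>0)\<^sup>2 = ?d"
    using le T by (simp add: power_divide)
  have \<theta>: "norm \<theta> = 1" using ex[OF \<eta>0] by simp
  show ?thesis
  proof
    assume "unique_unit_speed_minimizer ((x, 0, t) :: ('q, 'p) RH)"
    then obtain T' \<gamma> where uniq: "\<And>T'' \<gamma>'. unit_speed_minimizer (x, 0, t) T'' \<gamma>' \<Longrightarrow> T'' = T' \<and> (\<forall>s\<in>{0..T'}. \<gamma>' s = (\<gamma> s :: ('q, 'p) RH))"
      unfolding unique_unit_speed_minimizer_def by blast
    have m\<eta>0: "T\<^sup>2 / (4 * pi) * (norm (- \<eta>0))\<^sup>2 = ?d"
      using \<eta>0 by simp
    note u1 = uniq[OF conjunct2[OF conjunct2[OF conjunct2[OF ex[OF \<eta>0]]]]]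
      and u2 = uniq[OF conjunct2[OF conjunct2[OF conjunct2[OF ex[OF m\<eta>0]]]]]
    have "T / 4 \<in> {0..T'}" using u1 T by auto
    note b1 = bspec[OF conjunct2[OF u1] this] and b2 = bspec[OF conjunct2[OF u2] this]
    have "extremal (\<xi>, \<eta>0, ?\<tau>) (T / 4) = extremal (\<xi>, - \<eta>0, ?\<tau>) (T / 4)"
      by (rule trans[OF b1 b2[symmetric]])
    moreover have \<tau>: "?\<tau> \<noteq> 0" "norm (?\<tau>) = 2 * pi / T" using \<theta> T by auto
    ultimately have "snd (rot_hor (2 * pi / T) (?\<tau>) (\<xi>, \<eta>0) (T / 4)) = snd (rot_hor (2 * pi / T) (?\<tau>) (\<xi>, - \<eta>0) (T / 4))"
      using extremal_rotating[OF \<tau>(1), of "(\<xi>, \<eta>0)"] extremal_rotating[OF \<tau>(1), of "(\<xi>, - \<eta>0)"] by simp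
    then have "(sin (pi / 2) / (2 * pi / T)) *\<^sub>R \<eta>0 = - ((sin (pi / 2) / (2 * pi / T)) *\<^sub>R \<eta>0)"
      using snd_rot_hor[OF \<tau>(1), of "(\<xi>, \<eta>0)" "T / 4"] snd_rot_hor[OF \<tau>(1), of "(\<xi>, - \<eta>0)" "T / 4"] T
      unfolding \<tau>(2) by simp
    then have "(sin (pi / 2) / (2 * pi / T) + sin (pi / 2) / (2 * pi / T)) *\<^sub>R \<eta>0 = 0"
      by (simp only: scaleR_add_left eq_neg_iff_add_eq_0)
    then have "\<eta>0 = 0" using T by simp
    then show "norm (vert_perp x t) = pi * (norm (moore_penrose x *v t))\<^sup>2" using \<eta>0 by simp
  next
    assume eq: "norm (vert_perp x t) = pi * (norm (moore_penrose x *v t))\<^sup>2"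
    have z: "T\<^sup>2 / (4 * pi) * (norm (0 :: real^'p))\<^sup>2 = ?d"
      using eq by simp
    show "unique_unit_speed_minimizer ((x, 0, t) :: ('q, 'p) RH)"
      unfolding unique_unit_speed_minimizer_def
    proof (intro exI conjI allI impI)
      show "unit_speed_minimizer (x, 0, t) T (extremal (\<xi>, 0, ?\<tau>))" using ex[OF z] by blast
      fix T' and \<gamma> :: "real \<Rightarrow> ('q, 'p) RH" assume \<gamma>: "unit_speed_minimizer (x, 0, t) T' \<gamma>"
      show T': "T' = T" using unit_speed_minimizer_duration[OF \<gamma>] dist by metis
      have \<theta>x: "\<theta> v* x = 0"
        using moore_penrose_decomp(2)[where x = x and t = t] by (simp add: \<theta>_def vert_perp_def vec_mat_simps)
      have "inner \<theta> t = norm (vert_perp x t)"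
      proof -
        have "inner \<theta> t = inner \<theta> (x *v (moore_penrose x *v t)) + inner \<theta> (vert_perp x t)"
          using moore_penrose_decomp(1)[where x = x and t = t] by (metis inner_add_right vert_perp_def)
        also have "\<dots> = norm (vert_perp x t)"
          using N by (simp add: inner_mat_vec \<theta>x) (simp add: \<theta>_def dot_square_norm power2_eq_square)
        finally show ?thesis .
      qed
      then have "T\<^sup>2 = (norm x)\<^sup>2 + 4 * pi * inner \<theta> t" by (simp add: T_def)
      then obtain \<xi>' \<eta>' where \<gamma>': "\<And>s. s \<in> {0..T} \<Longrightarrow> \<gamma> s = extremal (\<xi>', \<eta>', ?\<tau>) s"
        using unit_speed_minimizer_is_extremal[OF \<gamma>[unfolded T'] \<theta> \<theta>x] by blast
      have e: "extremal (\<xi>', \<eta>', ?\<tau>) T = (x, 0, t)"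
        using \<gamma>'[of T] \<gamma> T by (simp add: unit_speed_minimizer_def T')
      have A: "A_op \<theta> (\<xi>', \<eta>') \<noteq> 0"
      proof
        assume A: "A_op \<theta> (\<xi>', \<eta>') = 0"
        then have "A_op (?\<tau>) (\<xi>', \<eta>') = 0" by (simp add: A_op_simps)
        from extremal_straight[OF this, of T] have "t = 0" using e by simp
        then have "inner \<theta> t = 0" by simp
        then show False using \<open>inner \<theta> t = norm (vert_perp x t)\<close> N by simp
      qed
      have "\<eta>' = 0" "\<theta> v* \<xi>' = - (2 * pi / T) *\<^sub>R (moore_penrose x *v t)"
        using endpoint_at_cut_time(7)[OF \<theta> T A e eq] by auto
      moreover have "\<xi>' = (1 / T) *\<^sub>R x + outer \<theta> (\<theta> v* \<xi>')"
        using T by (subst endpoint_at_cut_time(2)[OF \<theta> T A e]) simp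
      ultimately have "\<xi>' = \<xi>" "\<eta>' = 0" by (simp_all add: \<xi>_def)
      then show "\<forall>s\<in>{0..T}. \<gamma> s = extremal (\<xi>, 0, ?\<tau>) s" using \<gamma>' by simp
    qed
  qed
qed

section \<open>Conjugate points\<close>

lemma bounded_bilinear_A_op: "bounded_bilinear (A_op :: real^'q::finite \<Rightarrow> ('q, 'p::finite) V1 \<Rightarrow> _)"
  by (auto simp: bilinear_def A_op_eq outer_simps vec_mat_simps simp flip: bilinear_conv_bounded_bilinear
      intro!: linearI)

lemma differentiable_bilinear:
  assumes "bounded_bilinear h" "f differentiable (at x)" "g differentiable (at x)"
  shows "(\<lambda>x. h (f x) (g x)) differentiable (at x)"
  using assms bounded_bilinear.FDERIV[OF assms(1)] unfolding differentiable_def by blast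

lemma differentiable_bounded_linear: "bounded_linear f \<Longrightarrow> f differentiable (at x)"
  using bounded_linear_imp_has_derivative unfolding differentiable_def by blast

text \<open>Away from \<open>\<tau> = 0\<close> the closed form is a smooth function of the covector, because the norm of \<open>\<tau>\<close> is.\<close>
lemma extremal_differentiable:
  fixes \<zeta> :: "('q::finite, 'p::finite) RH"
  assumes \<tau>: "snd (snd \<zeta>) \<noteq> 0"
  shows "(\<lambda>\<zeta>. extremal \<zeta> s) differentiable (at \<zeta>)"
proof -
  let ?\<tau> = "\<lambda>\<zeta> :: ('q, 'p) RH. snd (snd \<zeta>)" and ?w = "\<lambda>\<zeta> :: ('q, 'p) RH. hor \<zeta>"
  let ?A = "\<lambda>\<zeta> :: ('q, 'p) RH. A_op (?\<tau> \<zeta>) (?w \<zeta>)" and ?B = "\<lambda>\<zeta> :: ('q, 'p) RH. A_op (?\<tau> \<zeta>) (A_op (?\<tau> \<zeta>) (?w \<zeta>))"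
  let ?z = "\<lambda>\<zeta>. rot_hor (norm (?\<tau> \<zeta>)) (?\<tau> \<zeta>) (?w \<zeta>) s" and ?t = "\<lambda>\<zeta>. rot_vert (norm (?\<tau> \<zeta>)) (?\<tau> \<zeta>) (?w \<zeta>) s"
  have n: "norm (?\<tau> \<zeta>) \<noteq> 0" using \<tau> by simp
  have d\<tau>: "?\<tau> differentiable (at \<zeta>)" by (rule differentiable_bounded_linear[OF bounded_linear_vert])
  have dw: "?w differentiable (at \<zeta>)" by (rule differentiable_bounded_linear[OF bounded_linear_hor])
  have dn: "(\<lambda>\<zeta>. norm (?\<tau> \<zeta>)) differentiable (at \<zeta>)"
    using differentiable_compose[of norm ?\<tau> \<zeta> UNIV] d\<tau> \<tau> differentiable_norm_at[of "?\<tau> \<zeta>"] by (auto intro: differentiable_at_withinI)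
  have dA: "?A differentiable (at \<zeta>)" by (intro differentiable_bilinear[OF bounded_bilinear_A_op] d\<tau> dw)
  have dB: "?B differentiable (at \<zeta>)" by (intro differentiable_bilinear[OF bounded_bilinear_A_op] d\<tau> dA)
  have real_comp: "(\<lambda>\<zeta>. f (norm (?\<tau> \<zeta>))) differentiable (at \<zeta>)" if "f differentiable (at (norm (?\<tau> \<zeta>)))" for f :: "real \<Rightarrow> real"
    using differentiable_chain_at[OF dn that] by (simp add: o_def)
  have dsin: "(\<lambda>\<zeta>. sin (norm (?\<tau> \<zeta>) * s)) differentiable (at \<zeta>)"
    by (rule real_comp) (auto simp: real_differentiable_def intro!: derivative_eq_intros exI)
  have dcos: "(\<lambda>\<zeta>. cos (norm (?\<tau> \<zeta>) * s)) differentiable (at \<zeta>)"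
    by (rule real_comp) (auto simp: real_differentiable_def intro!: derivative_eq_intros exI)
  have dz: "?z differentiable (at \<zeta>)"
    unfolding rot_hor_def
    by (intro differentiable_add differentiable_diff differentiable_scaleR differentiable_divide
        differentiable_power dsin dcos dn dA dB dw differentiable_const) (use n in auto)
  have dt: "?t differentiable (at \<zeta>)"
    unfolding rot_vert_def
    by (intro differentiable_add differentiable_diff differentiable_scaleR differentiable_divide differentiable_mult
        differentiable_power dsin dcos dn dA dB dw differentiable_const
        differentiable_bilinear[OF bounded_bilinear_rhQ]) (use n in auto)
  have dlin: "(\<lambda>\<zeta>. l (f \<zeta>)) differentiable (at \<zeta>)" if "bounded_linear l" "f differentiable (at \<zeta>)"
    for l :: "'b::real_normed_vector \<Rightarrow> 'c::real_normed_vector" and f :: "('q, 'p) RH \<Rightarrow> 'b"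
    using differentiable_chain_at[OF that(2) differentiable_bounded_linear[OF that(1)]] by (simp add: o_def)
  have "(\<lambda>\<zeta>. (fst (?z \<zeta>), snd (?z \<zeta>),
      ?t \<zeta>)) differentiable (at \<zeta>)"
    by (intro differentiable_Pair dt dlin[OF bounded_linear_fst dz] dlin[OF bounded_linear_snd dz])
  then obtain D where D: "((\<lambda>\<zeta>. (fst (?z \<zeta>), snd (?z \<zeta>),
      ?t \<zeta>)) has_derivative D) (at \<zeta>)"
    unfolding differentiable_def by blast
  have "((\<lambda>\<zeta>. extremal \<zeta> s) has_derivative D) (at \<zeta>)"
  proof (rule has_derivative_transform_within_open[OF D])
    have "open {\<zeta> :: ('q, 'p) RH. snd (snd \<zeta>) \<noteq> 0}"
      by (intro open_Collect_neq continuous_intros)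
    then show "open {\<zeta> :: ('q, 'p) RH. snd (snd \<zeta>) \<noteq> 0}" .
    show "\<zeta> \<in> {\<zeta>. snd (snd \<zeta>) \<noteq> 0}" using \<tau> by simp
    fix \<zeta>' :: "('q, 'p) RH" assume "\<zeta>' \<in> {\<zeta>. snd (snd \<zeta>) \<noteq> 0}"
    then show "(fst (?z \<zeta>'), snd (?z \<zeta>'),
      ?t \<zeta>') = extremal \<zeta>' s"
      using extremal_rotating[of "?\<tau> \<zeta>'" "?w \<zeta>'" s] by simp
  qed
  then show ?thesis unfolding differentiable_def by blast
qed

text \<open>At the period the endpoint depends on \<open>\<eta>\<close> through \<open>|\<eta>|\<^sup>2\<close> only, and moving \<open>\<eta>\<close> orthogonally to itself
  changes that to second order.  So the differential has a kernel.\<close>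
lemma conjugate_at_period:
  fixes \<xi> :: "real^'p::finite^'q::finite" and \<eta> :: "real^'p"
  assumes \<theta>: "norm \<theta> = 1" and T: "T > 0" and p: "CARD('p) \<ge> 2"
  shows "conjugate_time (\<xi>, \<eta>, (2 * pi / T) *\<^sub>R \<theta>) T"
proof -
  let ?\<tau> = "(2 * pi / T) *\<^sub>R \<theta>"
  have \<tau>0: "?\<tau> \<noteq> 0" using \<theta> T by auto
  obtain D where D: "((\<lambda>\<zeta>. extremal \<zeta> T) has_derivative D) (at (\<xi>, \<eta>, ?\<tau>))"
    using extremal_differentiable[of "(\<xi>, \<eta>, ?\<tau>)" T] \<tau>0 unfolding differentiable_def by auto
  obtain v :: "real^'p" where v: "v \<noteq> 0" "orthogonal \<eta> v"
    using orthogonal_to_vector_exists[of \<eta>] p by auto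
  define \<nu> where "\<nu> = T\<^sup>2 / (4 * pi)"
  define f where "f e = extremal (\<xi>, \<eta> + e *\<^sub>R v, ?\<tau>) T" for e
  have line: "((\<lambda>e. (\<xi>, \<eta> + e *\<^sub>R v, ?\<tau>)) has_derivative (\<lambda>e. (0, e *\<^sub>R v, 0))) (at 0)"
    by (auto intro!: derivative_eq_intros)
  have "(f has_derivative (\<lambda>e. D (0, e *\<^sub>R v, 0))) (at 0)"
    unfolding f_def using diff_chain_at[OF line, of "\<lambda>\<zeta>. extremal \<zeta> T" D] D by (simp add: o_def)
  moreover have "(f has_derivative (\<lambda>e. 0)) (at 0)"
  proof -
    obtain x u where f: "f e = (x, 0, u + (\<nu> * (norm (\<eta> + e *\<^sub>R v))\<^sup>2) *\<^sub>R \<theta>)" for e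
      unfolding f_def extremal_at_period(1)[OF \<theta> T] \<nu>_def distrib_left scaleR_add_left add.assoc[symmetric] by blast
    have "(norm (\<eta> + e *\<^sub>R v))\<^sup>2 = (norm \<eta>)\<^sup>2 + e\<^sup>2 * (norm v)\<^sup>2" for e
      using v(2) by (simp add: power2_norm_eq_inner inner_add orthogonal_def inner_commute power2_eq_square[of e])
    then have "f = (\<lambda>e. (x, 0, u + (\<nu> * ((norm \<eta>)\<^sup>2 + e\<^sup>2 * (norm v)\<^sup>2)) *\<^sub>R \<theta>))" using f by auto
    then show ?thesis by (auto intro!: derivative_eq_intros simp: zero_prod_def)
  qed
  ultimately have "(\<lambda>e. D (0, e *\<^sub>R v, 0)) = (\<lambda>e. 0)" by (rule has_derivative_unique)
  from fun_cong[OF this, of 1] have "D (0, v, 0) = 0" by simp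
  moreover have "D 0 = 0" using D by (simp add: has_derivative_def linear_simps bounded_linear.linear linear_0)
  moreover have "(0, v, 0) \<noteq> (0 :: ('q, 'p) RH)" using v by (simp add: zero_prod_def)
  ultimately have "\<not> inj D" by (metis injD)
  then have "\<not> bij D" by (simp add: bij_def)
  then show ?thesis unfolding conjugate_time_def using T D by blast
qed

theorem theorem1p2:
  shows
    "(cut_locus :: ('q::finite, 'p::finite) RH set) =
       {(x, 0, t) | x t. t \<notin> mat_im x \<and>
          norm (proj_on (orthogonal_comp (mat_im x)) t) \<ge> pi * (norm (moore_penrose x *v t))\<^sup>2}
     \<and> (CARD('p) \<ge> 2 \<longrightarrow>
         (\<forall>(\<xi> :: real^'p^'q) (\<eta> :: real^'p) (\<tau> :: real^'q) s.
            (\<xi>, \<eta>) \<noteq> 0 \<and> cut_time (\<xi>, \<eta>, \<tau>) = ereal s \<longrightarrow> conjugate_time (\<xi>, \<eta>, \<tau>) s))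
     \<and> (\<forall>(x :: real^'p^'q) (t :: real^'q). (x, 0, t) \<in> (cut_locus :: ('q, 'p) RH set) \<longrightarrow>
         (unique_unit_speed_minimizer ((x, 0, t) :: ('q, 'p) RH) \<longleftrightarrow>
          norm (proj_on (orthogonal_comp (mat_im x)) t) = pi * (norm (moore_penrose x *v t))\<^sup>2))
     \<and> (\<forall>(x :: real^'p^'q) (t :: real^'q). (x, 0, t) \<in> (cut_locus :: ('q, 'p) RH set) \<longrightarrow>
         rh_dist 0 ((x, 0, t) :: ('q, 'p) RH) =
           sqrt ((norm x)\<^sup>2 + 4 * pi * norm (proj_on (orthogonal_comp (mat_im x)) t)))"
proof (intro conjI impI allI)
  show "(cut_locus :: ('q, 'p) RH set) =
       {(x, 0, t) | x t. t \<notin> mat_im x \<and>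
          norm (proj_on (orthogonal_comp (mat_im x)) t) \<ge> pi * (norm (moore_penrose x *v t))\<^sup>2}"
    by (rule set_eqI) (auto simp: mem_cut_locus_iff vert_perp_def moore_penrose_decomp(3))
next
  fix \<xi> :: "real^'p^'q" and \<eta> :: "real^'p" and \<tau> :: "real^'q" and s
  assume "CARD('p) \<ge> 2" and c: "(\<xi>, \<eta>) \<noteq> 0 \<and> cut_time (\<xi>, \<eta>, \<tau>) = ereal s"
  then obtain \<theta> where "norm \<theta> = 1" "s > 0" "\<tau> = (2 * pi / s) *\<^sub>R \<theta>"
    using finite_cut_timeE by metis
  then show "conjugate_time (\<xi>, \<eta>, \<tau>) s"
    using conjugate_at_period \<open>CARD('p) \<ge> 2\<close> by simp
qed (simp_all add: unique_unit_speed_minimizer_iff cut_point_dist vert_perp_def)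

end
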